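(* Let $(S_n)_{n\ge 0}$ be the discrete-time simple symmetric random walk on $\mathbb{Z}$ with $S_0=0$. For $n\in\mathbb{N}$ and $x\in\mathbb{Z}$ let $\xi(x,n)=\#\{0\le j\le n: S_j=x\}$, let $\mathcal{R}(n)=\{x\in\mathbb{Z}:\exists i\in[0,n],\ S_i=x\}$, and let $f(n)=\min\{\xi(x,n):x\in\mathcal{R}(n)\}$. Then, with probability $1$, $$\limsup_{n\to\infty}\frac{f(n)}{\log\log n}=\frac{1}{\log 2}.$$
   Context: Here $\xi(x,n)$ is the local time (number of visits) at site $x$ up to time $n$, $\mathcal{R}(n)$ is the range (set of visited sites) up to time $n$, and $f(n)$ is the minimal local time, i.e. the smallest number of visits among all sites in the range at time $n$. $\log$ denotes the natural logarithm. *)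

theory Defs
  imports "HOL-Probability.Probability"
begin

(* Measurability of the steps is part of indep_vars. *)
locale simple_symmetric_random_walk = prob_space M
  for M :: "'a measure" and S :: "nat \<Rightarrow> 'a \<Rightarrow> int" +
  assumes start: "\<And>\<omega>. \<omega> \<in> space M \<Longrightarrow> S 0 \<omega> = 0"
    and steps_indep:
      "indep_vars (\<lambda>_. count_space UNIV) (\<lambda>n \<omega>. S (Suc n) \<omega> - S n \<omega>) UNIV"
    and step_up: "\<And>n. prob {\<omega> \<in> space M. S (Suc n) \<omega> - S n \<omega> = 1} = 1/2"
    and step_down: "\<And>n. prob {\<omega> \<in> space M. S (Suc n) \<omega> - S n \<omega> = -1} = 1/2"

(* The following are functionals of a single trajectory s. *)

definition local_time :: "(nat \<Rightarrow> int) \<Rightarrow> int \<Rightarrow> nat \<Rightarrow> nat" where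
  "local_time s x n = card {j. j \<le> n \<and> s j = x}"

definition visited_sites :: "(nat \<Rightarrow> int) \<Rightarrow> nat \<Rightarrow> int set" where
  "visited_sites s n = {x. \<exists>i\<le>n. s i = x}"

definition min_local_time :: "(nat \<Rightarrow> int) \<Rightarrow> nat \<Rightarrow> nat" where
  "min_local_time s n = Min {local_time s x n | x. x \<in> visited_sites s n}"

end

theory Submission
  imports Defs "HOL-Library.Sublist" "HOL-Real_Asymp.Real_Asymp"
begin

text \<open>
  The walk is driven by independent fair coin tosses, so everything is decided about streams of
  tosses.  The reason for the threshold \<open>ln (ln n) / ln 2\<close> is the following.  The range is an
  interval, one of whose two ends is older than the other.  As long as the older end stays an end
  of the range, each visit to it is followed with probability 1/2 by a step out of the range, so it
  collects \<open>k\<close> visits with probability about \<open>2^-k\<close>.  The older end is replaced only when the walk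
  crosses the whole range.  At the moment at which the range gets its \<open>w\<close>-th site this happens with
  probability of order \<open>1/w\<close>, independently for different \<open>w\<close>; as the range is polynomially
  large in \<open>n\<close>, there are of the order of \<open>ln n\<close> such crossings up to time \<open>n\<close>.  The best of them
  makes \<open>2^k\<close> comparable with \<open>ln n\<close>.

  For the upper bound the older end alone is considered.  The event that it is heavy has probability
  at most a constant times \<open>k 2^-k / w\<close> (\<open>pr_crossing_returns\<close>), every time has an older end
  (\<open>old_end\<close>), and the first Borel-Cantelli lemma over dyadic scales of \<open>w\<close> finishes the argument
  (\<open>min_local_time_upper\<close>).

  For the lower bound it must be shown that all other sites can be given \<open>k\<close> visits at a cost that
  is negligible compared with \<open>2^-k\<close>.  There are three zones.

  \<^item> Sites at a distance polynomial in \<open>k\<close> from the older end get their visits from \<open>k\<close> ordinary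
    excursions and about \<open>k^(3/4)\<close> tall ones; this has probability at least \<open>2^-((1+\<epsilon>)k)\<close>
    (\<open>local_thick_lower\<close>).

  \<^item> The bulk of the range is traversed twice, towards the older end and back.  A single traversal
    leaves a site at distance \<open>i\<close> from an end with fewer than \<open>k\<close> visits with probability of order
    \<open>k/i\<close>, two traversals with probability of order \<open>k^2/i^2\<close>, and this is summable
    (\<open>pr_thin_turn\<close>).

  \<^item> Near the newer end the sites are fresh, and one waits for a moment at which all of them have
    \<open>k\<close> visits just before the range grows.  These moments form a renewal sequence, whose
    expected number up to level \<open>N\<close> is at least a multiple of a harmonic sum; hence the probability of waiting for
    long tends to 0 (\<open>sum_renewals_no_renewal\<close>, \<open>pr_late_renewal_ge\<close>).

  Summed over the possible positions of the two ends at scale \<open>A\<close>, this gives a success probability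
  of order \<open>2^-((1+\<epsilon>)k)\<close> for every scale (\<open>pr_thick_range\<close>).  Scales \<open>9^i\<close> are treated in successive
  independent stages; with \<open>k\<close> about \<open>(1-\<delta>) log 2 i\<close> the success probabilities of the stages have a
  divergent sum, so that infinitely many stages succeed (\<open>min_local_time_infinitely_often\<close>).

  Stopping times never appear as random variables.  An event that is decided at a stopping time is a
  set of finite words of tosses, and the strong Markov property becomes the multiplicativity of
  probabilities under concatenation (\<open>pr_conc\<close>).
\<close>

section \<open>Fair coin tosses and sets of words\<close>

definition coin_tosses :: "bool stream measure" where
  "coin_tosses = stream_space (measure_pmf (bernoulli_pmf (1/2)))"

lemma sets_coin_tosses[measurable_cong]:
  "sets coin_tosses = sets (stream_space (count_space UNIV))"
  unfolding coin_tosses_def by (rule sets_stream_space_cong) simp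

lemma space_coin_tosses[simp]: "space coin_tosses = UNIV"
  by (simp add: coin_tosses_def space_stream_space)

interpretation coin: prob_space coin_tosses
  unfolding coin_tosses_def by (rule prob_space.prob_space_stream_space[OF prob_space_measure_pmf])

text \<open>
  An event that is decided at a stopping time is given by the set \<open>W\<close> of all words of tosses that
  can have been read at that time.
\<close>

definition cyl :: "bool list set \<Rightarrow> bool stream set" where
  "cyl W = {s. \<exists>n. stake n s \<in> W}"

definition pr :: "bool list set \<Rightarrow> real" where
  "pr W = measure coin_tosses (cyl W)"

definition conc :: "'a list set \<Rightarrow> 'a list set \<Rightarrow> 'a list set" (infixr "\<odot>" 75) where
  "A \<odot> B = {u @ v | u v. u \<in> A \<and> v \<in> B}"

text \<open>
  Along one stream a prefix-free set is met at most once, as is the case for the words read up to a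
  stopping time.
\<close>

definition prefix_free :: "'a list set \<Rightarrow> bool" where
  "prefix_free W \<longleftrightarrow> (\<forall>u\<in>W. \<forall>v\<in>W. prefix u v \<longrightarrow> u = v)"

lemma prefix_freeD: "prefix_free W \<Longrightarrow> u \<in> W \<Longrightarrow> v \<in> W \<Longrightarrow> prefix u v \<Longrightarrow> u = v"
  by (auto simp: prefix_free_def)

lemma prefix_free_subset: "prefix_free W \<Longrightarrow> V \<subseteq> W \<Longrightarrow> prefix_free V"
  by (auto simp: prefix_free_def)

lemma prefix_free_Nil[simp]: "prefix_free {[]}"
  by (auto simp: prefix_free_def)

lemma concI: "u \<in> A \<Longrightarrow> v \<in> B \<Longrightarrow> u @ v \<in> A \<odot> B"
  by (auto simp: conc_def)

lemma conc_mono: "A \<subseteq> A' \<Longrightarrow> B \<subseteq> B' \<Longrightarrow> A \<odot> B \<subseteq> A' \<odot> B'"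
  by (auto simp: conc_def)

lemma prefix_free_conc:
  assumes "prefix_free A" "prefix_free B" shows "prefix_free (A \<odot> B)"
  unfolding prefix_free_def
proof (intro ballI impI)
  fix x y assume "x \<in> A \<odot> B" "y \<in> A \<odot> B" and p: "prefix x y"
  then obtain u v u' v' where x: "x = u @ v" "u \<in> A" "v \<in> B" and y: "y = u' @ v'" "u' \<in> A" "v' \<in> B"
    by (auto simp: conc_def)
  have "prefix u y" "prefix u' y" using p x y by (auto dest: append_prefixD)
  then have "prefix u u' \<or> prefix u' u" by (rule prefix_same_cases)
  then have "u = u'" using assms(1) x(2) y(2) unfolding prefix_free_def by blast
  then show "x = y" using p x y prefix_freeD[OF assms(2), of v v'] by simp
qed

lemma stake_prefix: "m \<le> n \<Longrightarrow> prefix (stake m s) (stake n s)"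
  using stake_add[of m s "n - m"] by (metis le_add_diff_inverse prefixI)

lemma prefix_stakeD: "prefix u (stake n s) \<Longrightarrow> u = stake (length u) s"
proof -
  assume p: "prefix u (stake n s)"
  then have "length u \<le> n" using prefix_length_le by fastforce
  moreover have "u = take (length u) (stake n s)" using p by (auto simp: prefix_def)
  ultimately show ?thesis by (simp add: take_stake min_absorb1)
qed

lemma sets_cyl[measurable, simp]: "cyl W \<in> sets coin_tosses"
proof -
  have "cyl W = (\<Union>n. (stake n) -` W \<inter> space (stream_space (count_space UNIV)))"
    by (auto simp: cyl_def space_stream_space)
  moreover have "(stake n) -` W \<inter> space (stream_space (count_space (UNIV::bool set))) \<in> sets (stream_space (count_space UNIV))" for n
    by (rule measurable_sets[OF measurable_stake]) simp
  ultimately show ?thesis unfolding sets_coin_tosses by auto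
qed

lemma pr_nonneg[simp]: "0 \<le> pr W" by (simp add: pr_def)
lemma pr_le_1[simp]: "pr W \<le> 1" by (simp add: pr_def)
lemma pr_empty[simp]: "pr {} = 0" by (simp add: pr_def cyl_def)
lemma pr_Nil: "[] \<in> W \<Longrightarrow> pr W = 1"
proof -
  assume "[] \<in> W"
  then have "cyl W = UNIV" unfolding cyl_def by (metis (mono_tags, lifting) UNIV_eq_I mem_Collect_eq stake.simps(1))
  then show ?thesis using coin.prob_space by (simp add: pr_def)
qed

text \<open>
  Reading on makes an event smaller: a stream that starts with a word starts with its prefixes.
\<close>

lemma pr_mono_prefix:
  assumes "\<And>w. w \<in> A \<Longrightarrow> \<exists>u\<in>B. prefix u w"
  shows "pr A \<le> pr B"
proof -
  have "cyl A \<subseteq> cyl B"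
  proof
    fix s assume "s \<in> cyl A"
    then obtain n where "stake n s \<in> A" by (auto simp: cyl_def)
    from assms[OF this] obtain u where "prefix u (stake n s)" "u \<in> B" by auto
    then show "s \<in> cyl B" using prefix_stakeD[of u n s] unfolding cyl_def by (intro CollectI exI[of _ "length u"]) simp
  qed
  then show ?thesis unfolding pr_def by (intro coin.finite_measure_mono) auto
qed

lemma pr_mono: "A \<subseteq> B \<Longrightarrow> pr A \<le> pr B"
  by (rule pr_mono_prefix) auto

lemma cyl_Un: "cyl (A \<union> B) = cyl A \<union> cyl B"
  by (auto simp: cyl_def)

lemma pr_Un: "pr (A \<union> B) \<le> pr A + pr B"
  unfolding pr_def cyl_Un by (rule measure_Un_le) auto

lemma pr_UN: "finite I \<Longrightarrow> pr (\<Union>i\<in>I. A i) \<le> (\<Sum>i\<in>I. pr (A i))"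
proof (induction I rule: finite_induct)
  case (insert x F)
  then show ?case using pr_Un[of "A x" "\<Union>i\<in>F. A i"] by (auto intro: order_trans)
qed simp

text \<open>
  Two words of \<open>U\<close> that occur in one stream are comparable, hence equal; so disjoint subsets of \<open>U\<close>
  are disjoint events.
\<close>

lemma pr_disjoint_sum:
  assumes "finite I" "\<And>i. i \<in> I \<Longrightarrow> A i \<subseteq> U" "prefix_free U"
    "\<And>i j. i \<in> I \<Longrightarrow> j \<in> I \<Longrightarrow> i \<noteq> j \<Longrightarrow> A i \<inter> A j = {}"
  shows "(\<Sum>i\<in>I. pr (A i)) = pr (\<Union>i\<in>I. A i)"
proof -
  have "disjoint_family_on (\<lambda>i. cyl (A i)) I"
    unfolding disjoint_family_on_def
  proof (intro ballI impI, rule ccontr)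
    fix i j assume ij: "i \<in> I" "j \<in> I" "i \<noteq> j" "cyl (A i) \<inter> cyl (A j) \<noteq> {}"
    then obtain s m n where s: "stake m s \<in> A i" "stake n s \<in> A j" by (auto simp: cyl_def)
    then have U: "stake m s \<in> U" "stake n s \<in> U" using assms(2) ij by auto
    have "stake m s = stake n s"
    proof (cases "m \<le> n")
      case True then show ?thesis using prefix_freeD[OF assms(3) U] stake_prefix by blast
    next
      case False
      then have "prefix (stake n s) (stake m s)" by (intro stake_prefix) auto
      then show ?thesis using prefix_freeD[OF assms(3) U(2,1)] by simp
    qed
    with s assms(4)[OF ij(1-3)] show False by auto
  qed
  then have "measure coin_tosses (\<Union>i\<in>I. cyl (A i)) = (\<Sum>i\<in>I. measure coin_tosses (cyl (A i)))"
    using assms(1) by (intro coin.finite_measure_finite_Union) auto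
  moreover have "(\<Union>i\<in>I. cyl (A i)) = cyl (\<Union>i\<in>I. A i)" by (auto simp: cyl_def)
  ultimately show ?thesis by (simp add: pr_def)
qed

lemma emeasure_step:
  assumes "X \<in> sets coin_tosses"
  shows "emeasure coin_tosses X =
    ennreal (1/2) * emeasure coin_tosses {s. True ## s \<in> X} + ennreal (1/2) * emeasure coin_tosses {s. False ## s \<in> X}"
proof -
  have "emeasure coin_tosses X = (\<integral>\<^sup>+t. emeasure coin_tosses {x. t ## x \<in> X} \<partial>measure_pmf (bernoulli_pmf (1/2)))"
    using prob_space.emeasure_stream_space[OF prob_space_measure_pmf, of X "bernoulli_pmf (1/2)"] assms
    by (simp add: coin_tosses_def[symmetric])
  also have "\<dots> = ennreal (1/2) * emeasure coin_tosses {s. True ## s \<in> X} + ennreal (1/2) * emeasure coin_tosses {s. False ## s \<in> X}"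
    by (subst nn_integral_bernoulli_pmf) (auto simp: mult.commute)
  finally show ?thesis .
qed

text \<open>
  First-step analysis.
\<close>

lemma pr_step:
  assumes "[] \<notin> W"
  shows "pr W = (pr {v. True # v \<in> W} + pr {v. False # v \<in> W}) / 2"
proof -
  have eq: "{s. b ## s \<in> cyl W} = cyl {v. b # v \<in> W}" for b
  proof -
    have "(\<exists>n. stake n (b ## s) \<in> W) \<longleftrightarrow> (\<exists>n. b # stake n s \<in> W)" for s
    proof
      assume "\<exists>n. stake n (b ## s) \<in> W"
      then obtain n where n: "stake n (b ## s) \<in> W" by auto
      with assms show "\<exists>n. b # stake n s \<in> W" by (cases n) auto
    next
      assume "\<exists>n. b # stake n s \<in> W"
      then obtain n where "b # stake n s \<in> W" by auto
      then show "\<exists>n. stake n (b ## s) \<in> W" by (intro exI[of _ "Suc n"]) simp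
    qed
    then show ?thesis by (auto simp: cyl_def)
  qed
  show ?thesis
    using emeasure_step[OF sets_cyl, of W] unfolding eq pr_def coin.emeasure_eq_measure
      ennreal_mult[symmetric, OF zero_le_divide_1_iff[THEN iffD2, OF zero_le_numeral] measure_nonneg]
    by (subst (asm) ennreal_plus[symmetric]) (auto simp del: ennreal_plus simp: field_simps)
qed

definition after :: "bool list \<Rightarrow> bool stream set \<Rightarrow> bool stream set" where
  "after u X = {s. stake (length u) s = u \<and> sdrop (length u) s \<in> X}"

lemma sets_after[measurable]:
  assumes [measurable]: "X \<in> sets coin_tosses"
  shows "after u X \<in> sets coin_tosses"
proof -
  have "after u X = cyl {u} \<inter> sdrop (length u) -` X"
    by (auto simp: after_def cyl_def)
  moreover have "sdrop (length u) -` X \<inter> space coin_tosses \<in> sets coin_tosses"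
    unfolding coin_tosses_def by (rule measurable_sets[OF measurable_sdrop]) (use assms in \<open>simp add: coin_tosses_def\<close>)
  ultimately show ?thesis by auto
qed

lemma emeasure_after:
  assumes "X \<in> sets coin_tosses"
  shows "emeasure coin_tosses (after u X) = ennreal ((1/2) ^ length u) * emeasure coin_tosses X"
proof (induction u)
  case Nil
  then show ?case by (simp add: after_def)
next
  case (Cons b u)
  have eq: "{s. t ## s \<in> after (b # u) X} = (if t = b then after u X else {})" for t
    by (auto simp: after_def)
  show ?case
    apply (subst emeasure_step[OF sets_after[OF assms]])
    unfolding eq list.size power_Suc add_0_right add_Suc_right using Cons
    ennreal_mult[of "1/2" "(1/2) ^ length u"]
    by (cases b) (auto simp add: mult_ac simp del: ennreal_half)
qed

lemma emeasure_cyl_conc: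
  assumes "prefix_free A"
  shows "emeasure coin_tosses (cyl (A \<odot> B)) =
    emeasure coin_tosses (cyl B) * (\<integral>\<^sup>+u. ennreal ((1/2) ^ length u) \<partial>count_space A)"
proof -
  have "cyl (A \<odot> B) = (\<Union>u\<in>A. after u (cyl B))"
  proof safe
    fix s assume "s \<in> cyl (A \<odot> B)"
    then obtain n u v where uv: "stake n s = u @ v" "u \<in> A" "v \<in> B" by (auto simp: cyl_def conc_def)
    then have u: "u = stake (length u) s" by (intro prefix_stakeD[of _ n]) auto
    have "v = drop (length u) (stake n s)" using uv by simp
    then have "v = stake (n - length u) (sdrop (length u) s)" by (simp add: drop_stake)
    then have "sdrop (length u) s \<in> cyl B" using uv(3) unfolding cyl_def by auto
    then have "s \<in> after u (cyl B)" using u unfolding after_def by simp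
    then show "s \<in> (\<Union>u\<in>A. after u (cyl B))" using uv(2) by blast
  next
    fix s u assume "u \<in> A" "s \<in> after u (cyl B)"
    then obtain n where "stake (length u) s = u" "stake n (sdrop (length u) s) \<in> B"
      by (auto simp: after_def cyl_def)
    then have "stake (length u + n) s \<in> A \<odot> B" using \<open>u \<in> A\<close> by (metis concI stake_add)
    then show "s \<in> cyl (A \<odot> B)" by (auto simp: cyl_def)
  qed
  moreover have "disjoint_family_on (\<lambda>u. after u (cyl B)) A"
    unfolding disjoint_family_on_def
  proof (intro ballI impI, rule ccontr)
    fix u v assume uv: "u \<in> A" "v \<in> A" "u \<noteq> v" "after u (cyl B) \<inter> after v (cyl B) \<noteq> {}"
    then obtain s where "stake (length u) s = u" "stake (length v) s = v" by (auto simp: after_def)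
    then have "prefix u v \<or> prefix v u"
      using stake_prefix[of "length u" "length v" s] stake_prefix[of "length v" "length u" s] by (metis linear)
    then show False using uv(1-3) prefix_freeD[OF assms] by auto
  qed
  ultimately have "emeasure coin_tosses (cyl (A \<odot> B)) = (\<integral>\<^sup>+u. emeasure coin_tosses (after u (cyl B)) \<partial>count_space A)"
    by (simp add: emeasure_UN_countable)
  then show ?thesis
    by (simp add: emeasure_after mult.commute nn_integral_cmult)
qed

lemma conc_Nil_right[simp]: "A \<odot> {[]} = A" by (auto simp: conc_def)
text \<open>
  This is the strong Markov property: once a word of \<open>A\<close> has been read, the remaining tosses are again
  fair and independent of it.
\<close>

lemma pr_conc:
  assumes "prefix_free A" shows "pr (A \<odot> B) = pr A * pr B"
proof -
  have "emeasure coin_tosses (cyl {[]}) = 1"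
    using pr_Nil[of "{[]}"] by (simp add: pr_def coin.emeasure_eq_measure)
  then have "emeasure coin_tosses (cyl A) = (\<integral>\<^sup>+u. ennreal ((1/2) ^ length u) \<partial>count_space A)"
    using emeasure_cyl_conc[OF assms, of "{[]}"] by simp
  then have "emeasure coin_tosses (cyl (A \<odot> B)) = emeasure coin_tosses (cyl B) * emeasure coin_tosses (cyl A)"
    using emeasure_cyl_conc[OF assms, of B] by simp
  then show ?thesis
    by (simp add: pr_def coin.emeasure_eq_measure ennreal_mult[symmetric] mult.commute)
qed

lemma Not_comp_Not[simp]: "Not \<circ> Not = id"
  by auto

text \<open>
  Exchanging the two sides of the coin reflects the walk at its starting point, which halves the
  number of cases below.
\<close>

lemma distr_flip: "distr coin_tosses coin_tosses (smap Not) = coin_tosses"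
proof (rule stream_space_eq_sstart[where S=UNIV])
  have m: "smap Not \<in> coin_tosses \<rightarrow>\<^sub>M coin_tosses"
    unfolding coin_tosses_def by (rule measurable_smap) simp
  show "prob_space (distr coin_tosses coin_tosses (smap Not))" by (rule coin.prob_space_distr[OF m])
  show "prob_space coin_tosses" by (rule coin.prob_space_axioms)
  fix xs :: "bool list"
  have s: "sstart UNIV xs = after xs UNIV" for xs :: "bool list"
  proof -
    have "s \<in> sstart UNIV xs \<longleftrightarrow> stake (length xs) s = xs" for s
      by (induction xs arbitrary: s) auto
    then show ?thesis by (auto simp: after_def)
  qed
  have U: "UNIV \<in> sets coin_tosses" using sets.top[of coin_tosses] by simp
  have "map Not a = xs \<longleftrightarrow> a = map Not xs" for a by auto
  then have "smap Not -` after xs UNIV = after (map Not xs) UNIV"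
    by (auto simp: after_def)
  then show "emeasure (distr coin_tosses coin_tosses (smap Not)) (sstart UNIV xs) = emeasure coin_tosses (sstart UNIV xs)"
    unfolding s using emeasure_distr[OF m sets_after[OF U]] by (simp add: emeasure_after[OF U])
qed (simp_all add: sets_coin_tosses)

lemma pr_flip: "pr ((map Not) ` W) = pr W"
proof -
  have m: "smap Not \<in> coin_tosses \<rightarrow>\<^sub>M coin_tosses"
    unfolding coin_tosses_def by (rule measurable_smap) simp
  have "smap Not -` cyl W = cyl (map Not ` W)"
  proof -
    have "map Not u \<in> W \<longleftrightarrow> u \<in> map Not ` W" for u
      using image_eqI[of u "map Not" "map Not u" W] by auto
    then show ?thesis by (simp add: cyl_def vimage_def)
  qed
  then have "emeasure (distr coin_tosses coin_tosses (smap Not)) (cyl W) = emeasure coin_tosses (cyl (map Not ` W))"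
    using emeasure_distr[OF m sets_cyl, of W] by simp
  then show ?thesis by (simp add: distr_flip pr_def measure_def)
qed

section \<open>Paths of words\<close>

abbreviation step_of :: "bool \<Rightarrow> int" where "step_of b \<equiv> (if b then 1 else -1)"

fun disp :: "bool list \<Rightarrow> int" where
  "disp [] = 0"
| "disp (b # w) = step_of b + disp w"

text \<open>
  The position at the end of the word is not counted.  This makes the count additive under
  concatenation, and the word of length \<open>n + 1\<close> yields the local times at time \<open>n\<close>.
\<close>

fun visits :: "int \<Rightarrow> bool list \<Rightarrow> nat" where
  "visits y [] = 0"
| "visits y (b # w) = (if y = 0 then 1 else 0) + visits (y - step_of b) w"

text \<open>
  Again the final position is exempt, so that a word that ends with its first visit to \<open>a\<close> or \<open>b\<close> is
  confined to the interval between them.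
\<close>

fun confined :: "int \<Rightarrow> int \<Rightarrow> bool list \<Rightarrow> bool" where
  "confined a b [] = True"
| "confined a b (c # w) = (a < 0 \<and> 0 < b \<and> confined (a - step_of c) (b - step_of c) w)"

lemma disp_append[simp]: "disp (u @ v) = disp u + disp v"
  by (induction u) auto

lemma visits_append: "visits y (u @ v) = visits y u + visits (y - disp u) v"
  by (induction u arbitrary: y) (auto simp: algebra_simps)

lemma confined_append: "confined a b (u @ v) \<longleftrightarrow> confined a b u \<and> confined (a - disp u) (b - disp u) v"
  by (induction u arbitrary: a b) (auto simp: algebra_simps)

lemma confined_mono: "confined a b w \<Longrightarrow> a' \<le> a \<Longrightarrow> b \<le> b' \<Longrightarrow> confined a' b' w"
proof (induction w arbitrary: a b a' b')
  case (Cons c w)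
  then show ?case using Cons.IH[of "a - step_of c" "b - step_of c" "a' - step_of c" "b' - step_of c"] by auto
qed auto

lemma confined_visits: "confined a b w \<Longrightarrow> visits y w > 0 \<Longrightarrow> a < y \<and> y < b"
proof (induction w arbitrary: a b y)
  case (Cons c w)
  show ?case
  proof (cases "y = 0")
    case True then show ?thesis using Cons.prems by auto
  next
    case False
    then have "visits (y - step_of c) w > 0" using Cons.prems by (simp split: if_splits)
    moreover have "confined (a - step_of c) (b - step_of c) w" using Cons.prems by simp
    ultimately show ?thesis using Cons.IH[of "a - step_of c" "b - step_of c" "y - step_of c"] by linarith
  qed
qed simp

lemma visits_start: "w \<noteq> [] \<Longrightarrow> visits 0 w > 0"
  by (cases w) auto

lemma disp_map_Not[simp]: "disp (map Not w) = - disp w"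
  by (induction w) auto

lemma visits_map_Not[simp]: "visits y (map Not w) = visits (- y) w"
proof (induction w arbitrary: y)
  case (Cons c w)
  have "- (y - step_of (\<not> c)) = - y - step_of c" by simp
  then show ?case using Cons by simp
qed simp

lemma confined_map_Not[simp]: "confined a b (map Not w) = confined (- b) (- a) w"
proof (induction w arbitrary: a b)
  case (Cons c w)
  have "- (b - step_of (\<not> c)) = - b - step_of c" "- (a - step_of (\<not> c)) = - a - step_of c" by simp_all
  then show ?case using Cons by auto
qed simp

text \<open>
  Steps have size one, so that the walk cannot jump over the level \<open>y\<close>.
\<close>

lemma split_first_hit_up:
  "0 \<le> y \<Longrightarrow> y \<le> disp w \<Longrightarrow> confined a b w \<Longrightarrow> \<exists>u v. w = u @ v \<and> disp u = y \<and> confined a y u"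
proof (induction w arbitrary: y a b)
  case Nil
  then show ?case by simp
next
  case (Cons c w)
  show ?case
  proof (cases "y = 0")
    case True
    then show ?thesis by (intro exI[of _ "[]"] exI[of _ "c # w"]) simp
  next
    case False
    have "\<exists>u v. w = u @ v \<and> disp u = y - step_of c \<and> confined (a - step_of c) (y - step_of c) u"
      using Cons.prems False by (intro Cons.IH[of _ _ "b - step_of c"]) (auto split: if_splits)
    then obtain u v where "w = u @ v" "disp u = y - step_of c" "confined (a - step_of c) (y - step_of c) u" by blast
    then show ?thesis using Cons.prems False by (intro exI[of _ "c # u"] exI[of _ v]) auto
  qed
qed

lemma split_first_visit:
  "visits y w > 0 \<Longrightarrow> \<exists>u v. w = u @ v \<and> disp u = y \<and> visits y u = 0 \<and> v \<noteq> []"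
proof (induction w arbitrary: y)
  case Nil
  then show ?case by simp
next
  case (Cons c w)
  show ?case
  proof (cases "y = 0")
    case True
    then show ?thesis by (intro exI[of _ "[]"] exI[of _ "c # w"]) simp
  next
    case False
    then have "visits (y - step_of c) w > 0" using Cons.prems by (simp split: if_splits)
    from Cons.IH[OF this] obtain u v where "w = u @ v" "disp u = y - step_of c" "visits (y - step_of c) u = 0" "v \<noteq> []"
      by blast
    then show ?thesis using False by (intro exI[of _ "c # u"] exI[of _ v]) auto
  qed
qed

text \<open>
  Since the walk cannot jump over \<open>z\<close>, it stays above \<open>z\<close> if it never visits \<open>z\<close>.
\<close>

lemma confined_unbounded_below: "confined a b w \<Longrightarrow> z < 0 \<Longrightarrow> visits z w = 0 \<Longrightarrow> confined z b w"
proof (induction w arbitrary: a b z)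
  case (Cons c w)
  have v: "visits (z - step_of c) w = 0" using Cons.prems by auto
  show ?case
  proof (cases "w = []")
    case True then show ?thesis using Cons.prems by auto
  next
    case False
    then have "z - step_of c \<noteq> 0" using visits_start[of w] v by auto
    then have "z - step_of c < 0" using \<open>z < 0\<close> by (cases c) auto
    moreover have "confined (a - step_of c) (b - step_of c) w" using Cons.prems(1) by simp
    ultimately have "confined (z - step_of c) (b - step_of c) w" using v Cons.IH[of "a - step_of c" "b - step_of c" "z - step_of c"] by blast
    then show ?thesis using Cons.prems(1,2) by simp
  qed
qed simp

section \<open>Exits from an interval\<close>

text \<open>
  The walk leaves the interval from \<open>-l\<close> to \<open>r\<close> at its upper end, and in \<open>dn\<close> at its lower end.
\<close>

definition up :: "int \<Rightarrow> int \<Rightarrow> bool list set" where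
  "up l r = {w. disp w = r \<and> confined (- l) r w}"

definition dn :: "int \<Rightarrow> int \<Rightarrow> bool list set" where
  "dn l r = {w. disp w = - l \<and> confined (- l) r w}"

lemma up_Cons: "b # v \<in> up l r \<longleftrightarrow> 0 < l \<and> 0 < r \<and> v \<in> up (l + step_of b) (r - step_of b)"
proof -
  have "- (l + step_of b) = - l - step_of b" by simp
  then show ?thesis unfolding up_def by auto
qed

lemma dn_conv_up: "dn l r = map Not ` up r l"
proof -
  have "w \<in> dn l r \<longleftrightarrow> map Not w \<in> up r l" for w by (auto simp: dn_def up_def)
  moreover have "map Not w \<in> W \<longleftrightarrow> w \<in> map Not ` W" for w and W :: "bool list set"
    using image_eqI[of w "map Not" "map Not w" W] by auto
  ultimately show ?thesis by blast
qed

lemma prefix_free_up: "prefix_free (up l r)"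
  unfolding prefix_free_def
proof (intro ballI impI)
  fix u v assume "u \<in> up l r" "v \<in> up l r" "prefix u v"
  then obtain x where x: "v = u @ x" "disp u = r" "confined (-l) r (u @ x)" by (auto simp: up_def prefix_def)
  then have "x = []" by (cases x) (auto simp: confined_append)
  then show "u = v" using x by simp
qed

lemma prefix_free_dn: "prefix_free (dn l r)"
  unfolding prefix_free_def
proof (intro ballI impI)
  fix u v assume "u \<in> dn l r" "v \<in> dn l r" "prefix u v"
  then obtain x where x: "v = u @ x" "disp u = -l" "confined (-l) r (u @ x)" by (auto simp: dn_def prefix_def)
  then have "x = []" by (cases x) (auto simp: confined_append)
  then show "u = v" using x by simp
qed

lemma up_0_right: "up l 0 = {[]}"
proof -
  have "w = []" if "w \<in> up l 0" for w using that by (cases w) (auto simp: up_def)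
  then show ?thesis by (auto simp: up_def)
qed

lemma up_0_left: "r > 0 \<Longrightarrow> up 0 r = {}"
proof -
  assume "r > 0"
  then have "w \<notin> up 0 r" for w by (cases w) (auto simp: up_def)
  then show ?thesis by auto
qed

lemma harmonic_linear:
  fixes f :: "nat \<Rightarrow> real"
  assumes "f 0 = 0" "\<And>x. 0 < x \<Longrightarrow> x < n \<Longrightarrow> f x = (f (x + 1) + f (x - 1)) / 2"
  shows "x \<le> n \<Longrightarrow> f x = real x * f 1"
proof (induction x rule: less_induct)
  case (less x)
  show ?case
  proof (cases "x \<le> 1")
    case True then show ?thesis using assms by (cases "x = 0") (auto simp: le_Suc_eq)
  next
    case False
    define z where "z = x - 2"
    have z: "x = Suc (Suc z)" using False by (simp add: z_def)
    have "Suc z < n" "z \<le> n" using less.prems z by linarith+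
    then have "f (Suc z) = (f x + f z) / 2" using assms(2)[of "Suc z"] z by simp
    moreover have "f (Suc z) = real (Suc z) * f 1" "f z = real z * f 1"
      using less.IH[of "Suc z"] less.IH[of z] z \<open>Suc z < n\<close> by auto
    moreover have "real x = real z + 2" "real (Suc z) = real z + 1" using z by simp_all
    ultimately show ?thesis by (simp add: algebra_simps)
  qed
qed

text \<open>
  Gambler's ruin: as a function of the starting point the probability is harmonic with boundary values
  0 and 1, hence linear.
\<close>

lemma pr_up:
  assumes "0 \<le> l" "0 \<le> r" "0 < l + r"
  shows "pr (up l r) = l / (l + r)"
proof -
  define n where "n = nat (l + r)"
  define f where "f x = pr (up (int x) (int n - int x))" for x
  have f0: "f 0 = 0" using assms by (simp add: f_def n_def up_0_left)
  have fn: "f n = 1" by (simp add: f_def up_0_right pr_Nil)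
  have rec: "f x = (f (x + 1) + f (x - 1)) / 2" if "0 < x" "x < n" for x
  proof -
    have "{v. True # v \<in> up (int x) (int n - int x)} = up (int x + 1) (int n - int x - 1)"
         "{v. False # v \<in> up (int x) (int n - int x)} = up (int x + - 1) (int n - int x - - 1)"
      using that by (simp_all add: up_Cons)
    moreover have "int x + 1 = int (x + 1)" "int n - int x - 1 = int n - int (x + 1)"
      "int x + - 1 = int (x - 1)" "int n - int x - - 1 = int n - int (x - 1)" using that by auto
    moreover have "[] \<notin> up (int x) (int n - int x)" using that by (simp add: up_def)
    ultimately show ?thesis unfolding f_def by (simp only: pr_step not_False_eq_True)
  qed
  have "f x = real x * f 1" if "x \<le> n" for x using harmonic_linear[OF f0 rec] that by auto
  from this[of n] this[of "nat l"] have "real n * f 1 = 1" "f (nat l) = l * f 1"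
    using fn assms by (auto simp: n_def)
  moreover have "f (nat l) = pr (up l r)" "real n = l + r" using assms by (simp_all add: f_def n_def)
  ultimately show ?thesis using assms by (simp add: field_simps)
qed

lemma pr_dn:
  assumes "0 \<le> l" "0 \<le> r" "0 < l + r"
  shows "pr (dn l r) = r / (l + r)"
  using pr_up[of r l] assms by (simp add: dn_conv_up pr_flip add.commute)

lemma pr_Cons: "pr ((#) b ` W) = pr W / 2"
proof -
  have "[] \<notin> (#) b ` W" by auto
  moreover have "{v. b # v \<in> (#) b ` W} = W" "{v. (\<not> b) # v \<in> (#) b ` W} = {}" by auto
  ultimately show ?thesis by (cases b) (auto simp: pr_step)
qed

text \<open>
  The words that end with the first return to the starting point.
\<close>

definition loops :: "bool list set" where
  "loops = {c. disp c = 0 \<and> visits 0 c = 1}"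

lemma prefix_free_loops: "prefix_free loops"
  unfolding prefix_free_def
proof (intro ballI impI)
  fix u v assume "u \<in> loops" "v \<in> loops" "prefix u v"
  then obtain x where "v = u @ x" "disp u = 0" "visits 0 u = 1" "visits 0 (u @ x) = 1"
    by (auto simp: loops_def prefix_def)
  then show "u = v" using visits_start[of x] by (cases "x = []") (auto simp: visits_append)
qed

lemma split_loop:
  assumes "visits 0 w \<ge> 2"
  shows "\<exists>u v. w = u @ v \<and> u \<in> loops \<and> v \<noteq> [] \<and> visits 0 w = Suc (visits 0 v)"
proof -
  obtain c w' where w: "w = c # w'" using assms by (cases w) auto
  then have "visits (0 - step_of c) w' > 0" using assms by auto
  from split_first_visit[OF this] obtain u v where
    "w' = u @ v" "disp u = - step_of c" "visits (- step_of c) u = 0" "v \<noteq> []" by auto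
  then show ?thesis using w
    by (intro exI[of _ "c # u"] exI[of _ v]) (auto simp: loops_def visits_append)
qed

lemma visits_pos_if_crossed: "0 \<le> y \<Longrightarrow> y < disp w \<Longrightarrow> visits y w > 0"
proof (induction w arbitrary: y)
  case (Cons c w)
  then show ?case using Cons.IH[of "y - step_of c"] by (cases "y = 0") (auto split: if_splits)
qed simp

text \<open>
  After each visit to its starting point the walk goes on to \<open>r\<close> without coming back with probability
  \<open>1/(2 r)\<close>.  If there are fewer than \<open>k\<close> visits, this happens after one of the first \<open>k\<close>.
\<close>

lemma pr_thin_start:
  assumes "0 \<le> l" "1 \<le> r"
  shows "pr {v \<in> up l r. visits 0 v < k} \<le> real k / (2 * r)"
proof (induction k)
  case 0
  then show ?case by simp
next
  case (Suc k)
  let ?A = "(#) True ` up 1 (r - 1)" and ?B = "loops \<odot> {v \<in> up l r. visits 0 v < k}"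
  have "{v \<in> up l r. visits 0 v < Suc k} \<subseteq> ?A \<union> ?B"
  proof
    fix v assume "v \<in> {v \<in> up l r. visits 0 v < Suc k}"
    then have v: "disp v = r" "confined (-l) r v" "visits 0 v < Suc k" by (auto simp: up_def)
    show "v \<in> ?A \<union> ?B"
    proof (cases "visits 0 v \<ge> 2")
      case True
      then obtain u x where u: "v = u @ x" "u \<in> loops" "visits 0 v = Suc (visits 0 x)" using split_loop by blast
      then have "x \<in> {v \<in> up l r. visits 0 v < k}" using v by (auto simp: up_def confined_append loops_def)
      then show ?thesis using u by (auto intro: concI)
    next
      case False
      obtain c v' where c: "v = c # v'" using v assms by (cases v) auto
      then have "visits (- step_of c) v' = 0" using False by auto
      then have "c" using visits_pos_if_crossed[of 1 v'] v c assms by (cases c) auto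
      then have "confined (-1) (r - 1) v'" using c v \<open>visits (- step_of c) v' = 0\<close>
        confined_unbounded_below[of "-l-1" "r - 1" v' "-1"] by auto
      then have "v' \<in> up 1 (r - 1)" using c v \<open>c\<close> by (auto simp: up_def)
      then show ?thesis using c \<open>c\<close> by auto
    qed
  qed
  then have "pr {v \<in> up l r. visits 0 v < Suc k} \<le> pr (?A \<union> ?B)" by (rule pr_mono)
  also have "\<dots> \<le> pr ?A + pr ?B" by (rule pr_Un)
  also have "pr ?A = 1 / (2 * r)" using assms by (simp add: pr_Cons pr_up)
  also have "pr ?B \<le> pr {v \<in> up l r. visits 0 v < k}"
    unfolding pr_conc[OF prefix_free_loops] by (rule mult_left_le_one_le) auto
  finally have "pr {v \<in> up l r. visits 0 v < Suc k} \<le> 1 / (2 * r) + k / (2 * r)" using Suc by linarith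
  then show ?case by (simp add: add_divide_distrib)
qed

text \<open>
  The site \<open>y\<close> is reached first, which has probability \<open>l/(l+y)\<close>, and then left for good too early.
\<close>

lemma pr_thin_up:
  assumes "0 < l" "0 \<le> y" "y < r"
  shows "pr {w \<in> up l r. visits y w < k} \<le> l / (l + y) * (real k / (2 * (r - y)))"
proof -
  let ?B = "{v \<in> up (l + y) (r - y). visits 0 v < k}"
  have "{w \<in> up l r. visits y w < k} \<subseteq> up l y \<odot> ?B"
  proof
    fix w assume "w \<in> {w \<in> up l r. visits y w < k}"
    then have w: "disp w = r" "confined (-l) r w" "visits y w < k" by (auto simp: up_def)
    then obtain u v where uv: "w = u @ v" "disp u = y" "confined (-l) y u"
      using split_first_hit_up[of y w "-l" r] assms by auto
    then have "u \<in> up l y" by (simp add: up_def)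
    have m: "- (l + y) = - l - y" by simp
    have "v \<in> ?B" using w uv unfolding up_def m by (simp add: confined_append visits_append)
    with \<open>u \<in> up l y\<close> show "w \<in> up l y \<odot> ?B" using uv by (auto intro: concI)
  qed
  then have "pr {w \<in> up l r. visits y w < k} \<le> pr (up l y) * pr ?B"
    using pr_mono pr_conc[OF prefix_free_up] by metis
  also have "\<dots> \<le> l / (l + y) * (real k / (2 * (r - y)))"
    using assms pr_thin_start[of "l + y" "r - y" k] by (intro mult_mono) (auto simp: pr_up)
  finally show ?thesis by simp
qed

lemma pr_thin_dn:
  assumes "0 < r" "0 \<le> y" "y < l"
  shows "pr {w \<in> dn l r. visits (- y) w < k} \<le> r / (r + y) * (real k / (2 * (l - y)))"
proof -
  have "{w \<in> dn l r. visits (- y) w < k} = map Not ` {w \<in> up r l. visits y w < k}"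
    unfolding dn_conv_up by auto
  then show ?thesis using pr_thin_up[OF assms] by (simp add: pr_flip)
qed

section \<open>Serving the sites near an end of the range\<close>

lemma pr_conc_le: "W \<subseteq> A \<odot> B \<Longrightarrow> prefix_free A \<Longrightarrow> pr W \<le> pr A * pr B"
  using pr_mono[of W "A \<odot> B"] pr_conc[of A B] by simp

lemma prefix_free_Cons: "prefix_free W \<Longrightarrow> prefix_free ((#) b ` W)"
  by (auto simp: prefix_free_def)

fun lpow :: "'a list set \<Rightarrow> nat \<Rightarrow> 'a list set" where
  "lpow A 0 = {[]}"
| "lpow A (Suc n) = A \<odot> lpow A n"

lemma prefix_free_lpow: "prefix_free A \<Longrightarrow> prefix_free (lpow A n)"
  by (induction n) (auto intro: prefix_free_conc)

lemma pr_lpow: "prefix_free A \<Longrightarrow> pr (lpow A n) = pr A ^ n"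
  by (induction n) (auto simp: pr_conc pr_Nil)

text \<open>
  An exponential tail bound for the number of visits to a site during \<open>r\<close> excursions.  The quantity
  \<open>a r m\<close> stands for the probability that \<open>r\<close> excursions take place and together make fewer than \<open>m\<close>
  visits, and \<open>b r m\<close> for the same with the walk currently at the site and \<open>r\<close> further excursions to come.
  Splitting off the next excursion or the next loop at the site gives the recursive inequalities;
  \<open>\<mu> ^ r * x ^ m\<close> and \<open>\<kappa> * \<mu> ^ r * x ^ m\<close> satisfy the reversed ones, hence dominate.
\<close>

lemma supersolution:
  fixes a b :: "nat \<Rightarrow> nat \<Rightarrow> real"
  assumes a0: "\<And>m. a 0 m \<le> 1" and aS: "\<And>r m. a (Suc r) m \<le> pa * a r m + pb * b r m"
    and b0: "\<And>r. b r 0 \<le> 0" and bS: "\<And>r m. b r (Suc m) \<le> qa * b r m + qb * a r m"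
    and nonneg: "0 \<le> pa" "0 \<le> pb" "0 \<le> qa" "0 \<le> qb" "0 \<le> \<kappa>" "0 \<le> \<mu>" "1 \<le> x"
    and sup: "pa + pb * \<kappa> \<le> \<mu>" "qa * \<kappa> + qb \<le> \<kappa> * x"
  shows "a r m \<le> \<mu> ^ r * x ^ m"
proof -
  have b: "b r m \<le> \<kappa> * (\<mu> ^ r * x ^ m)" if a: "\<And>m. a r m \<le> \<mu> ^ r * x ^ m" for r m
  proof (induction m)
    case 0
    have "0 \<le> \<kappa> * (\<mu> ^ r * x ^ 0)" using nonneg by simp
    then show ?case using b0[of r] by linarith
  next
    case (Suc m)
    have "b r (Suc m) \<le> qa * (\<kappa> * (\<mu> ^ r * x ^ m)) + qb * (\<mu> ^ r * x ^ m)"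
      using bS[of r m] mult_left_mono[OF Suc nonneg(3)] mult_left_mono[OF a[of m] nonneg(4)] by linarith
    also have "\<dots> = (qa * \<kappa> + qb) * (\<mu> ^ r * x ^ m)" by (simp add: algebra_simps)
    also have "\<dots> \<le> (\<kappa> * x) * (\<mu> ^ r * x ^ m)" using sup(2) nonneg by (intro mult_right_mono) auto
    finally show ?case by (simp add: mult_ac)
  qed
  show ?thesis
  proof (induction r arbitrary: m)
    case 0
    have "1 \<le> x ^ m" using nonneg by simp
    then show ?case using a0[of m] by simp
  next
    case (Suc r)
    have "a (Suc r) m \<le> pa * (\<mu> ^ r * x ^ m) + pb * (\<kappa> * (\<mu> ^ r * x ^ m))"
      using aS[of r m] mult_left_mono[OF Suc nonneg(1)] mult_left_mono[OF b[OF Suc] nonneg(2)] by smt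
    also have "\<dots> = (pa + pb * \<kappa>) * (\<mu> ^ r * x ^ m)" by (simp add: algebra_simps)
    also have "\<dots> \<le> \<mu> * (\<mu> ^ r * x ^ m)" using sup(1) nonneg by (intro mult_right_mono) auto
    finally show ?case by (simp add: mult_ac)
  qed
qed

definition loops_in :: "int \<Rightarrow> int \<Rightarrow> bool list set" where
  "loops_in a b = {c \<in> loops. confined (- a) b c}"

lemma prefix_free_loops_in: "prefix_free (loops_in a b)"
  by (rule prefix_free_subset[OF prefix_free_loops]) (auto simp: loops_in_def)

lemma loop_prefix_visits:
  assumes "c \<in> loops" "prefix c e" "c \<noteq> e" shows "visits 0 e \<ge> 2"
proof -
  obtain x where "e = c @ x" "x \<noteq> []" using assms by (auto simp: prefix_def)
  then show ?thesis using assms(1) visits_start[of x] by (auto simp: loops_def visits_append)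
qed

lemma confined_prefix_strict:
  assumes "confined a b c" "prefix e c" "e \<noteq> c" shows "a < disp e \<and> disp e < b"
proof -
  obtain x where x: "c = e @ x" "x \<noteq> []" using assms by (auto simp: prefix_def)
  then have "confined (a - disp e) (b - disp e) x" using assms(1) by (simp add: confined_append)
  then show ?thesis using x(2) by (cases x) auto
qed

lemma visits_0_escape_up: "x \<in> up 1 r \<Longrightarrow> visits 0 (True # x) = 1"
  using confined_visits[of "-1" r x "-1"] by (cases "visits (- 1) x") (auto simp: up_def)

lemma visits_0_escape_dn: "x \<in> dn l 1 \<Longrightarrow> visits 0 (False # x) = 1"
  using confined_visits[of "-l" 1 x 1] by (cases "visits 1 x") (auto simp: dn_def)

text \<open>
  A walk started in the interval can make a loop, escape to \<open>-a\<close>, or escape to \<open>b\<close> before returning; the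
  three exclude each other, and the escapes have probabilities \<open>1/(2 a)\<close> and \<open>1/(2 b)\<close>.
\<close>

lemma pr_loops_in:
  assumes "1 \<le> a" "1 \<le> b"
  shows "pr (loops_in a b) \<le> 1 - 1 / (2 * a) - 1 / (2 * b)"
proof -
  define E where "E i = (if i = (0::nat) then loops_in a b
     else if i = 1 then (#) False ` dn (a - 1) 1 else (#) True ` up 1 (b - 1))" for i
  define U where "U = {w. confined (-a) b w \<and> visits 0 w = 1 \<and> (disp w = 0 \<or> disp w = - a \<or> disp w = b)}"
  have EU: "E i \<subseteq> U" for i
  proof
    fix w assume w: "w \<in> E i"
    consider "i = 0" | "i = 1" | "i \<noteq> 0" "i \<noteq> 1" by blast
    then show "w \<in> U"
    proof cases
      case 1 then show ?thesis using w by (auto simp: E_def U_def loops_in_def loops_def)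
    next
      case 2
      then obtain x where x: "w = False # x" "x \<in> dn (a - 1) 1" using w by (auto simp: E_def)
      then have "confined (-a + 1) (b + 1) x" using assms confined_mono[of "-(a-1)" 1 x "-a + 1" "b + 1"] by (simp add: dn_def)
      then show ?thesis using x visits_0_escape_dn[OF x(2)] assms by (auto simp: U_def dn_def)
    next
      case 3
      then obtain x where x: "w = True # x" "x \<in> up 1 (b - 1)" using w by (auto simp: E_def)
      then have "confined (-a - 1) (b - 1) x" using assms confined_mono[of "-1" "b-1" x "-a - 1" "b - 1"] by (simp add: up_def)
      then show ?thesis using x visits_0_escape_up[OF x(2)] assms by (auto simp: U_def up_def)
    qed
  qed
  have pf: "prefix_free U"
    unfolding prefix_free_def
  proof (intro ballI impI, rule ccontr)
    fix u v assume uv: "u \<in> U" "v \<in> U" "prefix u v" "u \<noteq> v"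
    have "-a < disp u \<and> disp u < b" using uv by (intro confined_prefix_strict[of _ _ v]) (auto simp: U_def)
    then have "u \<in> loops" using uv by (auto simp: U_def loops_def)
    then show False using loop_prefix_visits[of u v] uv by (auto simp: U_def)
  qed
  have disp_E: "w \<in> E i \<Longrightarrow> disp w = (if i = 0 then 0 else if i = 1 then - a else b)" for w i
    by (auto simp: E_def loops_in_def loops_def dn_def up_def split: if_splits)
  have "(\<Sum>i\<in>{0,1,2::nat}. pr (E i)) = pr (\<Union>i\<in>{0,1,2}. E i)"
  proof (rule pr_disjoint_sum[OF _ EU pf])
    fix i j assume "i \<in> {0,1,2::nat}" "j \<in> {0,1,2::nat}" "i \<noteq> j"
    then show "E i \<inter> E j = {}" using disp_E[of _ i] disp_E[of _ j] assms by fastforce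
  qed auto
  then have "pr (E 0) + pr (E 1) + pr (E 2) \<le> 1" by (simp add: add.assoc)
  moreover have "pr (E 1) = 1 / (2 * a)" "pr (E 2) = 1 / (2 * b)"
    using assms by (simp_all add: E_def pr_Cons pr_dn pr_up)
  ultimately show ?thesis by (simp add: E_def)
qed

text \<open>
  Ordinary excursions upwards from 0 stay below \<open>H\<close>; tall ones reach \<open>H\<close> and then come back to 0 before they
  reach \<open>2 H\<close>.
\<close>

definition excursion :: "int \<Rightarrow> bool list set" where
  "excursion H = (#) True ` dn 1 (H - 1)"

definition tall_excursion :: "int \<Rightarrow> bool list set" where
  "tall_excursion H = (#) True ` (up 1 (H - 1) \<odot> dn H H)"

lemma prefix_free_excursion: "prefix_free (excursion H)"
  unfolding excursion_def by (intro prefix_free_Cons prefix_free_dn)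

lemma prefix_free_tall_excursion: "prefix_free (tall_excursion H)"
  unfolding tall_excursion_def by (intro prefix_free_Cons prefix_free_conc prefix_free_dn prefix_free_up)

lemma pr_excursion: "1 \<le> H \<Longrightarrow> pr (excursion H) = (1 - 1 / H) / 2"
  by (simp add: excursion_def pr_Cons pr_dn field_simps)

lemma pr_tall_excursion: "1 \<le> H \<Longrightarrow> pr (tall_excursion H) = 1 / (4 * H)"
  by (simp add: tall_excursion_def pr_Cons pr_dn pr_up pr_conc prefix_free_up field_simps)

lemma excursion_props: "w \<in> excursion H \<Longrightarrow> 1 \<le> H \<Longrightarrow> disp w = 0 \<and> confined (- 1) H w \<and> visits 0 w \<ge> 1"
  using confined_mono[of "-1" "H - 1" _ "-2" "H - 1"] by (auto simp: excursion_def dn_def)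

lemma tall_excursion_props:
  assumes "w \<in> tall_excursion H" "1 \<le> H" shows "disp w = 0 \<and> confined (- 1) (2 * H) w"
proof -
  obtain u v where uv: "w = True # u @ v" "disp u = H - 1" "confined (-1) (H-1) u" "disp v = -H" "confined (-H) H v"
    using assms by (auto simp: tall_excursion_def conc_def up_def dn_def)
  have "confined (- 2) (2 * H - 1) u" "confined (- 2 - (H - 1)) (2 * H - 1 - (H - 1)) v"
    using confined_mono[OF uv(3)] confined_mono[OF uv(5)] assms(2) by auto
  then show ?thesis using uv assms(2) by (auto simp: confined_append)
qed

lemma lpow_excursion_props:
  "w \<in> lpow (excursion H) n \<Longrightarrow> 1 \<le> H \<Longrightarrow> disp w = 0 \<and> confined (- 1) H w \<and> visits 0 w \<ge> n"
proof (induction n arbitrary: w)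
  case (Suc n)
  then obtain u v where "w = u @ v" "u \<in> excursion H" "v \<in> lpow (excursion H) n" by (auto simp: conc_def)
  then show ?case using Suc.IH[of v] excursion_props[of u H] Suc.prems(2) by (auto simp: confined_append visits_append)
qed auto

lemma lpow_tall_excursion_props:
  "w \<in> lpow (tall_excursion H) n \<Longrightarrow> 1 \<le> H \<Longrightarrow> disp w = 0 \<and> confined (- 1) (2 * H) w"
proof (induction n arbitrary: w)
  case (Suc n)
  then obtain u v where "w = u @ v" "u \<in> tall_excursion H" "v \<in> lpow (tall_excursion H) n" by (auto simp: conc_def)
  then show ?case using Suc.IH[of v] tall_excursion_props[of u H] Suc.prems(2) by (auto simp: confined_append)
qed auto

lemma confined_unvisited_above: "confined a b w \<Longrightarrow> 0 < z \<Longrightarrow> visits z w = 0 \<Longrightarrow> confined a z w"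
  using confined_unbounded_below[of "-b" "-a" "map Not w" "-z"] by simp

lemma split_visit_dn:
  assumes w: "w \<in> dn l r" and y: "0 \<le> y" "visits y w > 0"
  shows "\<exists>u v. w = u @ v \<and> u \<in> up l y \<and> v \<in> dn (l + y) (r - y)"
proof -
  have w': "disp w = - l" "confined (-l) r w" using w by (auto simp: dn_def)
  obtain u v where uv: "w = u @ v" "disp u = y" "visits y u = 0" using split_first_visit[OF y(2)] by blast
  have c: "confined (-l) r u" "confined (-l - y) (r - y) v" using w' uv by (auto simp: confined_append)
  have "confined (-l) y u"
  proof (cases "y = 0")
    case True
    then have "u = []" using uv visits_start[of u] by auto
    then show ?thesis by simp
  next
    case False then show ?thesis using confined_unvisited_above[OF c(1)] y uv by auto
  qed
  then have "u \<in> up l y" using uv by (simp add: up_def)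
  have m: "- (l + y) = - l - y" by simp
  have "v \<in> dn (l + y) (r - y)" unfolding dn_def m using c uv w' by simp
  with \<open>u \<in> up l y\<close> show ?thesis using uv(1) by blast
qed

lemma split_up:
  assumes w: "w \<in> up l r" and y: "0 \<le> y" "y \<le> r"
  shows "\<exists>u v. w = u @ v \<and> u \<in> up l y \<and> v \<in> up (l + y) (r - y)"
proof -
  have w': "disp w = r" "confined (-l) r w" using w by (auto simp: up_def)
  obtain u v where uv: "w = u @ v" "disp u = y" "confined (-l) y u"
    using split_first_hit_up[of y w "-l" r] y w' by auto
  then have c: "confined (-l - y) (r - y) v" using w' by (auto simp: confined_append)
  have m: "- (l + y) = - l - y" by simp
  have "v \<in> up (l + y) (r - y)" unfolding up_def m using c uv w' by simp
  moreover have "u \<in> up l y" using uv by (simp add: up_def)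
  ultimately show ?thesis using uv(1) by blast
qed

text \<open>
  Either the walk never returns to its starting point, and then its first step leads downwards, or it
  begins with a loop.
\<close>

lemma dn_cases_start:
  assumes w: "w \<in> dn l r" "1 \<le> l"
  shows "(\<exists>x. w = False # x \<and> x \<in> dn (l - 1) 1) \<or>
    (\<exists>c x. w = c @ x \<and> c \<in> loops_in l r \<and> x \<in> dn l r \<and> visits 0 w = Suc (visits 0 x))"
proof (cases "visits 0 w \<ge> 2")
  case True
  then obtain c x where "w = c @ x" "c \<in> loops" "visits 0 w = Suc (visits 0 x)" using split_loop by blast
  moreover from this have "disp c = 0" by (simp add: loops_def)
  ultimately have "c \<in> loops_in l r" "x \<in> dn l r" using w(1) by (simp_all add: dn_def loops_in_def confined_append)
  then show ?thesis using \<open>w = c @ x\<close> \<open>visits 0 w = Suc (visits 0 x)\<close> by blast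
next
  case False
  obtain b x where b: "w = b # x" using w by (cases w) (auto simp: dn_def)
  have v: "visits (- step_of b) x = 0" using False b by simp
  have d: "disp x = - l - step_of b" "confined (- l - step_of b) (r - step_of b) x" using w b by (auto simp: dn_def)
  have "\<not> b"
  proof
    assume b
    then have "visits (- 1) (map Not (map Not x)) > 0"
      using visits_pos_if_crossed[of 1 "map Not x"] d w(2) by simp
    then show False using v \<open>b\<close> by simp
  qed
  then have "confined (-l + 1) 1 x" using confined_unvisited_above[OF d(2), of 1] v by simp
  then show ?thesis using b \<open>\<not> b\<close> d by (auto simp: dn_def)
qed

lemma up_cases_start:
  assumes w: "w \<in> up l r" "1 \<le> r"
  shows "(\<exists>x. w = True # x \<and> x \<in> up 1 (r - 1)) \<or>
    (\<exists>c x. w = c @ x \<and> c \<in> loops_in l r \<and> x \<in> up l r \<and> visits 0 w = Suc (visits 0 x))"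
proof (cases "visits 0 w \<ge> 2")
  case True
  then obtain c x where "w = c @ x" "c \<in> loops" "visits 0 w = Suc (visits 0 x)" using split_loop by blast
  moreover from this have "disp c = 0" by (simp add: loops_def)
  ultimately have "c \<in> loops_in l r" "x \<in> up l r" using w(1) by (simp_all add: up_def loops_in_def confined_append)
  then show ?thesis using \<open>w = c @ x\<close> \<open>visits 0 w = Suc (visits 0 x)\<close> by blast
next
  case False
  obtain b x where b: "w = b # x" using w by (cases w) (auto simp: up_def)
  have v: "visits (- step_of b) x = 0" using False b by simp
  have d: "disp x = r - step_of b" "confined (- l - step_of b) (r - step_of b) x" using w b by (auto simp: up_def)
  have "b" using visits_pos_if_crossed[of 1 x] d w(2) v by (cases b) auto
  then have "confined (-1) (r - 1) x" using confined_unbounded_below[OF d(2), of "-1"] v by simp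
  then show ?thesis using b \<open>b\<close> d by (auto simp: up_def)
qed

text \<open>
  An excursion reaches \<open>j\<close> with probability \<open>1/j\<close> and then visits it \<open>2 j\<close> times on average, which makes
  2 visits per excursion.  It is therefore exponentially unlikely that \<open>r\<close> excursions make at most \<open>r\<close>
  visits: for \<open>m = r\<close> the bound is at most \<open>((1 - 1/(12 j))/2) ^ r\<close>.
\<close>

lemma pr_thin_excursions:
  fixes j H :: int
  assumes j: "1 \<le> j" "j < H"
  shows "pr {w \<in> lpow (excursion H) r. visits j w < m} \<le> ((1 - 1 / (3 * j)) / 2) ^ r * (4 * j / (4 * j - 1)) ^ m"
proof -
  define Aset where "Aset r m = {w \<in> lpow (excursion H) r. visits j w < m}" for r m
  define Bset where "Bset r m = {x @ w | x w. x \<in> dn j (H - j) \<and> w \<in> lpow (excursion H) r \<and> visits 0 x + visits j w < m}" for r m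
  \<comment> \<open>The walk leaves the site for good at rate \<open>1/(2 j)\<close>, and \<open>x\<close> exceeds 1 by about half of this; then
    \<open>\<kappa> = 2/3\<close> solves the inequality at the site, and the other one gives the base.\<close>
  have "pr (Aset r m) \<le> ((1 - 1 / (3 * j)) / 2) ^ r * (4 * j / (4 * j - 1)) ^ m"
  proof (rule supersolution[where a="\<lambda>r m. pr (Aset r m)" and b="\<lambda>r m. pr (Bset r m)" and \<kappa>="2/3" and x="4 * j / (4 * j - 1)"
        and pa="(1 - 1/j)/2" and pb="1/(2*j)" and qa="1 - 1/(2*j)" and qb="1/(2*j)"])
    fix r m
    show "pr (Aset 0 m) \<le> 1" by simp
    show "pr (Bset r 0) \<le> 0" by (simp add: Bset_def)
    have "Aset (Suc r) m \<subseteq> (((#) True ` dn 1 (j - 1)) \<odot> Aset r m) \<union> (((#) True ` up 1 (j - 1)) \<odot> Bset r m)"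
    proof
      fix w assume "w \<in> Aset (Suc r) m"
      then obtain v z where w: "w = (True # v) @ z" "v \<in> dn 1 (H - 1)" "z \<in> lpow (excursion H) r" "visits j w < m"
        by (auto simp: Aset_def conc_def excursion_def)
      then have vis: "visits (j - 1) v + visits j z < m" using j by (auto simp: visits_append dn_def)
      show "w \<in> (((#) True ` dn 1 (j - 1)) \<odot> Aset r m) \<union> (((#) True ` up 1 (j - 1)) \<odot> Bset r m)"
      proof (cases "visits (j - 1) v = 0")
        case True
        have "j \<noteq> 1" using True visits_start[of v] w(2) by (cases "v = []") (auto simp: dn_def)
        then have "v \<in> dn 1 (j - 1)" using confined_unvisited_above[of "-1" "H - 1" v "j - 1"] True w(2) j by (auto simp: dn_def)
        moreover have "z \<in> Aset r m" using vis w by (auto simp: Aset_def)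
        ultimately show ?thesis unfolding w(1) by (intro UnI1 concI) auto
      next
        case False
        then obtain u x where u: "v = u @ x" "u \<in> up 1 (j - 1)" "x \<in> dn (1 + (j - 1)) (H - 1 - (j - 1))"
          using split_visit_dn[OF w(2), of "j - 1"] j by auto
        then have "visits (j - 1) v \<ge> visits 0 x" by (auto simp: visits_append up_def)
        then have "x @ z \<in> Bset r m" using u w vis unfolding Bset_def by (intro CollectI exI[of _ x] exI[of _ z]) auto
        moreover have "w = (True # u) @ (x @ z)" using w u by simp
        ultimately show ?thesis using u(2) by (auto intro!: UnI2 concI simp del: append.simps)
      qed
    qed
    then have "pr (Aset (Suc r) m) \<le> pr (((#) True ` dn 1 (j - 1)) \<odot> Aset r m) + pr (((#) True ` up 1 (j - 1)) \<odot> Bset r m)"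
      using pr_mono pr_Un order_trans by meson
    also have "\<dots> = pr ((#) True ` dn 1 (j - 1)) * pr (Aset r m) + pr ((#) True ` up 1 (j - 1)) * pr (Bset r m)"
      by (simp add: pr_conc prefix_free_Cons prefix_free_up prefix_free_dn)
    also have "pr ((#) True ` dn 1 (j - 1)) = (1 - 1/j)/2" using j by (simp add: pr_Cons pr_dn field_simps)
    also have "pr ((#) True ` up 1 (j - 1)) = 1/(2*j)" using j by (simp add: pr_Cons pr_up field_simps)
    finally show "pr (Aset (Suc r) m) \<le> (1 - 1/j)/2 * pr (Aset r m) + 1/(2*j) * pr (Bset r m)" by simp
    have "Bset r (Suc m) \<subseteq> (loops_in j (H - j) \<odot> Bset r m) \<union> (((#) False ` dn (j - 1) 1) \<odot> Aset r m)"
    proof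
      fix y assume "y \<in> Bset r (Suc m)"
      then obtain x w where x: "y = x @ w" "x \<in> dn j (H - j)" "w \<in> lpow (excursion H) r" "visits 0 x + visits j w < Suc m"
        by (auto simp: Bset_def)
      from dn_cases_start[OF x(2) j(1)]
      show "y \<in> (loops_in j (H - j) \<odot> Bset r m) \<union> (((#) False ` dn (j - 1) 1) \<odot> Aset r m)"
      proof (elim disjE exE conjE)
        fix v assume v: "x = False # v" "v \<in> dn (j - 1) 1"
        then have "w \<in> Aset r m" using x by (auto simp: Aset_def)
        then show ?thesis unfolding x(1) v(1) using v(2) by (intro UnI2 concI) auto
      next
        fix c v assume v: "x = c @ v" "c \<in> loops_in j (H - j)" "v \<in> dn j (H - j)" "visits 0 x = Suc (visits 0 v)"
        then have "v @ w \<in> Bset r m" using x unfolding Bset_def by auto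
        then show ?thesis unfolding x(1) v(1) append_assoc using v(2) by (intro UnI1 concI)
      qed
    qed
    then have "pr (Bset r (Suc m)) \<le> pr (loops_in j (H - j) \<odot> Bset r m) + pr (((#) False ` dn (j - 1) 1) \<odot> Aset r m)"
      using pr_mono pr_Un order_trans by meson
    also have "\<dots> = pr (loops_in j (H - j)) * pr (Bset r m) + pr ((#) False ` dn (j - 1) 1) * pr (Aset r m)"
      by (simp add: pr_conc prefix_free_Cons prefix_free_loops_in prefix_free_dn)
    also have "pr ((#) False ` dn (j - 1) 1) = 1/(2*j)" using j by (simp add: pr_Cons pr_dn field_simps)
    also have "pr (loops_in j (H - j)) * pr (Bset r m) \<le> (1 - 1/(2*j)) * pr (Bset r m)"
    proof (rule mult_right_mono)
      have "0 \<le> 1 / (2 * real_of_int (H - j))" using j by simp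
      then show "pr (loops_in j (H - j)) \<le> 1 - 1/(2*j)" using pr_loops_in[of j "H - j"] j by linarith
    qed simp
    finally show "pr (Bset r (Suc m)) \<le> (1 - 1/(2*j)) * pr (Bset r m) + 1/(2*j) * pr (Aset r m)" by simp
  next
    have j': "1 \<le> real_of_int j" using j by simp
    show "(1 - 1/real_of_int j)/2 + 1/(2*j) * (2/3) \<le> (1 - 1 / (3 * j)) / 2" using j' by (simp add: field_simps)
    have "4 * j / (4 * j - 1) = 1 + 1 / (4 * real_of_int j - 1)" using j' by (simp add: field_simps)
    moreover have "1 / (4 * real_of_int j) \<le> 1 / (4 * real_of_int j - 1)" using j' by (intro divide_left_mono) auto
    ultimately have "1 + 1 / (4 * real_of_int j) \<le> 4 * j / (4 * j - 1)" by linarith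
    then have "2/3 * (1 + 1 / (4 * real_of_int j)) \<le> 2/3 * (4 * j / (4 * j - 1))" by (rule mult_left_mono) simp
    moreover have "(1 - 1/(2*j)) * (2/3) + 1/(2*j) = 2/3 * (1 + 1 / (4 * real_of_int j))" using j' by (simp add: field_simps)
    ultimately show "(1 - 1/(2*j)) * (2/3) + 1/(2*j) \<le> 2/3 * (4 * j / (4 * j - 1))" by (simp only:)
    show "1 \<le> 4 * j / (4 * j - 1)" using j' by (simp add: field_simps)
  qed (use j in \<open>auto simp: field_simps\<close>)
  then show ?thesis by (simp add: Aset_def)
qed

text \<open>
  A tall excursion visits \<open>j\<close> about \<open>2 j\<close> times on its way up.  The factor \<open>1/(6 H)\<close> is two thirds of
  the probability \<open>1/(4 H)\<close> of a tall excursion, so few visits to \<open>j\<close> are exponentially unlikely in the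
  number \<open>r\<close> of excursions once \<open>m/j\<close> is small compared with \<open>r\<close>.
\<close>

lemma pr_thin_tall_excursions:
  fixes j H :: int
  assumes j: "1 \<le> j" "2 * j \<le> H"
  shows "pr {w \<in> lpow (tall_excursion H) r. visits j w < m} \<le> (1 / (6 * real_of_int H)) ^ r * (2 * real_of_int j / (2 * real_of_int j - 1)) ^ m"
proof -
  define Aset where "Aset r m = {w \<in> lpow (tall_excursion H) r. visits j w < m}" for r m
  define Bset where "Bset r m = {x @ v @ w | x v w. x \<in> up j (H - j) \<and> v \<in> dn H H \<and>
    w \<in> lpow (tall_excursion H) r \<and> visits 0 x + visits j w < m}" for r m
  \<comment> \<open>Here \<open>x\<close> is \<open>1/(1 - 1/(2 j))\<close>, and \<open>2 j \<le> H\<close> is what makes \<open>\<kappa> = j/(3 H)\<close> large enough.\<close>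
  have "pr (Aset r m) \<le> (1 / (6 * real_of_int H)) ^ r * (2 * real_of_int j / (2 * real_of_int j - 1)) ^ m"
  proof (rule supersolution[where a="\<lambda>r m. pr (Aset r m)" and b="\<lambda>r m. pr (Bset r m)" and \<kappa>="real_of_int j / (3 * real_of_int H)" and x="2 * real_of_int j / (2 * real_of_int j - 1)"
        and pa="0" and pb="1/(2*real_of_int j)" and qa="1 - 1/(2*real_of_int j) - 1/(2*(real_of_int H - real_of_int j))" and qb="1/(4*(real_of_int H - real_of_int j))"])
    fix r m
    show "pr (Aset 0 m) \<le> 1" by simp
    show "pr (Bset r 0) \<le> 0" by (simp add: Bset_def)
    have "Aset (Suc r) m \<subseteq> ((#) True ` up 1 (j - 1)) \<odot> Bset r m"
    proof
      fix w assume "w \<in> Aset (Suc r) m"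
      then obtain v v' z where w: "w = (True # v) @ v' @ z" "v \<in> up 1 (H - 1)" "v' \<in> dn H H"
          "z \<in> lpow (tall_excursion H) r" "visits j w < m"
        by (auto simp: Aset_def conc_def tall_excursion_def)
      then have vis: "visits (j - 1) v + visits j z < m" using j by (auto simp: visits_append dn_def up_def)
      obtain u x where u: "v = u @ x" "u \<in> up 1 (j - 1)" "x \<in> up (1 + (j - 1)) (H - 1 - (j - 1))"
        using split_up[OF w(2), of "j - 1"] j by auto
      then have "visits (j - 1) v \<ge> visits 0 x" by (auto simp: visits_append up_def)
      then have "x @ v' @ z \<in> Bset r m" using u w vis unfolding Bset_def by (intro CollectI exI[of _ x] exI[of _ v'] exI[of _ z]) auto
      moreover have "w = (True # u) @ (x @ v' @ z)" using w u by simp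
      ultimately show "w \<in> ((#) True ` up 1 (j - 1)) \<odot> Bset r m" using u(2) by (auto intro!: concI simp del: append.simps)
    qed
    then have "pr (Aset (Suc r) m) \<le> pr ((#) True ` up 1 (j - 1)) * pr (Bset r m)"
      by (rule pr_conc_le) (intro prefix_free_Cons prefix_free_up)
    also have "pr ((#) True ` up 1 (j - 1)) = 1/(2*real_of_int j)" using j by (simp add: pr_Cons pr_up field_simps)
    finally show "pr (Aset (Suc r) m) \<le> 0 * pr (Aset r m) + 1/(2*real_of_int j) * pr (Bset r m)" by simp
    have "Bset r (Suc m) \<subseteq> (loops_in j (H - j) \<odot> Bset r m) \<union> (((#) True ` up 1 (H - j - 1)) \<odot> dn H H \<odot> Aset r m)"
    proof
      fix y assume "y \<in> Bset r (Suc m)"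
      then obtain x v' w where x: "y = x @ v' @ w" "x \<in> up j (H - j)" "v' \<in> dn H H" "w \<in> lpow (tall_excursion H) r" "visits 0 x + visits j w < Suc m"
        by (auto simp: Bset_def)
      have "1 \<le> H - j" using j by simp
      from up_cases_start[OF x(2) this]
      show "y \<in> (loops_in j (H - j) \<odot> Bset r m) \<union> (((#) True ` up 1 (H - j - 1)) \<odot> dn H H \<odot> Aset r m)"
      proof (elim disjE exE conjE)
        fix v assume v: "x = True # v" "v \<in> up 1 (H - j - 1)"
        then have "w \<in> Aset r m" using x by (auto simp: Aset_def)
        then show ?thesis unfolding x(1) v(1) using v(2) x(3) by (intro UnI2 concI) auto
      next
        fix c v assume v: "x = c @ v" "c \<in> loops_in j (H - j)" "v \<in> up j (H - j)" "visits 0 x = Suc (visits 0 v)"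
        then have "v @ v' @ w \<in> Bset r m" using x unfolding Bset_def by auto
        then show ?thesis unfolding x(1) v(1) append_assoc using v(2) by (intro UnI1 concI)
      qed
    qed
    then have "pr (Bset r (Suc m)) \<le> pr (loops_in j (H - j) \<odot> Bset r m) + pr (((#) True ` up 1 (H - j - 1)) \<odot> dn H H \<odot> Aset r m)"
      using pr_mono pr_Un order_trans by meson
    also have "\<dots> = pr (loops_in j (H - j)) * pr (Bset r m) + pr ((#) True ` up 1 (H - j - 1)) * (pr (dn H H) * pr (Aset r m))"
      by (simp add: pr_conc prefix_free_Cons prefix_free_loops_in prefix_free_dn prefix_free_up)
    also have "pr ((#) True ` up 1 (H - j - 1)) = 1/(2*(real_of_int H - real_of_int j))" using j by (simp add: pr_Cons pr_up field_simps)
    also have "pr (dn H H) = 1/2" using j by (simp add: pr_dn)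
    also have "pr (loops_in j (H - j)) * pr (Bset r m) \<le> (1 - 1/(2*real_of_int j) - 1/(2*(real_of_int H - real_of_int j))) * pr (Bset r m)"
      using pr_loops_in[of j "H - j"] j by (intro mult_right_mono) auto
    finally show "pr (Bset r (Suc m)) \<le> (1 - 1/(2*real_of_int j) - 1/(2*(real_of_int H - real_of_int j))) * pr (Bset r m) + 1/(4*(real_of_int H - real_of_int j)) * pr (Aset r m)" by simp
  next
    have j': "1 \<le> real_of_int j" "2 * real_of_int j \<le> real_of_int H" using j by linarith+
    show "0 + 1/(2*real_of_int j) * (real_of_int j / (3 * real_of_int H)) \<le> 1 / (6 * real_of_int H)" using j' by (simp add: field_simps)
    have "2 * real_of_int j / (2 * real_of_int j - 1) = 1 + 1 / (2 * real_of_int j - 1)" using j' by (simp add: field_simps)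
    moreover have "1 / (2 * real_of_int j) \<le> 1 / (2 * real_of_int j - 1)" using j' by (intro divide_left_mono) auto
    ultimately have x: "1 + 1 / (2 * real_of_int j) \<le> 2 * real_of_int j / (2 * real_of_int j - 1)" by linarith
    define \<kappa> where "\<kappa> = real_of_int j / (3 * real_of_int H)"
    have k0: "0 \<le> \<kappa>" using j' by (simp add: \<kappa>_def)
    have "1/(4*(real_of_int H - real_of_int j)) \<le> \<kappa> * (1/real_of_int j + 1/(2*(real_of_int H - real_of_int j)))"
    proof -
      have "\<kappa> * (1/real_of_int j + 1/(2*(real_of_int H - real_of_int j))) = (2 * (real_of_int H - real_of_int j) + real_of_int j) / (3 * real_of_int H * (2 * (real_of_int H - real_of_int j)))"
        using j' by (simp add: \<kappa>_def field_simps)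
      also have "\<dots> \<ge> (3/2 * real_of_int H) / (3 * real_of_int H * (2 * (real_of_int H - real_of_int j)))"
        using j' by (intro divide_right_mono) auto
      also have "(3/2 * real_of_int H) / (3 * real_of_int H * (2 * (real_of_int H - real_of_int j))) = 1/(4*(real_of_int H - real_of_int j))" using j' by (simp add: field_simps)
      finally show ?thesis by simp
    qed
    also have "\<dots> \<le> \<kappa> * (2 * real_of_int j / (2 * real_of_int j - 1) - (1 - 1/(2*real_of_int j) - 1/(2*(real_of_int H - real_of_int j))))"
      using x k0 by (intro mult_left_mono) (auto simp: add_divide_distrib)
    finally show "(1 - 1/(2*real_of_int j) - 1/(2*(real_of_int H - real_of_int j))) * (real_of_int j / (3 * real_of_int H)) + 1/(4*(real_of_int H - real_of_int j)) \<le> real_of_int j / (3 * real_of_int H) * (2 * real_of_int j / (2 * real_of_int j - 1))"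
      unfolding \<kappa>_def[symmetric] by (simp add: algebra_simps)
    show "1 \<le> 2 * real_of_int j / (2 * real_of_int j - 1)" using j' by (simp add: field_simps)
    have "1 / (2 * real_of_int j) \<le> 1/2" "1 / (2 * (real_of_int H - real_of_int j)) \<le> 1/2" using j' by (auto simp: field_simps)
    then show "0 \<le> 1 - 1/(2*real_of_int j) - 1/(2*(real_of_int H - real_of_int j))" by linarith
  qed (use j in \<open>auto simp: field_simps\<close>)
  then show ?thesis by (simp add: Aset_def)
qed

text \<open>
  Paths that start at an old end, placed at 0, and give all sites below \<open>J\<close> their visits before stepping
  below 0.
\<close>

definition local_thick :: "nat \<Rightarrow> nat \<Rightarrow> int \<Rightarrow> bool list set" where
  "local_thick k m J = {w \<in> lpow (excursion (2 * J)) k \<odot> lpow (tall_excursion (2 * J)) m \<odot> up 1 J.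
     \<forall>y. 0 \<le> y \<and> y < J \<longrightarrow> k \<le> visits y w}"

lemma local_thick_props:
  assumes "w \<in> local_thick k m J" "1 \<le> J"
  shows "disp w = J" "confined (- 1) (4 * J) w" "\<And>y. 0 \<le> y \<Longrightarrow> y < J \<Longrightarrow> k \<le> visits y w"
proof -
  obtain a b c where w: "w = a @ b @ c" "a \<in> lpow (excursion (2 * J)) k" "b \<in> lpow (tall_excursion (2 * J)) m" "c \<in> up 1 J"
    using assms(1) by (auto simp: local_thick_def conc_def)
  have a: "disp a = 0" "confined (-1) (4 * J) a"
    using lpow_excursion_props[OF w(2)] confined_mono[of "-1" "2 * J" a "-1" "4 * J"] assms(2) by auto
  have b: "disp b = 0" "confined (-1) (4 * J) b"
    using lpow_tall_excursion_props[OF w(3)] assms(2) by auto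
  have c: "disp c = J" "confined (-1) (4 * J) c"
    using confined_mono[of "-1" J c "-1" "4 * J"] w(4) assms(2) by (auto simp: up_def)
  show "disp w = J" "confined (- 1) (4 * J) w" using a b c w(1) by (auto simp: confined_append)
  show "\<And>y. 0 \<le> y \<Longrightarrow> y < J \<Longrightarrow> k \<le> visits y w" using assms(1) by (auto simp: local_thick_def)
qed

lemma prefix_free_local_thick: "prefix_free (local_thick k m J)"
  by (rule prefix_free_subset[OF prefix_free_conc[OF prefix_free_lpow[OF prefix_free_excursion]
     prefix_free_conc[OF prefix_free_lpow[OF prefix_free_tall_excursion] prefix_free_up]]])
     (auto simp: local_thick_def)

text \<open>
  The sites up to \<open>c\<close> get their visits from the \<open>k\<close> ordinary excursions, those between \<open>c\<close> and \<open>J\<close> from the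
  \<open>m\<close> tall ones.
\<close>

lemma pr_local_thick:
  fixes J c :: int
  assumes "1 \<le> c" "c < J"
  shows "(1/2) ^ k * (1 / (8 * real_of_int J)) ^ m * (1 / (real_of_int J + 1)) *
    ((1 - 1 / (2 * real_of_int J)) ^ k - (\<Sum>j\<in>{1..c}. (1 - 1 / (12 * real_of_int j)) ^ k)
      - (\<Sum>j\<in>{c<..<J}. (2/3) ^ m * (2 * real_of_int j / (2 * real_of_int j - 1)) ^ k)) \<le> pr (local_thick k m J)"
proof -
  define A B C where "A = lpow (excursion (2 * J)) k" and "B = lpow (tall_excursion (2 * J)) m" and "C = up 1 J"
  define A' where "A' j = {w \<in> A. visits j w < k}" for j
  define B' where "B' j = {w \<in> B. visits j w < k}" for j
  have pfA: "prefix_free A" and pfB: "prefix_free B"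
    unfolding A_def B_def by (intro prefix_free_lpow prefix_free_excursion prefix_free_tall_excursion)+
  have pfA': "prefix_free (A' j)" and pfB': "prefix_free (B' j)" for j
    using prefix_free_subset[OF pfA] prefix_free_subset[OF pfB] by (auto simp: A'_def B'_def)
  have "A \<odot> B \<odot> C \<subseteq> local_thick k m J \<union> ((\<Union>j\<in>{1..c}. A' j \<odot> B \<odot> C) \<union> (\<Union>j\<in>{c<..<J}. A \<odot> B' j \<odot> C))"
  proof
    fix w assume "w \<in> A \<odot> B \<odot> C"
    then obtain a b d where w: "w = a @ b @ d" "a \<in> A" "b \<in> B" "d \<in> C" by (auto simp: conc_def)
    have a: "disp a = 0" "visits 0 a \<ge> k" using lpow_excursion_props[of a "2 * J" k] w(2) assms by (auto simp: A_def)
    have vis: "visits y w \<ge> visits y a" "visits y w \<ge> visits y b" for y using a w(1) by (auto simp: visits_append)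
    show "w \<in> local_thick k m J \<union> ((\<Union>j\<in>{1..c}. A' j \<odot> B \<odot> C) \<union> (\<Union>j\<in>{c<..<J}. A \<odot> B' j \<odot> C))"
    proof (cases "\<forall>y. 0 \<le> y \<and> y < J \<longrightarrow> k \<le> visits y w")
      case True
      then show ?thesis using \<open>w \<in> A \<odot> B \<odot> C\<close> by (auto simp: local_thick_def A_def B_def C_def)
    next
      case False
      then obtain y where y: "0 \<le> y" "y < J" "visits y w < k" by (auto simp: not_le)
      have "y \<noteq> 0" using y a vis[of 0] by auto
      show ?thesis
      proof (cases "y \<le> c")
        case True
        then have "a \<in> A' y" using y vis(1)[of y] w by (auto simp: A'_def)
        then have "w \<in> A' y \<odot> B \<odot> C" unfolding w(1) using w by (intro concI)
        then show ?thesis using True y \<open>y \<noteq> 0\<close> by auto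
      next
        case False
        then have "b \<in> B' y" using y vis(2)[of y] w by (auto simp: B'_def)
        then have "w \<in> A \<odot> B' y \<odot> C" unfolding w(1) using w by (intro concI)
        then show ?thesis using False y by auto
      qed
    qed
  qed
  then have "pr (A \<odot> B \<odot> C) \<le> pr (local_thick k m J \<union> ((\<Union>j\<in>{1..c}. A' j \<odot> B \<odot> C) \<union> (\<Union>j\<in>{c<..<J}. A \<odot> B' j \<odot> C)))"
    by (rule pr_mono)
  also have "\<dots> \<le> pr (local_thick k m J) + (pr (\<Union>j\<in>{1..c}. A' j \<odot> B \<odot> C) + pr (\<Union>j\<in>{c<..<J}. A \<odot> B' j \<odot> C))"
    by (intro order_trans[OF pr_Un] add_left_mono pr_Un)
  also have "\<dots> \<le> pr (local_thick k m J) + ((\<Sum>j\<in>{1..c}. pr (A' j \<odot> B \<odot> C)) + (\<Sum>j\<in>{c<..<J}. pr (A \<odot> B' j \<odot> C)))"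
    by (intro add_left_mono add_mono pr_UN) auto
  finally have main: "pr (A \<odot> B \<odot> C) - (\<Sum>j\<in>{1..c}. pr (A' j \<odot> B \<odot> C)) - (\<Sum>j\<in>{c<..<J}. pr (A \<odot> B' j \<odot> C)) \<le> pr (local_thick k m J)"
    by linarith
  define q where "q = (1/2) ^ k * (1 / (8 * real_of_int J)) ^ m * (1 / (real_of_int J + 1))"
  have q0: "q \<ge> 0" using assms by (simp add: q_def)
  have prC: "pr C = 1 / (real_of_int J + 1)" using assms by (simp add: C_def pr_up)
  have prB: "pr B = (1 / (8 * real_of_int J)) ^ m"
    using assms by (simp add: B_def pr_lpow prefix_free_tall_excursion pr_tall_excursion)
  have prA: "pr A = (1/2) ^ k * (1 - 1 / (2 * real_of_int J)) ^ k"
    using assms by (simp add: A_def pr_lpow prefix_free_excursion pr_excursion power_mult_distrib[symmetric])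
  have prA_le: "pr A \<le> (1/2) ^ k"
  proof -
    have "(1 - 1 / (2 * real_of_int J)) ^ k \<le> 1" using assms by (intro power_le_one) (auto simp: field_simps)
    then show ?thesis unfolding prA by (simp add: mult_left_le)
  qed
  have "pr (A \<odot> B \<odot> C) = q * (1 - 1 / (2 * real_of_int J)) ^ k"
    by (simp add: pr_conc pfA pfB prA prB prC q_def)
  moreover have "pr (A' j \<odot> B \<odot> C) \<le> q * (1 - 1 / (12 * real_of_int j)) ^ k" if "j \<in> {1..c}" for j
  proof -
    define r where "r = real_of_int j"
    have r: "1 \<le> r" using that by (simp add: r_def)
    have "pr (A' j) \<le> ((1 - 1 / (3 * r)) / 2) ^ k * (4 * r / (4 * r - 1)) ^ k"
      using pr_thin_excursions[of j "2 * J" k k] that assms by (simp add: A'_def A_def r_def)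
    also have "\<dots> = ((1 - 1 / (3 * r)) / 2 * (4 * r / (4 * r - 1))) ^ k" by (rule power_mult_distrib[symmetric])
    also have "\<dots> \<le> ((1 - 1 / (12 * r)) / 2) ^ k"
    proof (rule power_mono)
      have "1 - 1 / (3 * r) \<le> (1 - 1 / (12 * r)) * (1 - 1 / (4 * r))" using r by (simp add: field_simps)
      then have "(1 - 1 / (3 * r)) * (4 * r / (4 * r - 1)) \<le> (1 - 1 / (12 * r)) * (1 - 1 / (4 * r)) * (4 * r / (4 * r - 1))"
        using r by (intro mult_right_mono) auto
      also have "(1 - 1 / (12 * r)) * (1 - 1 / (4 * r)) * (4 * r / (4 * r - 1)) = 1 - 1 / (12 * r)"
      proof -
        have "(1 - 1 / (4 * r)) * (4 * r / (4 * r - 1)) = 1" using r by (simp add: field_simps)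
        then show ?thesis by (simp only: mult.assoc mult_1_right)
      qed
      finally show "(1 - 1 / (3 * r)) / 2 * (4 * r / (4 * r - 1)) \<le> (1 - 1 / (12 * r)) / 2"
        unfolding times_divide_eq_left by (rule divide_right_mono) simp
      show "0 \<le> (1 - 1 / (3 * r)) / 2 * (4 * r / (4 * r - 1))" using r by (intro mult_nonneg_nonneg) (auto simp: field_simps)
    qed
    also have "\<dots> = (1/2) ^ k * (1 - 1 / (12 * r)) ^ k" by (simp add: power_mult_distrib[symmetric])
    finally have "pr (A' j) \<le> (1/2) ^ k * (1 - 1 / (12 * r)) ^ k" .
    moreover have "pr (A' j \<odot> B \<odot> C) = pr (A' j) * (pr B * pr C)" by (simp add: pr_conc pfA' pfB)
    ultimately have "pr (A' j \<odot> B \<odot> C) \<le> ((1/2) ^ k * (1 - 1 / (12 * r)) ^ k) * (pr B * pr C)"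
      by (simp add: mult_right_mono)
    then show ?thesis by (simp add: prB prC q_def r_def mult_ac)
  qed
  then have "(\<Sum>j\<in>{1..c}. pr (A' j \<odot> B \<odot> C)) \<le> q * (\<Sum>j\<in>{1..c}. (1 - 1 / (12 * real_of_int j)) ^ k)"
    unfolding sum_distrib_left by (rule sum_mono)
  moreover have "pr (A \<odot> B' j \<odot> C) \<le> q * ((2/3) ^ m * (2 * real_of_int j / (2 * real_of_int j - 1)) ^ k)" if "j \<in> {c<..<J}" for j
  proof -
    have "pr (B' j) \<le> (1 / (6 * real_of_int (2 * J))) ^ m * (2 * real_of_int j / (2 * real_of_int j - 1)) ^ k"
      using pr_thin_tall_excursions[of j "2 * J" m k] that assms by (simp add: B'_def B_def)
    also have "1 / (6 * real_of_int (2 * J)) = 1 / (8 * real_of_int J) * (2/3)" by simp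
    finally have B'_le: "pr (B' j) \<le> (1 / (8 * real_of_int J)) ^ m * ((2/3) ^ m * (2 * real_of_int j / (2 * real_of_int j - 1)) ^ k)"
      by (simp only: power_mult_distrib mult.assoc)
    have "pr A * (pr (B' j) * pr C) \<le> (1/2) ^ k * (((1 / (8 * real_of_int J)) ^ m * ((2/3) ^ m * (2 * real_of_int j / (2 * real_of_int j - 1)) ^ k)) * pr C)"
      using order_trans[OF pr_nonneg B'_le] by (intro mult_mono prA_le B'_le order_refl) auto
    then show ?thesis by (simp add: pr_conc pfA pfB' prC q_def mult_ac)
  qed
  then have "(\<Sum>j\<in>{c<..<J}. pr (A \<odot> B' j \<odot> C)) \<le> q * (\<Sum>j\<in>{c<..<J}. (2/3) ^ m * (2 * real_of_int j / (2 * real_of_int j - 1)) ^ k)"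
    unfolding sum_distrib_left by (rule sum_mono)
  ultimately show ?thesis using main unfolding q_def[symmetric] right_diff_distrib by linarith
qed

text \<open>
  Only the \<open>k\<close> steps from 0 to 1 cost an exponential factor.  Ordinary excursions fail at a site up to
  \<open>c = sqrt k\<close> with probability at most \<open>exp (- sqrt k / 12)\<close> or so.  Beyond \<open>c\<close>, about \<open>k^(3/4)\<close> tall excursions fail with
  probability \<open>(2/3)^(k^(3/4)) exp (sqrt k)\<close>, and each of them costs only a factor polynomial in \<open>k\<close>.
\<close>

lemma local_thick_lower:
  assumes \<epsilon>: "0 < \<epsilon>"
  shows "eventually (\<lambda>k. \<exists>m. 2 powr (- (1 + \<epsilon>) * real k) \<le> pr (local_thick k m (25 * int k ^ 4 + 1))) sequentially"
proof -
  have e1: "eventually (\<lambda>k::nat. (sqrt (real k) + 1) * exp (- (real k / (12 * (sqrt (real k) + 1)))) \<le> 1/8) sequentially"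
    by real_asymp
  have e2: "eventually (\<lambda>k::nat. (25 * real k ^ 4 + 1) * ((2/3) powr (real k powr (3/4)) * exp (sqrt (real k))) \<le> 1/8) sequentially"
    by real_asymp
  have e3: "eventually (\<lambda>k::nat. 2 * (25 * real k ^ 4 + 2) * (8 * (25 * real k ^ 4 + 1)) powr (real k powr (3/4) + 1) \<le> 2 powr (\<epsilon> * real k)) sequentially"
    using \<epsilon> by real_asymp
  have e4: "eventually (\<lambda>k::nat. sqrt (real k) + 2 \<le> 25 * real k ^ 4 + 1) sequentially" by real_asymp
  have e5: "eventually (\<lambda>k::nat. k \<ge> 1) sequentially" by (rule eventually_ge_at_top)
  show ?thesis using e1 e2 e3 e4 e5
  proof eventually_elim
    case (elim k)
    define J where "J = 25 * int k ^ 4 + 1"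
    define c where "c = \<lceil>sqrt (real k)\<rceil>"
    define m where "m = nat \<lceil>real k powr (3/4)\<rceil>"
    define R where "R = real_of_int J"
    have R: "R = 25 * real k ^ 4 + 1" by (simp add: R_def J_def)
    have c: "sqrt (real k) \<le> c" "c \<le> sqrt (real k) + 1" unfolding c_def by linarith+
    have sq: "sqrt (real k) \<ge> 1" using elim(5) by simp
    have c1: "1 \<le> c" using c sq by linarith
    have cJ: "c < J"
    proof -
      have "real_of_int c < R" using c elim(4) R by linarith
      then show ?thesis by (simp add: R_def)
    qed
    have m: "real k powr (3/4) \<le> m" "m \<le> real k powr (3/4) + 1"
    proof -
      have "0 \<le> \<lceil>real k powr (3/4)\<rceil>" using powr_ge_zero[of "real k" "3/4"] by linarith
      then have "real m = real_of_int \<lceil>real k powr (3/4)\<rceil>" by (simp add: m_def)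
      then show "real k powr (3/4) \<le> m" "m \<le> real k powr (3/4) + 1" by linarith+
    qed
    have R1: "R \<ge> 26" using elim(5) by (simp add: R)
    have s0: "(1 - 1 / (2 * R)) ^ k \<ge> 3/4"
    proof -
      have "1 + real k * (- (1 / (2 * R))) \<le> (1 + - (1 / (2 * R))) ^ k"
        using R1 by (intro Bernoulli_inequality) (auto simp: field_simps)
      moreover have "real k / (2 * R) \<le> 1/4"
      proof -
        have "real k * 1 \<le> real k * real k ^ 3" using elim(5) by (intro mult_left_mono) auto
        then have "real k \<le> real k ^ 4" by (simp add: power_Suc[symmetric] eval_nat_numeral)
        moreover have "0 \<le> real k" by simp
        ultimately have "4 * real k \<le> 2 * (25 * real k ^ 4 + 1)" unfolding distrib_left by linarith
        then have "4 * real k \<le> 2 * R" unfolding R .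
        then show ?thesis using R1 by (simp add: field_simps)
      qed
      ultimately show ?thesis by simp
    qed
    have s1: "(\<Sum>j\<in>{1..c}. (1 - 1 / (12 * real_of_int j)) ^ k) \<le> 1/8"
    proof -
      have "(1 - 1 / (12 * real_of_int j)) ^ k \<le> exp (- (real k / (12 * (sqrt (real k) + 1))))" if "j \<in> {1..c}" for j
      proof -
        have j: "1 \<le> real_of_int j" "real_of_int j \<le> sqrt (real k) + 1" using that c by auto
        have "(1 - 1 / (12 * real_of_int j)) \<le> exp (- (1 / (12 * real_of_int j)))"
          using exp_ge_add_one_self[of "- (1 / (12 * real_of_int j))"] by simp
        then have "(1 - 1 / (12 * real_of_int j)) ^ k \<le> exp (- (1 / (12 * real_of_int j))) ^ k"
          using j by (intro power_mono) (auto simp: field_simps)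
        also have "\<dots> = exp (- (real k / (12 * real_of_int j)))" by (simp add: exp_of_nat_mult[symmetric])
        also have "\<dots> \<le> exp (- (real k / (12 * (sqrt (real k) + 1))))"
          using j by (auto intro!: divide_left_mono mult_pos_pos)
        finally show ?thesis .
      qed
      then have "(\<Sum>j\<in>{1..c}. (1 - 1 / (12 * real_of_int j)) ^ k) \<le> (\<Sum>j\<in>{1..c}. exp (- (real k / (12 * (sqrt (real k) + 1)))))"
        by (rule sum_mono)
      also have "\<dots> = real_of_int c * exp (- (real k / (12 * (sqrt (real k) + 1))))" using c1 by simp
      also have "\<dots> \<le> (sqrt (real k) + 1) * exp (- (real k / (12 * (sqrt (real k) + 1))))" using c by (intro mult_right_mono) auto
      finally show ?thesis using elim(1) by linarith
    qed
    have s2: "(\<Sum>j\<in>{c<..<J}. (2/3) ^ m * (2 * real_of_int j / (2 * real_of_int j - 1)) ^ k) \<le> 1/8"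
    proof -
      have "(2/3) ^ m * (2 * real_of_int j / (2 * real_of_int j - 1)) ^ k \<le> (2/3) powr (real k powr (3/4)) * exp (sqrt (real k))"
        if "j \<in> {c<..<J}" for j
      proof (rule mult_mono)
        have "(2/3) ^ m = (2/3::real) powr real m" by (simp add: powr_realpow)
        also have "\<dots> \<le> (2/3) powr (real k powr (3/4))" using m by (intro powr_mono') auto
        finally show "(2/3) ^ m \<le> (2/3::real) powr (real k powr (3/4))" .
        have j: "1 \<le> real_of_int j" "sqrt (real k) \<le> real_of_int j" using that c sq c1 by auto
        have "2 * real_of_int j / (2 * real_of_int j - 1) = 1 + 1 / (2 * real_of_int j - 1)" using j by (simp add: field_simps)
        also have "\<dots> \<le> exp (1 / (2 * real_of_int j - 1))" by (rule exp_ge_add_one_self)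
        finally have "(2 * real_of_int j / (2 * real_of_int j - 1)) ^ k \<le> exp (1 / (2 * real_of_int j - 1)) ^ k"
          using j by (intro power_mono) auto
        also have "\<dots> = exp (real k / (2 * real_of_int j - 1))" by (simp add: exp_of_nat_mult[symmetric])
        also have "\<dots> \<le> exp (sqrt (real k))"
        proof -
          have "real k = sqrt (real k) * sqrt (real k)" by simp
          also have "\<dots> \<le> sqrt (real k) * (2 * real_of_int j - 1)" using j by (intro mult_left_mono) auto
          finally show ?thesis using j by (simp add: pos_divide_le_eq)
        qed
        finally show "(2 * real_of_int j / (2 * real_of_int j - 1)) ^ k \<le> exp (sqrt (real k))" .
        show "0 \<le> (2 * real_of_int j / (2 * real_of_int j - 1)) ^ k" using j by simp
      qed simp
      then have "(\<Sum>j\<in>{c<..<J}. (2/3) ^ m * (2 * real_of_int j / (2 * real_of_int j - 1)) ^ k) \<le>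
          (\<Sum>j\<in>{c<..<J}. (2/3) powr (real k powr (3/4)) * exp (sqrt (real k)))" by (rule sum_mono)
      also have "\<dots> = real (card {c<..<J}) * ((2/3) powr (real k powr (3/4)) * exp (sqrt (real k)))" by simp
      also have "\<dots> \<le> (25 * real k ^ 4 + 1) * ((2/3) powr (real k powr (3/4)) * exp (sqrt (real k)))"
      proof (rule mult_right_mono)
        have "real (card {c<..<J}) \<le> R" using c1 cJ by (simp add: R_def)
        then show "real (card {c<..<J}) \<le> 25 * real k ^ 4 + 1" by (simp add: R)
      qed simp
      finally show ?thesis using elim(2) by linarith
    qed
    define q where "q = (1/2) ^ k * (1 / (8 * R)) ^ m * (1 / (R + 1))"
    have q0: "q > 0" using R1 by (simp add: q_def)
    have "q * (1/2) \<le> pr (local_thick k m J)"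
    proof -
      have "q * (1/2) \<le> q * ((1 - 1 / (2 * R)) ^ k - (\<Sum>j\<in>{1..c}. (1 - 1 / (12 * real_of_int j)) ^ k)
        - (\<Sum>j\<in>{c<..<J}. (2/3) ^ m * (2 * real_of_int j / (2 * real_of_int j - 1)) ^ k))"
        using s0 s1 s2 q0 by (intro mult_left_mono) linarith+
      also have "\<dots> \<le> pr (local_thick k m J)" using pr_local_thick[OF c1 cJ, of k m] by (simp add: q_def R_def)
      finally show ?thesis .
    qed
    moreover have "2 powr (- (1 + \<epsilon>) * real k) \<le> q * (1/2)"
    proof -
      have "2 * (R + 1) * (8 * R) ^ m \<le> 2 * (R + 1) * (8 * R) powr (real k powr (3/4) + 1)"
      proof (rule mult_left_mono)
        have "(8 * R) ^ m = (8 * R) powr real m" using R1 by (subst powr_realpow) auto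
        also have "\<dots> \<le> (8 * R) powr (real k powr (3/4) + 1)" using R1 m by (intro powr_mono) auto
        finally show "(8 * R) ^ m \<le> (8 * R) powr (real k powr (3/4) + 1)" .
      qed (use R1 in simp)
      also have "\<dots> \<le> 2 powr (\<epsilon> * real k)" using elim(3) by (simp add: R add_ac)
      finally have *: "2 * (R + 1) * (8 * R) ^ m \<le> 2 powr (\<epsilon> * real k)" .
      have "2 powr (- (1 + \<epsilon>) * real k) = (1/2) ^ k * (1 / 2 powr (\<epsilon> * real k))"
      proof -
        have "- (1 + \<epsilon>) * real k = - real k + - (\<epsilon> * real k)" by (simp add: algebra_simps)
        then have "2 powr (- (1 + \<epsilon>) * real k) = 2 powr (- real k) * 2 powr (- (\<epsilon> * real k))" by (simp only: powr_add)
        moreover have "2 powr (- real k) = (1/2) ^ k" by (simp add: powr_minus powr_realpow power_one_over inverse_eq_divide)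
        moreover have "2 powr (- (\<epsilon> * real k)) = 1 / 2 powr (\<epsilon> * real k)" by (simp add: powr_minus inverse_eq_divide)
        ultimately show ?thesis by simp
      qed
      also have "\<dots> \<le> (1/2) ^ k * (1 / (2 * (R + 1) * (8 * R) ^ m))"
        using * R1 by (intro mult_left_mono divide_left_mono mult_pos_pos) auto
      also have "\<dots> = q * (1/2)" by (simp add: q_def power_one_over)
      finally show ?thesis .
    qed
    ultimately show ?case unfolding J_def by (intro exI[of _ m]) linarith
  qed
qed

section \<open>Turning at an end of the range\<close>

lemma sum_inverse_squares_le:
  assumes "2 \<le> a"
  shows "(\<Sum>i\<in>{a..b::int}. 1 / (real_of_int i)\<^sup>2) \<le> 1 / (real_of_int a - 1)"
proof (cases "a \<le> b")
  case False
  then show ?thesis using assms by simp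
next
  case True
  then have "(\<Sum>i\<in>{a..b}. 1 / (real_of_int i)\<^sup>2) \<le> 1 / (real_of_int a - 1) - 1 / real_of_int b"
  proof (induction b rule: int_ge_induct)
    case base
    define x where "x = real_of_int a"
    have "2 \<le> x" using assms by (simp add: x_def)
    then have "1 / x\<^sup>2 \<le> 1 / (x - 1) - 1 / x"
      by (simp add: field_simps power2_eq_square)
    then show ?case by (simp add: x_def)
  next
    case (step i)
    define x where "x = real_of_int i"
    have x: "2 \<le> x" using assms step by (simp add: x_def)
    have "1 / (x + 1)\<^sup>2 \<le> 1 / (x * (x + 1))" using x by (intro divide_left_mono) (auto simp: power2_eq_square)
    also have "\<dots> = 1 / x - 1 / (x + 1)" using x by (simp add: field_simps)
    finally have "1 / (x + 1)\<^sup>2 \<le> 1 / x - 1 / (x + 1)" .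
    moreover have "{a..i + 1} = insert (i + 1) {a..i}" using step by auto
    ultimately show ?case using step.IH by (simp add: x_def)
  qed
  moreover have "0 \<le> 1 / real_of_int b" using True assms by simp
  ultimately show ?thesis by linarith
qed

lemma sum_inverse_squares_from_1_le: "(\<Sum>i\<in>{1..b::int}. 1 / (real_of_int i)\<^sup>2) \<le> 2"
proof (cases "1 \<le> b")
  case True
  then have "{1..b} = insert 1 {2..b}" by auto
  then show ?thesis using sum_inverse_squares_le[of 2 b] by simp
qed simp

lemma sum_reflect:
  fixes f :: "int \<Rightarrow> real"
  shows "(\<Sum>i\<in>{a..w}. f (w - i + s)) = (\<Sum>n\<in>{s..w - a + s}. f n)"
  by (rule sum.reindex_bij_witness[of _ "\<lambda>n. w + s - n" "\<lambda>i. w - i + s"]) auto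

text \<open>
  The four products are sums of squares up to the inequality of the geometric and arithmetic mean.  The
  squares of \<open>1/(w - i + h)\<close> have only a bounded sum, the other squares have sums of at most \<open>1/d^2\<close>; so
  the mixed terms are weighted with \<open>d\<close>.
\<close>

lemma two_pass_sum:
  fixes d :: real and J w h S :: int
  assumes d: "1 \<le> d" "d\<^sup>2 + 1 \<le> J" "d\<^sup>2 + 1 \<le> S" and h: "1 \<le> h"
  shows "(\<Sum>i\<in>{J..w}. (1 / real_of_int i + 1 / real_of_int (w - i + h)) * (1 / real_of_int (i + 1) + 1 / real_of_int (w - i + S))) \<le> 5 / d"
proof -
  have d2: "1 \<le> d\<^sup>2" using d(1) by simp
  have "2 \<le> real_of_int J" "2 \<le> real_of_int S" using d d2 by linarith+
  then have JS: "2 \<le> J" "2 \<le> S" by linarith+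
  define X where "X i = (1 / (real_of_int i))\<^sup>2" for i
  have sX: "(\<Sum>i\<in>{J..w}. X i) \<le> 1 / d\<^sup>2"
  proof -
    have "(\<Sum>i\<in>{J..w}. X i) \<le> 1 / (real_of_int J - 1)" using sum_inverse_squares_le[OF JS(1)] by (simp add: X_def power_one_over)
    also have "\<dots> \<le> 1 / d\<^sup>2" using d d2 JS by (intro divide_left_mono mult_pos_pos) auto
    finally show ?thesis .
  qed
  have sQ: "(\<Sum>i\<in>{J..w}. X (w - i + S)) \<le> 1 / d\<^sup>2"
  proof -
    have "(\<Sum>i\<in>{J..w}. X (w - i + S)) \<le> 1 / (real_of_int S - 1)"
      unfolding sum_reflect using sum_inverse_squares_le[OF JS(2)] by (simp add: X_def power_one_over)
    also have "\<dots> \<le> 1 / d\<^sup>2" using d d2 JS by (intro divide_left_mono mult_pos_pos) auto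
    finally show ?thesis .
  qed
  have sY: "(\<Sum>i\<in>{J..w}. X (w - i + h)) \<le> 2"
  proof -
    have "(\<Sum>i\<in>{J..w}. X (w - i + h)) \<le> (\<Sum>i\<in>{J..w}. X (w - i + 1))"
      using h by (intro sum_mono) (auto simp: X_def power_one_over intro!: divide_left_mono power_mono)
    also have "\<dots> \<le> 2" unfolding sum_reflect using sum_inverse_squares_from_1_le by (simp add: X_def power_one_over)
    finally show ?thesis .
  qed
  have pt: "(1 / real_of_int i + 1 / real_of_int (w - i + h)) * (1 / real_of_int (i + 1) + 1 / real_of_int (w - i + S)) \<le>
      (3/2 + d/2) * X i + (1/2 + d/2) * X (w - i + S) + 1 / d * X (w - i + h)" if "i \<in> {J..w}" for i
  proof -
    define x y p q where "x = 1 / real_of_int i" "y = 1 / real_of_int (w - i + h)" "p = 1 / real_of_int (i + 1)" "q = 1 / real_of_int (w - i + S)"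
    have nn: "0 \<le> x" "0 \<le> y" "0 \<le> q" "p \<le> x" using that JS h by (auto simp: x_y_p_q_def intro!: divide_left_mono)
    have yx: "x * y \<le> (y\<^sup>2 / d + d * x\<^sup>2) / 2"
    proof -
      have "0 \<le> (y - d * x)\<^sup>2 / d" using d by simp
      also have "\<dots> = y\<^sup>2 / d + d * x\<^sup>2 - 2 * (x * y)" using d by (simp add: power2_eq_square field_simps)
      finally have "2 * (x * y) \<le> y\<^sup>2 / d + d * x\<^sup>2" by linarith
      then show ?thesis by (simp add: mult.commute mult.left_commute)
    qed
    have yq: "y * q \<le> (y\<^sup>2 / d + d * q\<^sup>2) / 2"
    proof -
      have "0 \<le> (y - d * q)\<^sup>2 / d" using d by simp
      also have "\<dots> = y\<^sup>2 / d + d * q\<^sup>2 - 2 * (y * q)" using d by (simp add: power2_eq_square field_simps)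
      finally have "2 * (y * q) \<le> y\<^sup>2 / d + d * q\<^sup>2" by linarith
      then show ?thesis by (simp add: mult.commute mult.left_commute)
    qed
    have xq: "x * q \<le> (x\<^sup>2 + q\<^sup>2) / 2"
      using sum_squares_bound[of x q] by (simp add: power2_eq_square)
    have "(x + y) * (p + q) \<le> (x + y) * (x + q)" using nn by (intro mult_left_mono) auto
    also have "\<dots> = x\<^sup>2 + x * q + x * y + y * q" by (simp add: power2_eq_square algebra_simps)
    also have "\<dots> \<le> x\<^sup>2 + (x\<^sup>2 + q\<^sup>2) / 2 + (y\<^sup>2 / d + d * x\<^sup>2) / 2 + (y\<^sup>2 / d + d * q\<^sup>2) / 2"
      using yx yq xq by linarith
    also have "\<dots> = (3/2 + d/2) * x\<^sup>2 + (1/2 + d/2) * q\<^sup>2 + 1 / d * y\<^sup>2" using d by (simp add: field_simps)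
    finally show ?thesis by (simp add: x_y_p_q_def X_def)
  qed
  have "(\<Sum>i\<in>{J..w}. (1 / real_of_int i + 1 / real_of_int (w - i + h)) * (1 / real_of_int (i + 1) + 1 / real_of_int (w - i + S))) \<le>
     (\<Sum>i\<in>{J..w}. (3/2 + d/2) * X i + (1/2 + d/2) * X (w - i + S) + 1 / d * X (w - i + h))"
    by (rule sum_mono) (rule pt)
  also have "\<dots> = (3/2 + d/2) * (\<Sum>i\<in>{J..w}. X i) + (1/2 + d/2) * (\<Sum>i\<in>{J..w}. X (w - i + S)) + 1 / d * (\<Sum>i\<in>{J..w}. X (w - i + h))"
    by (simp add: sum.distrib sum_distrib_left)
  also have "\<dots> \<le> (3/2 + d/2) * (1 / d\<^sup>2) + (1/2 + d/2) * (1 / d\<^sup>2) + 1 / d * 2"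
    using sX sQ sY d by (intro add_mono mult_left_mono) auto
  also have "\<dots> = 2 / d\<^sup>2 + 3 / d" using d by (simp add: field_simps power2_eq_square)
  also have "\<dots> \<le> 2 / d + 3 / d" using d by (intro add_right_mono divide_left_mono) (auto simp: power2_eq_square)
  finally show ?thesis by simp
qed

lemma prefix_free_flip: "prefix_free W \<Longrightarrow> prefix_free (map Not ` W)"
  unfolding prefix_free_def
proof (intro ballI impI)
  fix u v assume W: "\<forall>u\<in>W. \<forall>v\<in>W. prefix u v \<longrightarrow> u = v" "u \<in> map Not ` W" "v \<in> map Not ` W" "prefix u v"
  then obtain u' v' where uv: "u = map Not u'" "v = map Not v'" "u' \<in> W" "v' \<in> W" by auto
  moreover have "prefix (map Not u) (map Not v)" using W(4) by (rule map_mono_prefix)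
  ultimately have "prefix u' v'" by simp
  then have "u' = v'" using W(1)[rule_format, OF uv(3,4)] by simp
  then show "u = v" using uv by simp
qed

lemma confined_combine: "confined a b w \<Longrightarrow> confined a' b' w \<Longrightarrow> confined a b' w"
proof (induction w arbitrary: a b a' b')
  case (Cons c w)
  have "confined (a - step_of c) (b - step_of c) w" "confined (a' - step_of c) (b' - step_of c) w"
    using Cons.prems by simp_all
  then have "confined (a - step_of c) (b' - step_of c) w" by (rule Cons.IH)
  then show ?case using Cons.prems by simp
qed simp

lemma ln_le_sum_inverse:
  assumes "1 \<le> a" "a \<le> b"
  shows "ln (real_of_int b + 1) - ln (real_of_int a) \<le> (\<Sum>c\<in>{a..b}. 1 / real_of_int c)"
  using assms(2)
proof (induction b rule: int_ge_induct)
  case base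
  have "ln (real_of_int a + 1) - ln (real_of_int a) = ln ((real_of_int a + 1) / real_of_int a)"
    using assms by (subst ln_div) auto
  also have "(real_of_int a + 1) / real_of_int a = 1 + 1 / real_of_int a" using assms by (simp add: field_simps)
  also have "ln (1 + 1 / real_of_int a) \<le> 1 / real_of_int a" using assms by (intro ln_add_one_self_le_self) auto
  finally show ?case by simp
next
  case (step i)
  define x where "x = real_of_int i + 1"
  have x: "1 \<le> x" using step assms by (simp add: x_def)
  have "ln (x + 1) - ln x = ln ((x + 1) / x)" using x by (subst ln_div) auto
  also have "(x + 1) / x = 1 + 1 / x" using x by (simp add: field_simps)
  also have "ln (1 + 1 / x) \<le> 1 / x" using x by (intro ln_add_one_self_le_self) auto
  finally have "ln (x + 1) - ln x \<le> 1 / x" .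
  moreover have "{a..i + 1} = insert (i + 1) {a..i}" using step by auto
  ultimately show ?case using step.IH by (simp add: x_def)
qed

text \<open>
  In a turn, \<open>L\<close> is the part of the path that serves the sites at height below \<open>J\<close> above the lower end,
  without leaving the range through that end.  Its probability is the only small factor.
\<close>

locale thick_start =
  fixes L :: "bool list set" and k :: nat and J :: int
  assumes J_pos: "1 \<le> J"
    and prefix_free_L: "prefix_free L"
    and L_disp: "\<And>w. w \<in> L \<Longrightarrow> disp w = J"
    and L_confined: "\<And>w. w \<in> L \<Longrightarrow> confined (- 1) (4 * J) w"
    and L_thick: "\<And>w y. w \<in> L \<Longrightarrow> 0 \<le> y \<Longrightarrow> y < J \<Longrightarrow> k \<le> visits y w"
    and k_pos: "1 \<le> k" and J_large: "25 * int k ^ 4 + 1 \<le> J"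
begin

text \<open>
  A turn starts at 0, goes down to the end \<open>-w\<close> before rising to \<open>h\<close>, performs \<open>L\<close> there and climbs to
  \<open>S\<close> before visiting \<open>-w - 1\<close>.  It is bad if some site at height \<open>i \<ge> J\<close> above the end gets fewer than \<open>k\<close> visits
  in each of the two traversals.
\<close>

definition thin_turn :: "int \<Rightarrow> int \<Rightarrow> int \<Rightarrow> bool list set" where
  "thin_turn w h S = (\<Union>i\<in>{J..w}. {u \<in> dn w h. visits (- (w - i)) u < k} \<odot> L \<odot> {v \<in> up (J + 1) (w + S - J). visits (i - J) v < k})"

lemma turn_thick:
  assumes "u \<in> dn w h" "l \<in> L" "v \<in> up (J + 1) (w + S - J)" "u @ l @ v \<notin> thin_turn w h S" "- w \<le> y" "y \<le> 0"
  shows "k \<le> visits y (u @ l @ v)"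
proof -
  have d: "disp u = - w" "disp l = J" using assms L_disp by (auto simp: dn_def)
  have vis: "visits y (u @ l @ v) = visits y u + visits (y + w) l + visits (y + w - J) v"
    using d by (simp add: visits_append algebra_simps)
  show ?thesis
  proof (cases "y + w < J")
    case True
    then show ?thesis using L_thick[OF assms(2), of "y + w"] assms(5) vis by linarith
  next
    case False
    show ?thesis
    proof (rule ccontr)
      assume "\<not> k \<le> visits y (u @ l @ v)"
      then have c: "visits y u < k" "visits (y + w - J) v < k" using vis by linarith+
      have "u @ l @ v \<in> {u \<in> dn w h. visits (- (w - (y + w))) u < k} \<odot> L \<odot> {v \<in> up (J + 1) (w + S - J). visits (y + w - J) v < k}"
        using assms c by (intro concI) auto
      then have "u @ l @ v \<in> thin_turn w h S" unfolding thin_turn_def using False assms by (intro UN_I[of "y + w"]) auto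
      then show False using assms by simp
    qed
  qed
qed

lemma pr_turn:
  assumes "J \<le> w" "1 \<le> h" "1 \<le> S"
  shows "pr (dn w h \<odot> L \<odot> up (J + 1) (w + S - J)) = h / (w + h) * (pr L * ((J + 1) / (w + S + 1)))"
  using assms J_pos by (simp add: pr_conc prefix_free_dn prefix_free_L pr_dn pr_up add_ac)

text \<open>
  At height \<open>i\<close> the first traversal is too quick with probability of order \<open>k/i\<close>, relative to the
  probability of the traversal, and so is the second one.  The two are independent, and the
  resulting \<open>k^2/i^2\<close> sums up to a small number over \<open>i \<ge> J\<close>.  The factors \<open>h/(h+w-i)\<close> and \<open>1/(w-i+S)\<close> account for
  the effect of the two upper boundaries.
\<close>

lemma pr_thin_turn:
  assumes w: "J \<le> w" and h: "1 \<le> h" and S: "25 * int k ^ 4 + 1 \<le> S"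
  shows "pr (thin_turn w h S) \<le> 1/4 * pr (dn w h \<odot> L \<odot> up (J + 1) (w + S - J))"
proof -
  have S1: "1 \<le> S" using S zero_le_power[of "int k" 4] by linarith
  define q where "q = h / (w + h) * (pr L * ((J + 1) / (w + S + 1)))"
  have q0: "0 \<le> q" using w h S1 J_pos by (simp add: q_def)
  \<comment> \<open>Then \<open>d^2 = 25 k^4\<close> is the lower bound for \<open>J\<close> and \<open>S\<close>, and \<open>k^2/4 * (5/d) = 1/4\<close>.\<close>
  define d where "d = 5 * real k ^ 2"
  have d1: "1 \<le> d"
  proof -
    have "1 \<le> real k ^ 2" using k_pos by (intro one_le_power) simp
    then show ?thesis by (simp add: d_def)
  qed
  have d2: "d\<^sup>2 + 1 \<le> J" "d\<^sup>2 + 1 \<le> S"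
  proof -
    have e: "d\<^sup>2 + 1 = real_of_int (25 * int k ^ 4 + 1)" by (simp add: d_def power_mult_distrib)
    show "d\<^sup>2 + 1 \<le> J" "d\<^sup>2 + 1 \<le> S" unfolding e of_int_le_iff using J_large S by auto
  qed
  have "pr (thin_turn w h S) \<le> (\<Sum>i\<in>{J..w}. pr ({u \<in> dn w h. visits (- (w - i)) u < k} \<odot> L \<odot> {v \<in> up (J + 1) (w + S - J). visits (i - J) v < k}))"
    unfolding thin_turn_def by (rule pr_UN) simp
  also have "\<dots> \<le> (\<Sum>i\<in>{J..w}. q * (real k)\<^sup>2 / 4 * ((1 / real_of_int i + 1 / real_of_int (w - i + h)) * (1 / real_of_int (i + 1) + 1 / real_of_int (w - i + S))))"
  proof (rule sum_mono)
    fix i assume i: "i \<in> {J..w}"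
    define i' where "i' = w - i"
    have i1: "1 \<le> i" "0 \<le> i'" using i J_pos by (auto simp: i'_def)
    have t1: "pr {u \<in> dn w h. visits (- i') u < k} \<le> h / (h + i') * (k / (2 * i))"
      using pr_thin_dn[of h i' w k] i1 h by (simp add: i'_def)
    have t2: "pr {v \<in> up (J + 1) (w + S - J). visits (i - J) v < k} \<le> (J + 1) / (i + 1) * (k / (2 * (i' + S)))"
      using pr_thin_up[of "J + 1" "i - J" "w + S - J" k] i J_pos S1 by (simp add: i'_def algebra_simps)
    have "pr ({u \<in> dn w h. visits (- i') u < k} \<odot> L \<odot> {v \<in> up (J + 1) (w + S - J). visits (i - J) v < k})
      = pr {u \<in> dn w h. visits (- i') u < k} * (pr L * pr {v \<in> up (J + 1) (w + S - J). visits (i - J) v < k})"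
    proof -
      have "prefix_free {u \<in> dn w h. visits (- i') u < k}" by (rule prefix_free_subset[OF prefix_free_dn]) auto
      then show ?thesis by (simp only: pr_conc prefix_free_L)
    qed
    also have "\<dots> \<le> h / (h + i') * (k / (2 * i)) * (pr L * ((J + 1) / (i + 1) * (k / (2 * (i' + S)))))"
      using h i1 by (intro mult_mono t1 t2 order_refl) auto
    also have "\<dots> = q * (real k)\<^sup>2 / 4 * ((1 / real_of_int i + 1 / real_of_int (i' + h)) * (1 / real_of_int (i + 1) + 1 / real_of_int (i' + S)))"
    proof -
      have "w = i + i'" by (simp add: i'_def)
      then have ww: "real_of_int w = real_of_int i + real_of_int i'" by simp
      define x y H T where "x = real_of_int i" "y = real_of_int i'" "H = real_of_int h" "T = real_of_int S"
      have pos: "1 \<le> x" "0 \<le> y" "1 \<le> H" "1 \<le> T" using i1 h S1 by (auto simp: x_y_H_T_def)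
      have a: "1 / x + 1 / (y + H) = (x + y + H) / (x * (y + H))" using pos by (simp add: field_simps)
      have b: "1 / (x + 1) + 1 / (y + T) = (x + y + T + 1) / ((x + 1) * (y + T))" using pos by (simp add: field_simps)
      have c: "H / (H + y) * (k / (2 * x)) = H / (x + y + H) * (1 / x + 1 / (y + H)) * (real k / 2)"
      proof -
        have "H / (H + y) * (k / (2 * x)) = H / (x * (y + H)) * (real k / 2)" by (simp add: add.commute mult_ac)
        also have "H / (x * (y + H)) = H / (x + y + H) * (1 / x + 1 / (y + H))" unfolding a using pos by simp
        finally show ?thesis .
      qed
      have c': "(J + 1) / (x + 1) * (k / (2 * (y + T))) = (J + 1) / (x + y + T + 1) * (1 / (x + 1) + 1 / (y + T)) * (real k / 2)"
      proof -
        have "(J + 1) / (x + 1) * (k / (2 * (y + T))) = (J + 1) / ((x + 1) * (y + T)) * (real k / 2)" by (simp add: mult_ac)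
        also have "(J + 1) / ((x + 1) * (y + T)) = (J + 1) / (x + y + T + 1) * (1 / (x + 1) + 1 / (y + T))" unfolding b using pos by simp
        finally show ?thesis .
      qed
      have gen: "(h1 / s * a1 * (c1 / 2)) * (p1 * (g1 / t1 * b1 * (c1 / 2))) = (h1 / s * (p1 * (g1 / t1))) * c1\<^sup>2 / 4 * (a1 * b1)"
        for h1 s a1 c1 p1 g1 t1 b1 :: real by (simp add: power2_eq_square mult_ac)
      have "H / (H + y) * (k / (2 * x)) * (pr L * ((J + 1) / (x + 1) * (k / (2 * (y + T))))) =
         (H / (x + y + H) * (pr L * ((J + 1) / (x + y + T + 1)))) * (real k)\<^sup>2 / 4 * ((1 / x + 1 / (y + H)) * (1 / (x + 1) + 1 / (y + T)))"
        unfolding c c' by (rule gen)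
      then show ?thesis by (simp add: q_def x_y_H_T_def ww)
    qed
    finally show "pr ({u \<in> dn w h. visits (- (w - i)) u < k} \<odot> L \<odot> {v \<in> up (J + 1) (w + S - J). visits (i - J) v < k})
      \<le> q * (real k)\<^sup>2 / 4 * ((1 / real_of_int i + 1 / real_of_int (w - i + h)) * (1 / real_of_int (i + 1) + 1 / real_of_int (w - i + S)))" by (simp add: i'_def)
  qed
  also have "\<dots> = q * (real k)\<^sup>2 / 4 * (\<Sum>i\<in>{J..w}. (1 / real_of_int i + 1 / real_of_int (w - i + h)) * (1 / real_of_int (i + 1) + 1 / real_of_int (w - i + S)))"
    by (rule sum_distrib_left[symmetric])
  also have "\<dots> \<le> q * (real k)\<^sup>2 / 4 * (5 / d)"
    using two_pass_sum[OF d1 d2 h, of w] q0 by (intro mult_left_mono) auto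
  also have "\<dots> = 1/4 * q" using k_pos by (simp add: d_def)
  finally show ?thesis using pr_turn[OF w h S1] by (simp add: q_def)
qed

section \<open>Renewals at the maximum\<close>

text \<open>
  The path ends with the first visit to \<open>b\<close>, and the sites from 0 to \<open>b - 1\<close> have all been visited at least \<open>k\<close> times.
  The sites from \<open>b\<close> on are then fresh, so the walk starts anew: \<open>renewal_after\<close> and \<open>renewal_append\<close>
  say that the levels at which this happens form a renewal sequence.
\<close>

definition renewal :: "int \<Rightarrow> bool list \<Rightarrow> bool" where
  "renewal b p \<longleftrightarrow> disp p = b \<and> (\<exists>a. confined a b p) \<and> (\<forall>y. 0 \<le> y \<and> y < b \<longrightarrow> k \<le> visits y p)"

definition renewals :: "int \<Rightarrow> int \<Rightarrow> bool list set" where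
  "renewals Z b = {p \<in> up Z b. renewal b p}"

lemma prefix_free_renewals: "prefix_free (renewals Z b)"
  by (rule prefix_free_subset[OF prefix_free_up]) (auto simp: renewals_def)

text \<open>
  One way to obtain a renewal is a turn, reflected, at \<open>b - 1\<close>: the walk goes up to \<open>b - 1\<close>, serves the sites
  below it, goes down to \<open>-(b - 1)\<close> and finally up to \<open>b\<close>.
\<close>

lemma pr_renewals:
  assumes b: "J * 4 + 2 \<le> b" and Z: "3 * b \<le> Z"
  shows "pr L / (16 * b) \<le> pr (renewals Z b)"
proof -
  define w where "w = b - 1"
  have w: "4 * J + 1 \<le> w" "25 * int k ^ 4 + 1 \<le> w" using b J_large J_pos by (auto simp: w_def)
  let ?G = "dn w w \<odot> L \<odot> up (J + 1) (w + w - J)"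
  let ?U = "up (Z - w) (2 * w + 1)"
  have pfG: "prefix_free ?G" by (intro prefix_free_conc prefix_free_dn prefix_free_up prefix_free_L)
  have pfT: "prefix_free (thin_turn w w w)"
    by (rule prefix_free_subset[OF pfG]) (auto simp: thin_turn_def conc_def)
  have "map Not ` ?G \<odot> ?U \<subseteq> renewals Z b \<union> map Not ` thin_turn w w w \<odot> ?U"
  proof
    fix z assume "z \<in> map Not ` ?G \<odot> ?U"
    then obtain u l v t where z: "z = map Not (u @ l @ v) @ t" "u \<in> dn w w" "l \<in> L" "v \<in> up (J + 1) (w + w - J)" "t \<in> ?U"
      by (auto simp: conc_def)
    show "z \<in> renewals Z b \<union> map Not ` thin_turn w w w \<odot> ?U"
    proof (cases "u @ l @ v \<in> thin_turn w w w")
      case True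
      then have "map Not (u @ l @ v) \<in> map Not ` thin_turn w w w" by blast
      then show ?thesis unfolding z(1) using z(5) by (intro UnI2 concI)
    next
      case False
      have u: "disp u = - w" "confined (- Z) b (map Not u)"
        using z(2) Z w b J_pos confined_mono[of "- w" w u "- b" "Z"] by (auto simp: dn_def w_def)
      have l: "disp l = J" "confined (- Z - w) (b - w) (map Not l)"
        using L_disp[OF z(3)] L_confined[OF z(3)] Z w b J_pos confined_mono[of "- 1" "4 * J" l "- (b - w)" "- (- Z - w)"] by (auto simp: w_def)
      have v: "disp v = 2 * w - J" "confined (- Z - (w - J)) (b - (w - J)) (map Not v)"
        using z(4) Z w b J_pos confined_mono[of "- (J + 1)" "w + w - J" v "- (b - (w - J))" "- (- Z - (w - J))"] by (auto simp: up_def w_def)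
      have t: "disp t = 2 * w + 1" "confined (- Z + w) (b + w) t"
        using z(5) by (auto simp: up_def w_def)
      have dm: "disp (map Not u) = w" "disp (map Not l) = - J" "disp (map Not v) = J - 2 * w"
        using u l v by simp_all
      have e1: "- Z - w - - J = - Z - (w - J)" "b - w - - J = b - (w - J)"
        "- Z - (w - J) - (J - 2 * w) = - Z + w" "b - (w - J) - (J - 2 * w) = b + w" by simp_all
      have "w + (- J + (J - 2 * w + (2 * w + 1))) = b" by (simp add: w_def)
      then have "z \<in> up Z b" using u(2) l(2) v(2) t(2)
        unfolding z(1) up_def mem_Collect_eq map_append append_assoc confined_append disp_append dm t(1) e1 by blast
      moreover have "k \<le> visits y z" if "0 \<le> y" "y < b" for y
      proof -
        have "k \<le> visits (- y) (u @ l @ v)" using that z False by (intro turn_thick[of u w w l v w]) (auto simp: w_def)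
        also have "\<dots> \<le> visits y z" unfolding z(1) visits_append[of y "map Not _"] visits_map_Not by simp
        finally show ?thesis .
      qed
      ultimately have "z \<in> renewals Z b" unfolding renewals_def renewal_def by (auto simp: up_def)
      then show ?thesis by simp
    qed
  qed
  then have "pr (map Not ` ?G \<odot> ?U) \<le> pr (renewals Z b) + pr (map Not ` thin_turn w w w \<odot> ?U)"
    using pr_mono pr_Un order_trans by meson
  moreover have "pr (map Not ` ?G \<odot> ?U) = pr ?G * pr ?U"
    by (simp only: pr_conc[OF prefix_free_flip[OF pfG]] pr_flip)
  moreover have "pr (map Not ` thin_turn w w w \<odot> ?U) = pr (thin_turn w w w) * pr ?U"
    by (simp only: pr_conc[OF prefix_free_flip[OF pfT]] pr_flip)
  moreover have "pr (thin_turn w w w) * pr ?U \<le> 1/4 * pr ?G * pr ?U"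
    using pr_thin_turn[of w w w] w J_pos by (intro mult_right_mono) auto
  ultimately have "3/4 * (pr ?G * pr ?U) \<le> pr (renewals Z b)" by linarith
  moreover have "pr L / (16 * b) \<le> 3/4 * (pr ?G * pr ?U)"
  proof -
    define x where "x = real_of_int w"
    have x: "1 \<le> x" using w J_pos by (simp add: x_def)
    have "pr ?G = 1/2 * (pr L * ((J + 1) / (2 * x + 1)))"
      using pr_turn[of w w w] w J_pos x by (simp add: x_def)
    moreover have "1 / (2 * x + 1) \<le> (J + 1) / (2 * x + 1)" using x J_pos by (intro divide_right_mono) auto
    then have "1/2 * (pr L * (1 / (2 * x + 1))) \<le> 1/2 * (pr L * ((J + 1) / (2 * x + 1)))"
      by (intro mult_left_mono) auto
    ultimately have G: "1/2 * (pr L * (1 / (2 * x + 1))) \<le> pr ?G" by (simp only:)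
    have "pr ?U = (Z - w) / (Z + w + 1)" using Z b w J_pos by (simp add: pr_up w_def)
    also have "\<dots> \<ge> 1/2" using Z b w J_pos by (simp add: w_def field_simps)
    finally have U: "1/2 \<le> pr ?U" .
    have "1/2 * (pr L * (1 / (2 * x + 1))) * (1/2) \<le> pr ?G * pr ?U"
      using G U by (intro mult_mono) auto
    moreover have "pr L / (16 * b) \<le> 3/4 * (1/2 * (pr L * (1 / (2 * x + 1))) * (1/2))"
    proof -
      have "1 / (16 * (x + 1)) \<le> 3 / 16 * (1 / (2 * x + 1))" using x by (simp add: field_simps)
      then have "pr L * (1 / (16 * (x + 1))) \<le> pr L * (3 / 16 * (1 / (2 * x + 1)))" by (intro mult_left_mono) auto
      then show ?thesis by (simp add: x_def w_def)
    qed
    ultimately show ?thesis by linarith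
  qed
  ultimately show ?thesis by linarith
qed

definition no_renewal :: "int \<Rightarrow> int \<Rightarrow> bool list set" where
  "no_renewal Z N = {x \<in> up Z N. \<not> (\<exists>b\<in>{1..N}. \<exists>p. prefix p x \<and> renewal b p)}"

text \<open>
  A longer level to reach makes it harder to avoid renewals, and a more distant lower boundary easier to
  survive.
\<close>

lemma pr_no_renewal_mono:
  assumes "0 \<le> b" "b \<le> N" shows "pr (no_renewal Z N) \<le> pr (no_renewal (Z + b) (N - b))"
proof (rule pr_mono_prefix)
  fix x assume x: "x \<in> no_renewal Z N"
  then obtain u v where uv: "x = u @ v" "u \<in> up Z (N - b)"
    using split_up[of x Z N "N - b"] assms by (auto simp: no_renewal_def)
  have "u \<in> up (Z + b) (N - b)" using uv(2) confined_mono[of "- Z" "N - b" u "- (Z + b)" "N - b"] assms by (auto simp: up_def)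
  then have "u \<in> no_renewal (Z + b) (N - b)" using x uv assms unfolding no_renewal_def by fastforce
  then show "\<exists>u\<in>no_renewal (Z + b) (N - b). prefix u x" using uv(1) by (intro bexI[of _ u]) simp_all
qed

lemma renewal_after:
  assumes "renewal b p" "renewal b' (p @ r)" "b < b'" "0 \<le> b"
  shows "renewal (b' - b) r"
proof -
  obtain a where a: "confined a b p" using assms by (auto simp: renewal_def)
  obtain a' where a': "confined a' b' (p @ r)" using assms by (auto simp: renewal_def)
  have d: "disp p = b" using assms by (simp add: renewal_def)
  have "k \<le> visits y r" if "0 \<le> y" "y < b' - b" for y
  proof -
    have "k \<le> visits (y + b) (p @ r)" using assms that by (simp add: renewal_def)
    moreover have "visits (y + b) p = 0" using confined_visits[OF a, of "y + b"] that by (cases "visits (y + b) p") auto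
    ultimately show ?thesis using d by (simp add: visits_append)
  qed
  moreover have "confined (a' - b) (b' - b) r" using a' d by (simp add: confined_append)
  ultimately show ?thesis using assms d by (auto simp: renewal_def)
qed

lemma renewal_append:
  assumes "renewal b p" "renewal c r" "0 \<le> b" "0 \<le> c"
  shows "renewal (b + c) (p @ r)"
proof -
  obtain a where a: "confined a b p" using assms by (auto simp: renewal_def)
  obtain a' where a': "confined a' c r" using assms by (auto simp: renewal_def)
  have d: "disp p = b" "disp r = c" using assms by (simp_all add: renewal_def)
  define m where "m = min a (a' + b)"
  have "confined m (b + c) p" using a assms(4) confined_mono[of a b p m "b + c"] by (simp add: m_def)
  moreover have "confined (m - b) (b + c - b) r" using a' confined_mono[of a' c r "m - b" "b + c - b"] by (simp add: m_def)
  ultimately have "confined m (b + c) (p @ r)" using d by (simp add: confined_append)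
  moreover have "k \<le> visits y (p @ r)" if "0 \<le> y" "y < b + c" for y
  proof (cases "y < b")
    case True
    then have "k \<le> visits y p" using assms that by (simp add: renewal_def)
    then show ?thesis by (simp add: visits_append)
  next
    case False
    then have "k \<le> visits (y - b) r" using assms that by (simp add: renewal_def)
    then show ?thesis using d by (simp add: visits_append)
  qed
  ultimately show ?thesis using d by (auto simp: renewal_def)
qed

text \<open>
  The summands bound from below the probabilities that the last renewal up to level \<open>N\<close> is at \<open>b\<close>, and these events
  exclude each other.
\<close>

lemma sum_renewals_no_renewal: "(\<Sum>b\<in>{1..N}. pr (renewals Z b)) * pr (no_renewal Z N) \<le> 1"
proof -
  define X where "X b = renewals Z b \<odot> no_renewal (Z + b) (N - b)" for b
  have "(\<Sum>b\<in>{1..N}. pr (renewals Z b)) * pr (no_renewal Z N) = (\<Sum>b\<in>{1..N}. pr (renewals Z b) * pr (no_renewal Z N))"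
    by (rule sum_distrib_right)
  also have "\<dots> \<le> (\<Sum>b\<in>{1..N}. pr (X b))"
    unfolding X_def pr_conc[OF prefix_free_renewals] by (intro sum_mono mult_left_mono pr_no_renewal_mono) auto
  also have "\<dots> = pr (\<Union>b\<in>{1..N}. X b)"
  proof (rule pr_disjoint_sum[where U="up Z N"])
    fix b assume "b \<in> {1..N}"
    show "X b \<subseteq> up Z N"
    proof
      fix z assume "z \<in> X b"
      then obtain p x where z: "z = p @ x" "p \<in> up Z b" "x \<in> up (Z + b) (N - b)"
        by (auto simp: X_def conc_def renewals_def no_renewal_def)
      have m: "- (Z + b) = - Z - b" by simp
      have "confined (- Z) N p" using z(2) confined_mono[of "- Z" b p "- Z" N] \<open>b \<in> {1..N}\<close> by (simp add: up_def)
      then show "z \<in> up Z N" using z unfolding up_def m by (simp add: confined_append)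
    qed
  next
    have dis: "X b \<inter> X b' = {}" if bb: "b \<in> {1..N}" "b' \<in> {1..N}" "b < b'" for b b'
    proof (rule ccontr)
      assume "X b \<inter> X b' \<noteq> {}"
      then obtain p x p' x' where z: "p @ x = p' @ x'" "p \<in> renewals Z b" "x \<in> no_renewal (Z + b) (N - b)" "p' \<in> renewals Z b'"
        by (auto simp: X_def conc_def)
      have p: "disp p = b" "confined (- Z) b p" "renewal b p" "disp p' = b'" "renewal b' p'"
        using z by (auto simp: renewals_def up_def)
      have "prefix p' (p @ x)" unfolding z(1) by simp
      moreover have "prefix p (p @ x)" by simp
      ultimately have "prefix p' p \<or> prefix p p'" by (rule prefix_same_cases)
      moreover have "\<not> prefix p' p"
        using confined_prefix_strict[OF p(2), of p'] p bb by auto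
      ultimately obtain r where r: "p' = p @ r" by (auto simp: prefix_def)
      have "renewal (b' - b) r" using renewal_after[OF p(3) _ bb(3)] p(5) r bb by auto
      moreover have "prefix r x" using z(1) r by auto
      ultimately show False using z(3) bb unfolding no_renewal_def by force
    qed
    fix i j assume ij: "i \<in> {1..N}" "j \<in> {1..N}" "i \<noteq> j"
    show "X i \<inter> X j = {}" using dis[of i j] dis[of j i] ij by (cases "i < j") auto
  qed (auto simp: prefix_free_up)
  also have "\<dots> \<le> 1" by simp
  finally show ?thesis .
qed

text \<open>
  The sites just below the starting point are served while the walk makes its first \<open>S\<close> levels of
  progress; only renewals after that are of use.
\<close>

definition late_renewal :: "int \<Rightarrow> int \<Rightarrow> int \<Rightarrow> bool list set" where
  "late_renewal Z S N = {x \<in> up Z N. \<exists>b\<in>{S<..N}. \<exists>p. prefix p x \<and> renewal b p}"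

lemma prefix_free_late_renewal: "prefix_free (late_renewal Z S N)"
  by (rule prefix_free_subset[OF prefix_free_up]) (auto simp: late_renewal_def)

text \<open>
  If there is no renewal beyond \<open>S\<close>, then there is none after the last one up to \<open>S\<close>; the starting point counts
  as a renewal at level 0.
\<close>

lemma pr_late_renewal:
  assumes S: "0 \<le> S" "S \<le> N"
  shows "pr (up Z N) \<le> pr (late_renewal Z S N) + (\<Sum>b\<in>{0..S}. pr (no_renewal (Z + b) (N - b)))"
proof -
  have "up Z N \<subseteq> late_renewal Z S N \<union> (\<Union>b\<in>{0..S}. renewals Z b \<odot> no_renewal (Z + b) (N - b))"
  proof
    fix x assume x: "x \<in> up Z N"
    show "x \<in> late_renewal Z S N \<union> (\<Union>b\<in>{0..S}. renewals Z b \<odot> no_renewal (Z + b) (N - b))"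
    proof (cases "x \<in> late_renewal Z S N")
      case False
      define R where "R = {b \<in> {0..S}. \<exists>p. prefix p x \<and> renewal b p}"
      have "renewal 0 []" by (auto simp: renewal_def)
      then have "\<exists>p. prefix p x \<and> renewal 0 p" by (intro exI[of _ "[]"]) simp
      then have R: "0 \<in> R" using S by (simp add: R_def)
      have "R \<subseteq> {0..S}" by (auto simp: R_def)
      then have "finite R" by (rule finite_subset) simp
      note R = this R
      \<comment> \<open>the last renewal up to level \<open>S\<close>\<close>
      define b where "b = Max R"
      have "b \<in> R" using R unfolding b_def by (intro Max_in) auto
      then obtain p r where p: "0 \<le> b" "b \<le> S" "x = p @ r" "renewal b p" by (auto simp: R_def prefix_def)
      have cx: "confined (- Z) N (p @ r)" "disp (p @ r) = N" using x p by (auto simp: up_def)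
      obtain a where "confined a b p" using p by (auto simp: renewal_def)
      then have "confined (- Z) b p" using confined_combine[of "- Z" N p a b] cx by (simp add: confined_append)
      then have "p \<in> renewals Z b" using p by (auto simp: renewals_def up_def renewal_def)
      moreover have "r \<in> no_renewal (Z + b) (N - b)"
      proof -
        have m: "- (Z + b) = - Z - b" by simp
        have "disp p = b" using p by (simp add: renewal_def)
        then have "r \<in> up (Z + b) (N - b)" using cx unfolding up_def m by (simp add: confined_append)
        moreover have "False" if "c \<in> {1..N - b}" "prefix q r" "renewal c q" for c q
        proof -
          have "renewal (b + c) (p @ q)" "prefix (p @ q) x" using renewal_append[OF p(4) that(3)] p that by simp_all
          note pq = this
          have "b + c \<le> S"
          proof (rule ccontr)
            assume "\<not> b + c \<le> S"
            then have "b + c \<in> {S<..N}" using that by simp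
            then have "x \<in> late_renewal Z S N" using pq x unfolding late_renewal_def by blast
            then show False using False by blast
          qed
          then have "b + c \<in> R" using p(1) that(1) pq unfolding R_def by auto
          then have "b + c \<le> b" using R unfolding b_def by (intro Max_ge) auto
          then show False using that by simp
        qed
        ultimately show ?thesis unfolding no_renewal_def by blast
      qed
      ultimately have "x \<in> renewals Z b \<odot> no_renewal (Z + b) (N - b)" unfolding p(3) by (intro concI)
      then show ?thesis using p by auto
    qed simp
  qed
  then have "pr (up Z N) \<le> pr (late_renewal Z S N) + pr (\<Union>b\<in>{0..S}. renewals Z b \<odot> no_renewal (Z + b) (N - b))"
    using pr_mono pr_Un order_trans by meson
  also have "pr (\<Union>b\<in>{0..S}. renewals Z b \<odot> no_renewal (Z + b) (N - b)) \<le> (\<Sum>b\<in>{0..S}. pr (renewals Z b \<odot> no_renewal (Z + b) (N - b)))"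
    by (rule pr_UN) simp
  also have "\<dots> \<le> (\<Sum>b\<in>{0..S}. pr (no_renewal (Z + b) (N - b)))"
    unfolding pr_conc[OF prefix_free_renewals] by (intro sum_mono mult_left_le_one_le) auto
  finally show ?thesis by simp
qed

text \<open>
  By \<open>pr_renewals\<close> the expected number of renewals is at least a multiple of a harmonic sum.
\<close>

lemma pr_no_renewal_le:
  assumes "4 * J + 2 \<le> N" "3 * N \<le> Z"
  shows "pr (no_renewal Z N) * (pr L / 16 * (ln (real_of_int N + 1) - ln (real_of_int (4 * J + 2)))) \<le> 1"
proof -
  have "pr L / 16 * (ln (real_of_int N + 1) - ln (real_of_int (4 * J + 2))) \<le> pr L / 16 * (\<Sum>c\<in>{4 * J + 2..N}. 1 / real_of_int c)"
    using assms J_pos by (intro mult_left_mono ln_le_sum_inverse) auto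
  also have "\<dots> = (\<Sum>c\<in>{4 * J + 2..N}. pr L / (16 * c))" by (simp add: sum_distrib_left)
  also have "\<dots> \<le> (\<Sum>c\<in>{4 * J + 2..N}. pr (renewals Z c))"
    using assms by (intro sum_mono pr_renewals) auto
  also have "\<dots> \<le> (\<Sum>c\<in>{1..N}. pr (renewals Z c))" using J_pos by (intro sum_mono2) auto
  finally have "pr (no_renewal Z N) * (pr L / 16 * (ln (real_of_int N + 1) - ln (real_of_int (4 * J + 2)))) \<le>
     pr (no_renewal Z N) * (\<Sum>c\<in>{1..N}. pr (renewals Z c))" by (intro mult_left_mono) auto
  also have "\<dots> \<le> 1" using sum_renewals_no_renewal by (simp add: mult.commute)
  finally show ?thesis .
qed

lemma pr_late_renewal_ge:
  assumes S: "0 \<le> S" "S + 4 * J + 2 \<le> N" and Z: "3 * N \<le> Z"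
    and N: "64 * (real_of_int S + 1) \<le> pr L * (ln (real_of_int N - real_of_int S) - ln (real_of_int (4 * J + 2)))"
  shows "1/2 \<le> pr (late_renewal Z S N)"
proof -
  have "pr (no_renewal (Z + b) (N - b)) \<le> 1 / (4 * (real_of_int S + 1))" if "b \<in> {0..S}" for b
  proof -
    define c where "c = pr L / 16 * (ln (real_of_int (N - b) + 1) - ln (real_of_int (4 * J + 2)))"
    have "pr L * (ln (real_of_int N - real_of_int S) - ln (real_of_int (4 * J + 2))) \<le> 16 * c"
    proof -
      have "ln (real_of_int N - real_of_int S) \<le> ln (real_of_int (N - b) + 1)"
      proof (rule ln_mono)
        show "0 < real_of_int N - real_of_int S" using S J_pos by linarith
        show "real_of_int N - real_of_int S \<le> real_of_int (N - b) + 1" using that by simp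
      qed
      then show ?thesis unfolding c_def by (simp add: mult_left_mono)
    qed
    then have c: "4 * (real_of_int S + 1) \<le> c" using N by linarith
    have "pr (no_renewal (Z + b) (N - b)) * c \<le> 1"
      unfolding c_def using S Z that by (intro pr_no_renewal_le) auto
    moreover have "pr (no_renewal (Z + b) (N - b)) * (4 * (real_of_int S + 1)) \<le> pr (no_renewal (Z + b) (N - b)) * c"
      using c by (intro mult_left_mono) auto
    ultimately have "pr (no_renewal (Z + b) (N - b)) * (4 * (real_of_int S + 1)) \<le> 1" by linarith
    then show ?thesis using S by (simp add: field_simps)
  qed
  then have "(\<Sum>b\<in>{0..S}. pr (no_renewal (Z + b) (N - b))) \<le> (\<Sum>b\<in>{0..S}. 1 / (4 * (real_of_int S + 1)))"
    by (rule sum_mono)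
  also have "\<dots> = 1/4" using S by (simp add: field_simps)
  finally have "pr (up Z N) \<le> pr (late_renewal Z S N) + 1/4" using pr_late_renewal[of S N Z] S J_pos by linarith
  moreover have "3/4 \<le> pr (up Z N)"
  proof -
    have "pr (up Z N) = Z / (Z + N)" using S Z J_pos by (simp add: pr_up)
    moreover have "3 * real_of_int N \<le> real_of_int Z" "0 < real_of_int N" using S Z J_pos by linarith+
    then have "3/4 \<le> real_of_int Z / real_of_int (Z + N)" by (simp add: field_simps)
    ultimately show ?thesis by simp
  qed
  ultimately show ?thesis by linarith
qed

end

section \<open>Ranges without rarely visited sites\<close>

lemma up_conc: "u \<in> up l r \<Longrightarrow> v \<in> up (l + r) s \<Longrightarrow> 0 \<le> s \<Longrightarrow> u @ v \<in> up l (r + s)"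
proof -
  assume u: "u \<in> up l r" and v: "v \<in> up (l + r) s" and s: "0 \<le> s"
  have "confined (- l) (r + s) u" using u s confined_mono[of "- l" r u "- l" "r + s"] by (simp add: up_def)
  moreover have e: "- l - r = - (l + r)" "r + s - r = s" by simp_all
  have "confined (- l - r) (r + s - r) v" unfolding e using v by (simp add: up_def)
  ultimately show ?thesis using u v by (simp add: up_def confined_append)
qed

text \<open>
  The visited sites fill the interval from \<open>-a\<close> to \<open>b - 1\<close>, each with at least \<open>k\<close> visits.  The margin \<open>r\<close>
  ensures that the interval contains everything that was visited before the path started.
\<close>

definition thick_range :: "nat \<Rightarrow> int \<Rightarrow> bool list \<Rightarrow> bool" where
  "thick_range k r p \<longleftrightarrow> (\<exists>a b. r \<le> a \<and> r < b \<and> confined (- a - 1) b p \<and> (\<forall>y. - a \<le> y \<and> y < b \<longrightarrow> k \<le> visits y p))"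

context thick_start
begin

definition turn_then_renewal :: "int \<Rightarrow> int \<Rightarrow> int \<Rightarrow> bool list set" where
  "turn_then_renewal w S N = dn w 1 \<odot> L \<odot> up (J + 1) (w + 1 - J) \<odot> late_renewal (w + 2) S N"

definition thick_turn :: "int \<Rightarrow> int \<Rightarrow> int \<Rightarrow> bool list set" where
  "thick_turn w S N = {z \<in> turn_then_renewal w S N. \<exists>p b. prefix p z \<and> 1 \<le> b \<and> confined (- w - 1) b p \<and>
     (\<forall>y. - w \<le> y \<and> y < b \<longrightarrow> k \<le> visits y p)}"

lemma prefix_free_turn_then_renewal: "prefix_free (turn_then_renewal w S N)"
  unfolding turn_then_renewal_def
  by (intro prefix_free_conc prefix_free_dn prefix_free_up prefix_free_L prefix_free_late_renewal)

lemma prefix_free_thick_turn: "prefix_free (thick_turn w S N)"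
  by (rule prefix_free_subset[OF prefix_free_turn_then_renewal]) (auto simp: thick_turn_def)

text \<open>
  If the turn is not bad, then at the late renewal the sites of the old range are thick by \<open>turn_thick\<close> and
  the new ones by the definition of a renewal.
\<close>

lemma turn_then_renewal_cases:
  assumes z: "z \<in> turn_then_renewal w S N" and S: "0 \<le> S" and w: "4 * J \<le> w + 1"
  shows "z \<in> thick_turn w S N \<or> (\<exists>t\<in>thin_turn w 1 (S + 1). prefix t z)"
proof -
  obtain u l v x where zs: "z = u @ l @ v @ x" "u \<in> dn w 1" "l \<in> L" "v \<in> up (J + 1) (w + 1 - J)" "x \<in> late_renewal (w + 2) S N"
    using z by (auto simp: turn_then_renewal_def conc_def)
  then obtain b q x' where q: "S < b" "b \<le> N" "x = q @ x'" "renewal b q" and x: "x \<in> up (w + 2) N"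
    by (auto simp: late_renewal_def prefix_def)
  have cq: "confined (- (w + 2)) N q" using x q(3) by (simp add: up_def confined_append)
  obtain a where "confined a b q" using q by (auto simp: renewal_def)
  then have cq': "confined (- (w + 2)) b q" using confined_combine[OF cq] by blast
  then have "q \<in> up (w + 2) b" using q by (simp add: up_def renewal_def)
  then obtain q1 q2 where qq: "q = q1 @ q2" "q1 \<in> up (w + 2) S" using split_up[of q "w + 2" b S] S q by auto
  have vq: "v @ q1 \<in> up (J + 1) (w + (S + 1) - J)"
    using up_conc[of v "J + 1" "w + 1 - J" q1 S] zs(4) qq(2) S by (simp add: algebra_simps)
  show ?thesis
  proof (cases "u @ l @ (v @ q1) \<in> thin_turn w 1 (S + 1)")
    case True
    moreover have "prefix (u @ l @ (v @ q1)) z" using zs q qq by simp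
    ultimately show ?thesis by blast
  next
    case False
    have d: "disp u = - w" "disp l = J" "disp v = w + 1 - J" "disp q = b"
      using zs L_disp q by (auto simp: dn_def up_def renewal_def)
    define p where "p = u @ l @ v @ q"
    have pz: "prefix p z" using zs q by (simp add: p_def)
    have "confined (- w - 1) (1 + b) p"
    proof -
      have 1: "confined (- w - 1) (1 + b) u" using zs(2) confined_mono[of "- w" 1 u "- w - 1" "1 + b"] q S by (simp add: dn_def)
      have 2: "confined (- 1) (1 + b + w) l" using L_confined[OF zs(3)] confined_mono[of "- 1" "4 * J" l "- 1" "1 + b + w"] w q S by simp
      have 3: "confined (- J - 1) (1 + b + w - J) v"
        using zs(4) confined_mono[of "- (J + 1)" "w + 1 - J" v "- J - 1" "1 + b + w - J"] q S by (simp add: up_def)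
      have e: "- w - 1 - - w = - 1" "1 + b - - w = 1 + b + w" "- 1 - J = - J - 1" "- J - 1 - (w + 1 - J) = - (w + 2)" "1 + b + w - J - (w + 1 - J) = b"
        by simp_all
      show ?thesis unfolding p_def confined_append d e using 1 2 3 cq' by blast
    qed
    moreover have "k \<le> visits y p" if "- w \<le> y" "y < 1 + b" for y
    proof (cases "y \<le> 0")
      case True
      have "k \<le> visits y (u @ l @ (v @ q1))"
        using turn_thick[OF zs(2,3) vq False that(1) True] .
      also have "\<dots> \<le> visits y p" unfolding p_def qq(1) by (simp add: visits_append)
      finally show ?thesis .
    next
      case False
      then have "k \<le> visits (y - 1) q" using q(4) that by (simp add: renewal_def)
      also have "\<dots> \<le> visits y p" unfolding p_def by (simp add: visits_append d)
      finally show ?thesis .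
    qed
    ultimately have "z \<in> thick_turn w S N" using z pz q S unfolding thick_turn_def by (intro CollectI conjI exI[of _ p] exI[of _ "1 + b"]) auto
    then show ?thesis by simp
  qed
qed

text \<open>
  The climb to height \<open>S + 1\<close> is at most as likely as the climb to height 1, so the bad turns have at most a quarter
  of the probability of all turns.  This is at most half of what remains after waiting for a late renewal.
\<close>

lemma pr_thick_turn:
  assumes S: "25 * int k ^ 4 \<le> S" and w: "4 * J \<le> w + 1" and lr: "1/2 \<le> pr (late_renewal (w + 2) S N)"
  shows "1/4 * (1 / (w + 1) * (pr L * ((J + 1) / (w + 2)))) \<le> pr (thick_turn w S N)"
proof -
  have S0: "0 \<le> S" using S zero_le_power[of "int k" 4] by linarith
  have Jw: "J \<le> w" using w J_pos by linarith
  define Q where "Q = 1 / (real_of_int w + 1) * (pr L * (real_of_int (J + 1) / (real_of_int w + 2)))"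
  have Q0: "0 \<le> Q" using Jw J_pos by (simp add: Q_def)
  have "pr (turn_then_renewal w S N) \<le> pr (thick_turn w S N \<union> {z \<in> turn_then_renewal w S N. \<exists>t\<in>thin_turn w 1 (S + 1). prefix t z})"
    using turn_then_renewal_cases[OF _ S0 w] by (intro pr_mono) blast
  also have "\<dots> \<le> pr (thick_turn w S N) + pr {z \<in> turn_then_renewal w S N. \<exists>t\<in>thin_turn w 1 (S + 1). prefix t z}"
    by (rule pr_Un)
  also have "pr {z \<in> turn_then_renewal w S N. \<exists>t\<in>thin_turn w 1 (S + 1). prefix t z} \<le> pr (thin_turn w 1 (S + 1))"
    by (rule pr_mono_prefix) auto
  also have "pr (thin_turn w 1 (S + 1)) \<le> 1/4 * pr (dn w 1 \<odot> L \<odot> up (J + 1) (w + (S + 1) - J))"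
    using S Jw by (intro pr_thin_turn) auto
  also have "pr (dn w 1 \<odot> L \<odot> up (J + 1) (w + (S + 1) - J)) = 1 / (real_of_int w + 1) * (pr L * (real_of_int (J + 1) / (real_of_int w + real_of_int S + 2)))"
    using pr_turn[of w 1 "S + 1"] S0 Jw by (simp add: add_ac)
  also have "\<dots> \<le> Q"
    unfolding Q_def using S0 Jw J_pos by (intro mult_left_mono divide_left_mono) auto
  finally have 1: "pr (turn_then_renewal w S N) \<le> pr (thick_turn w S N) + 1/4 * Q" by simp
  have "pr (turn_then_renewal w S N) = pr (dn w 1) * (pr L * (pr (up (J + 1) (w + 1 - J)) * pr (late_renewal (w + 2) S N)))"
    by (simp add: turn_then_renewal_def pr_conc prefix_free_dn prefix_free_L prefix_free_up)
  also have "\<dots> = Q * pr (late_renewal (w + 2) S N)"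
    using Jw J_pos by (simp add: Q_def pr_dn pr_up add_ac)
  also have "\<dots> \<ge> Q * (1/2)" using lr Q0 by (intro mult_left_mono)
  finally show ?thesis using 1 unfolding Q_def[symmetric] by linarith
qed

text \<open>
  Here \<open>-a\<close> is the new minimum at which the walk turns, and \<open>B\<close> is the maximum up to that time.  The final part,
  up to the level \<open>R\<close> before a visit to \<open>-a - 1\<close>, makes the events for different \<open>a\<close> and \<open>B\<close> exclusive.
\<close>

definition turn_at :: "int \<Rightarrow> int \<Rightarrow> int \<Rightarrow> int \<Rightarrow> int \<Rightarrow> bool list set" where
  "turn_at S N R a B = up a B \<odot> thick_turn (a + B) S N \<odot> up (a + B + 2 + N) (R - B - 1 - N)"

lemma turn_at_props:
  assumes z: "z \<in> turn_at S N R a B" and B: "0 \<le> B" "B + 1 + N \<le> R" "4 * J \<le> a + B + 1" "0 \<le> N" and a: "0 \<le> a"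
  shows "z \<in> up (a + 1) R" "\<exists>p. prefix p z \<and> thick_range k (min a B) p"
    "\<exists>x u. x \<in> up a B \<and> x @ u \<in> dn a (B + 1) \<and> prefix (x @ u) z"
proof -
  let ?w = "a + B"
  obtain x y t where zs: "z = x @ y @ t" "x \<in> up a B" "y \<in> thick_turn ?w S N" "t \<in> up (?w + 2 + N) (R - B - 1 - N)"
    using z by (auto simp: turn_at_def conc_def)
  obtain u l v r where ys: "y = u @ l @ v @ r" "u \<in> dn ?w 1" "l \<in> L" "v \<in> up (J + 1) (?w + 1 - J)" "r \<in> up (?w + 2) N"
    using zs(3) by (auto simp: thick_turn_def turn_then_renewal_def conc_def late_renewal_def)
  have d: "disp x = B" "disp u = - ?w" "disp l = J" "disp v = ?w + 1 - J" "disp r = N" "disp t = R - B - 1 - N"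
    using zs ys L_disp by (auto simp: up_def dn_def)
  have cx: "confined (- a - 1) (B + 1) x" using zs(2) confined_mono[of "- a" B x "- a - 1" "B + 1"] by (simp add: up_def)
  have cx': "confined (- a) (B + 1) x" using zs(2) confined_mono[of "- a" B x "- a" "B + 1"] by (simp add: up_def)
  have cu: "confined (- ?w) 1 u" using ys(2) by (simp add: dn_def)
  have e0: "- a - B = - ?w" "B + 1 - B = 1" by simp_all
  have "confined (- a - B) (B + 1 - B) u" unfolding e0 by (rule cu)
  then have xu: "x @ u \<in> dn a (B + 1)" using cx' d by (simp add: dn_def confined_append)
  then show "\<exists>x u. x \<in> up a B \<and> x @ u \<in> dn a (B + 1) \<and> prefix (x @ u) z"
    using zs ys by (intro exI[of _ x] exI[of _ u]) simp
  have "confined (- (a + 1)) R z"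
  proof -
    have 1: "confined (- (a + 1)) R x" using cx confined_mono[of "- a - 1" "B + 1" x "- (a + 1)" R] B by simp
    have 2: "confined (- ?w - 1) (R - B) u" using cu confined_mono[of "- ?w" 1 u "- ?w - 1" "R - B"] B by simp
    have 3: "confined (- 1) (R + a) l" using L_confined[OF ys(3)] confined_mono[of "- 1" "4 * J" l "- 1" "R + a"] B by simp
    have 4: "confined (- J - 1) (R + a - J) v"
      using ys(4) confined_mono[of "- (J + 1)" "?w + 1 - J" v "- J - 1" "R + a - J"] B by (simp add: up_def)
    have 5: "confined (- ?w - 2) (R - B - 1) r"
      using ys(5) confined_mono[of "- (?w + 2)" N r "- ?w - 2" "R - B - 1"] B by (simp add: up_def)
    have 6: "confined (- ?w - 2 - N) (R - B - 1 - N) t"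
      using zs(4) confined_mono[of "- (?w + 2 + N)" "R - B - 1 - N" t "- ?w - 2 - N" "R - B - 1 - N"] by (simp add: up_def)
    have e: "- (a + 1) - B = - ?w - 1" "- ?w - 1 - - ?w = - 1" "R - B - - ?w = R + a" "- 1 - J = - J - 1"
      "- J - 1 - (?w + 1 - J) = - ?w - 2" "R + a - J - (?w + 1 - J) = R - B - 1" by simp_all
    show ?thesis unfolding zs(1) ys(1) append_assoc confined_append d e using 1 2 3 4 5 6 by blast
  qed
  then show "z \<in> up (a + 1) R" unfolding zs(1) ys(1) by (simp add: up_def d)
  obtain p b where p: "prefix p y" "1 \<le> b" "confined (- ?w - 1) b p" "\<And>y. - ?w \<le> y \<Longrightarrow> y < b \<Longrightarrow> k \<le> visits y p"
    using zs(3) unfolding thick_turn_def by blast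
  have "prefix (x @ p) z" using p(1) zs(1) by (auto simp: prefix_def)
  moreover have "thick_range k (min a B) (x @ p)"
  proof -
    have "confined (- a - 1) (B + b) x" using cx confined_mono[of "- a - 1" "B + 1" x "- a - 1" "B + b"] p by simp
    moreover have e: "- a - 1 - B = - ?w - 1" "B + b - B = b" by simp_all
    have "confined (- a - 1) (B + b) (x @ p)" unfolding confined_append d e using calculation p(3) by blast
    moreover have "k \<le> visits y (x @ p)" if "- a \<le> y" "y < B + b" for y
    proof -
      have "k \<le> visits (y - B) p" using that by (intro p(4)) auto
      then show ?thesis by (simp add: visits_append d)
    qed
    ultimately show ?thesis unfolding thick_range_def using p(2) by (intro exI[of _ a] exI[of _ "B + b"]) auto
  qed
  ultimately show "\<exists>p. prefix p z \<and> thick_range k (min a B) p" by blast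
qed

text \<open>
  Both parameters can be read off: \<open>-a\<close> is the minimum of the path, and \<open>B\<close> is its maximum before the first visit
  to \<open>-a\<close>.
\<close>

lemma turn_at_disjoint:
  assumes z: "z \<in> turn_at S N R a B" "z \<in> turn_at S N R a' B'"
    and B: "0 \<le> B" "B + 1 + N \<le> R" "4 * J \<le> a + B + 1" "0 \<le> N" "0 \<le> a"
    and B': "0 \<le> B'" "B' + 1 + N \<le> R" "4 * J \<le> a' + B' + 1" "0 \<le> a'"
  shows "a = a' \<and> B = B'"
proof -
  have *: "a' \<le> a" if z: "z \<in> turn_at S N R a B" "z \<in> turn_at S N R a' B'"
    and B: "0 \<le> B" "B + 1 + N \<le> R" "4 * J \<le> a + B + 1" "0 \<le> N" "0 \<le> a"
    and B': "0 \<le> B'" "B' + 1 + N \<le> R" "4 * J \<le> a' + B' + 1" "0 \<le> a'" for a B a' B'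
  proof -
    obtain p where p: "p \<in> dn a' (B' + 1)" "prefix p z" using turn_at_props(3)[OF z(2) B'(1,2,3) B(4) B'(4)] by blast
    have zz: "confined (- (a + 1)) R z" "disp z = R" using turn_at_props(1)[OF z(1) B] by (simp_all add: up_def)
    have d: "disp p = - a'" using p by (simp add: dn_def)
    then have "p \<noteq> z" using zz B B' by auto
    then have "- (a + 1) < disp p" using confined_prefix_strict[OF zz(1) p(2)] by simp
    then show "a' \<le> a" using d by simp
  qed
  have "a = a'" using *[OF z B B'] *[OF z(2,1) B'(1,2,3) B(4) B'(4) B(1,2,3,5)] by simp
  have **: "B' \<le> B" if z: "z \<in> turn_at S N R a B" "z \<in> turn_at S N R a B'"
    and B: "0 \<le> B" "B + 1 + N \<le> R" "4 * J \<le> a + B + 1" "0 \<le> N" "0 \<le> a"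
    and B': "0 \<le> B'" "B' + 1 + N \<le> R" "4 * J \<le> a + B' + 1" for B B'
  proof -
    obtain x u where x: "x \<in> up a B" "x @ u \<in> dn a (B + 1)" "prefix (x @ u) z" using turn_at_props(3)[OF z(1) B] by blast
    obtain x' u' where x': "x' \<in> up a B'" "x' @ u' \<in> dn a (B' + 1)" "prefix (x' @ u') z"
      using turn_at_props(3)[OF z(2) B'(1,2,3) B(4,5)] by blast
    have c: "confined (- a) (B + 1) (x @ u)" "confined (- a) (B' + 1) (x' @ u')" "disp (x @ u) = - a" "disp (x' @ u') = - a"
      using x(2) x'(2) unfolding dn_def by simp_all
    have "prefix (x @ u) (x' @ u') \<or> prefix (x' @ u') (x @ u)" using x(3) x'(3) by (rule prefix_same_cases)
    then have eq: "x' @ u' = x @ u"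
      using confined_prefix_strict[OF c(1), of "x' @ u'"] confined_prefix_strict[OF c(2), of "x @ u"] c(3,4) by fastforce
    then have "prefix x' (x @ u)" by (metis prefixI)
    show "B' \<le> B"
    proof (cases "x' = x @ u")
      case True
      then have "B' = - a" using x'(1) c(3) by (simp add: up_def)
      then show ?thesis using B B' by simp
    next
      case False
      then show ?thesis using confined_prefix_strict[OF c(1) \<open>prefix x' (x @ u)\<close>] x'(1) by (simp add: up_def)
    qed
  qed
  have "B = B'" using **[OF z(1) z(2)[folded \<open>a = a'\<close>] B B'(1,2,3)[folded \<open>a = a'\<close>]]
    **[OF z(2)[folded \<open>a = a'\<close>] z(1) B'(1,2,3)[folded \<open>a = a'\<close>] B(4,5) B(1,2,3)] by simp
  with \<open>a = a'\<close> show ?thesis by simp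
qed

text \<open>
  Each of the \<open>A^2\<close> pairs of ends contributes a probability of order \<open>pr L / A^2\<close>.
\<close>

lemma pr_thick_range:
  assumes S: "25 * int k ^ 4 \<le> S" "S + 4 * J + 2 \<le> N" and A: "2 * N + 2 \<le> A"
    and N: "64 * (real_of_int S + 1) \<le> pr L * (ln (real_of_int N - real_of_int S) - ln (real_of_int (4 * J + 2)))"
  shows "\<exists>W. W \<subseteq> up (2 * A) (4 * A) \<and> (\<forall>z\<in>W. \<exists>p. prefix p z \<and> thick_range k A p) \<and> pr L / 576 \<le> pr W"
proof -
  have S0: "0 \<le> S" using S zero_le_power[of "int k" 4] by linarith
  define I where "I = {A..<2 * A} \<times> {A..<2 * A}"
  define E where "E i = turn_at S N (4 * A) (fst i) (snd i)" for i
  have I: "A \<le> fst i" "fst i < 2 * A" "A \<le> snd i" "snd i < 2 * A" "0 \<le> fst i" "0 \<le> snd i"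
    "snd i + 1 + N \<le> 4 * A" "4 * J \<le> fst i + snd i + 1" "0 \<le> N" if "i \<in> I" for i
    using that S S0 A J_pos by (auto simp: I_def)
  have EU: "E i \<subseteq> up (2 * A) (4 * A)" if i: "i \<in> I" for i
  proof
    fix z assume "z \<in> E i"
    then have "z \<in> up (fst i + 1) (4 * A)" unfolding E_def using turn_at_props(1) I[OF i] by blast
    then show "z \<in> up (2 * A) (4 * A)"
      using I[OF i] confined_mono[of "- (fst i + 1)" "4 * A" z "- (2 * A)" "4 * A"] by (simp add: up_def)
  qed
  \<comment> \<open>576 is 3 * (4 * 16) * 3: the first and the last part of the path have probability at least 1/3, and
    the turn loses a factor 4 and involves a range of at most \<open>4 A\<close> sites.\<close>
  have prE: "pr L / (576 * (real_of_int A)\<^sup>2) \<le> pr (E i)" if i: "i \<in> I" for i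
  proof -
    define a B where "a = fst i" "B = snd i"
    note aB = I[OF i, folded a_B_def]
    have A0: "1 \<le> A" using A S S0 J_pos by linarith
    have e: "pr (E i) = pr (up a B) * (pr (thick_turn (a + B) S N) * pr (up (a + B + 2 + N) (4 * A - B - 1 - N)))"
      unfolding E_def turn_at_def a_B_def[symmetric]
      by (simp only: pr_conc prefix_free_up prefix_free_thick_turn)
    have 1: "1/3 \<le> pr (up a B)"
    proof -
      have "pr (up a B) = a / (a + B)" using aB A0 by (simp add: pr_up)
      also have "\<dots> \<ge> 1/3" using aB A0 by (simp add: field_simps)
      finally show ?thesis .
    qed
    have 3: "1/3 \<le> pr (up (a + B + 2 + N) (4 * A - B - 1 - N))"
    proof -
      have "pr (up (a + B + 2 + N) (4 * A - B - 1 - N)) = (a + B + 2 + N) / (a + 1 + 4 * A)"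
        using aB A0 by (simp add: pr_up algebra_simps)
      also have "\<dots> \<ge> 1/3" using aB A0 by (simp add: field_simps)
      finally show ?thesis .
    qed
    have 2: "1/4 * (pr L * (1 / (4 * real_of_int A)\<^sup>2)) \<le> pr (thick_turn (a + B) S N)"
    proof -
      define x where "x = real_of_int (a + B)"
      have x: "0 \<le> x" "x + 2 \<le> 4 * real_of_int A" using aB A0 by (auto simp: x_def)
      have "1/2 \<le> pr (late_renewal (a + B + 2) S N)" using aB A S S0 by (intro pr_late_renewal_ge N) auto
      then have "1/4 * (1 / (x + 1) * (pr L * ((J + 1) / (x + 2)))) \<le> pr (thick_turn (a + B) S N)"
        using pr_thick_turn[OF S(1), of "a + B" N] aB by (simp add: x_def)
      moreover have "1 / (4 * real_of_int A)\<^sup>2 \<le> 1 / (x + 1) * (1 / (x + 2))"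
        unfolding power2_eq_square times_divide_times_eq mult_1
        using x by (intro divide_left_mono mult_mono mult_pos_pos) auto
      moreover have "1 / (x + 1) * (1 / (x + 2)) \<le> 1 / (x + 1) * ((J + 1) / (x + 2))"
        using x J_pos by (intro mult_left_mono divide_right_mono) auto
      ultimately have "1 / (4 * real_of_int A)\<^sup>2 \<le> 1 / (x + 1) * ((J + 1) / (x + 2))" by linarith
      then have "pr L * (1 / (4 * real_of_int A)\<^sup>2) \<le> pr L * (1 / (x + 1) * ((J + 1) / (x + 2)))" by (rule mult_left_mono) simp
      then have "1/4 * (pr L * (1 / (4 * real_of_int A)\<^sup>2)) \<le> 1/4 * (pr L * (1 / (x + 1) * ((J + 1) / (x + 2))))"
        by (rule mult_left_mono) simp
      also have "pr L * (1 / (x + 1) * ((J + 1) / (x + 2))) = 1 / (x + 1) * (pr L * ((J + 1) / (x + 2)))" by (rule mult.left_commute)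
      finally have "1/4 * (pr L * (1 / (4 * real_of_int A)\<^sup>2)) \<le> 1/4 * (1 / (x + 1) * (pr L * ((J + 1) / (x + 2))))" .
      then show ?thesis using \<open>1/4 * (1 / (x + 1) * _) \<le> _\<close> by linarith
    qed
    have "pr L / (576 * (real_of_int A)\<^sup>2) = 1/3 * (1/4 * (pr L * (1 / (4 * real_of_int A)\<^sup>2)) * (1/3))"
      by (simp add: power_mult_distrib)
    also have "\<dots> \<le> pr (E i)" unfolding e using 1 2 3 by (intro mult_mono) auto
    finally show ?thesis .
  qed
  have A0: "1 \<le> A" using A S S0 J_pos by linarith
  have "(\<Sum>i\<in>I. pr L / (576 * (real_of_int A)\<^sup>2)) \<le> (\<Sum>i\<in>I. pr (E i))" by (rule sum_mono) (rule prE)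
  moreover have "(\<Sum>i\<in>I. pr L / (576 * (real_of_int A)\<^sup>2)) = pr L / 576"
  proof -
    have "real (card I) = (real_of_int A)\<^sup>2" using A0 by (simp add: I_def power2_eq_square)
    then show ?thesis using A0 by simp
  qed
  moreover have "(\<Sum>i\<in>I. pr (E i)) = pr (\<Union>i\<in>I. E i)"
  proof (rule pr_disjoint_sum[OF _ EU prefix_free_up])
    show "finite I" by (simp add: I_def)
    fix i j assume ij: "i \<in> I" "j \<in> I" "i \<noteq> j"
    show "E i \<inter> E j = {}"
    proof (rule ccontr)
      assume "E i \<inter> E j \<noteq> {}"
      then obtain z where "z \<in> E i" "z \<in> E j" by auto
      then have "fst i = fst j \<and> snd i = snd j" unfolding E_def
        using turn_at_disjoint I[OF ij(1)] I[OF ij(2)] by blast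
      then show False using ij by (simp add: prod_eq_iff)
    qed
  qed
  moreover have "\<exists>p. prefix p z \<and> thick_range k A p" if z: "z \<in> E i" "i \<in> I" for z i
  proof -
    obtain p where "prefix p z" "thick_range k (min (fst i) (snd i)) p"
      using turn_at_props(2) z(1) I[OF z(2)] unfolding E_def by blast
    moreover have "A \<le> min (fst i) (snd i)" using I[OF z(2)] by simp
    ultimately show ?thesis unfolding thick_range_def by (meson order_trans le_less_trans)
  qed
  ultimately have fin: "pr L / 576 \<le> pr (\<Union>i\<in>I. E i)" "\<And>z i. z \<in> E i \<Longrightarrow> i \<in> I \<Longrightarrow> \<exists>p. prefix p z \<and> thick_range k A p"
    by (simp_all only:)
  have "(\<Union>i\<in>I. E i) \<subseteq> up (2 * A) (4 * A)" using EU by blast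
  moreover have "\<forall>z\<in>(\<Union>i\<in>I. E i). \<exists>p. prefix p z \<and> thick_range k A p" using fin(2) by blast
  ultimately show ?thesis using fin(1) by blast
qed

end

text \<open>
  The requirement on \<open>A\<close> is doubly exponential in \<open>k\<close>, because the harmonic sum up to \<open>A\<close> has to
  compensate \<open>pr L\<close> when waiting for a renewal.
\<close>

lemma thick_range_eventually:
  assumes \<epsilon>: "0 < \<epsilon>"
  shows "eventually (\<lambda>k. \<forall>A. 2 powr ((1 + 2 * \<epsilon>) * real k) \<le> ln (real_of_int A) \<and> 0 < A \<longrightarrow>
    (\<exists>W. W \<subseteq> up (2 * A) (4 * A) \<and> (\<forall>z\<in>W. \<exists>p. prefix p z \<and> thick_range k A p) \<and>
      2 powr (- (1 + \<epsilon>) * real k) / 576 \<le> pr W)) sequentially"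
proof -
  have "eventually (\<lambda>k::nat. 64 * (25 * real k ^ 4 + 1) + ln 4 + ln (4 * (25 * real k ^ 4 + 1) + 2) \<le> 2 powr (\<epsilon> * real k)) sequentially"
    using \<epsilon> by real_asymp
  then have e1: "eventually (\<lambda>k::nat. 64 * (25 * real k ^ 4 + 1) \<le>
     2 powr (- (1 + \<epsilon>) * real k) * (2 powr ((1 + 2 * \<epsilon>) * real k) - ln 4 - ln (4 * (25 * real k ^ 4 + 1) + 2))) sequentially"
  proof eventually_elim
    fix k :: nat
    assume k: "64 * (25 * real k ^ 4 + 1) + ln 4 + ln (4 * (25 * real k ^ 4 + 1) + 2) \<le> 2 powr (\<epsilon> * real k)"
    define p c where "p = 2 powr (- (1 + \<epsilon>) * real k)" and "c = ln 4 + ln (4 * (25 * real k ^ 4 + 1) + 2)"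
    have "- (1 + \<epsilon>) * real k \<le> 0" using \<epsilon> by (intro mult_nonpos_nonneg) auto
    then have "p \<le> 2 powr 0" unfolding p_def by (intro powr_mono) auto
    then have p: "p \<le> 1" by simp
    have c0: "0 \<le> c" unfolding c_def by (intro add_nonneg_nonneg ln_ge_zero) auto
    have "p * 2 powr ((1 + 2 * \<epsilon>) * real k) = 2 powr (\<epsilon> * real k)"
      unfolding p_def powr_add[symmetric] by (simp add: algebra_simps)
    moreover have "p * c \<le> c" using p c0 by (simp add: mult_left_le_one_le p_def)
    moreover have "p * (2 powr ((1 + 2 * \<epsilon>) * real k) - ln 4 - ln (4 * (25 * real k ^ 4 + 1) + 2)) = p * 2 powr ((1 + 2 * \<epsilon>) * real k) - p * c"
      by (simp add: c_def algebra_simps)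
    ultimately have "64 * (25 * real k ^ 4 + 1) \<le> p * (2 powr ((1 + 2 * \<epsilon>) * real k) - ln 4 - ln (4 * (25 * real k ^ 4 + 1) + 2))"
      using k unfolding c_def by linarith
    then show "64 * (25 * real k ^ 4 + 1) \<le>
     2 powr (- (1 + \<epsilon>) * real k) * (2 powr ((1 + 2 * \<epsilon>) * real k) - ln 4 - ln (4 * (25 * real k ^ 4 + 1) + 2))"
      by (simp only: p_def)
  qed
  have e2: "eventually (\<lambda>k::nat. 4 * (125 * real k ^ 4 + 20) \<le> exp (2 powr ((1 + 2 * \<epsilon>) * real k))) sequentially"
    using \<epsilon> by real_asymp
  have e3: "eventually (\<lambda>k::nat. k \<ge> 1) sequentially" by (rule eventually_ge_at_top)
  show ?thesis using e1 e2 e3 local_thick_lower[OF \<epsilon>]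
  proof (eventually_elim, intro allI impI)
    fix k :: nat and A :: int
    assume k: "64 * (25 * real k ^ 4 + 1) \<le>
     2 powr (- (1 + \<epsilon>) * real k) * (2 powr ((1 + 2 * \<epsilon>) * real k) - ln 4 - ln (4 * (25 * real k ^ 4 + 1) + 2))"
     "4 * (125 * real k ^ 4 + 20) \<le> exp (2 powr ((1 + 2 * \<epsilon>) * real k))" "1 \<le> k"
     and "\<exists>m. 2 powr (- (1 + \<epsilon>) * real k) \<le> pr (local_thick k m (25 * int k ^ 4 + 1))"
     and A: "2 powr ((1 + 2 * \<epsilon>) * real k) \<le> ln (real_of_int A) \<and> 0 < A"
    then obtain m where m: "2 powr (- (1 + \<epsilon>) * real k) \<le> pr (local_thick k m (25 * int k ^ 4 + 1))" by blast
    define J S where "J = 25 * int k ^ 4 + 1" and "S = 25 * int k ^ 4"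
    define L where "L = local_thick k m J"
    have J1: "1 \<le> J" by (simp add: J_def)
    interpret thick_start L k J
    proof unfold_locales
      show "1 \<le> J" by (rule J1)
      show "prefix_free L" unfolding L_def by (rule prefix_free_local_thick)
      show "1 \<le> k" by (rule k(3))
      show "25 * int k ^ 4 + 1 \<le> J" by (simp add: J_def)
      fix w assume "w \<in> L"
      then have w: "w \<in> local_thick k m J" by (simp add: L_def)
      show "disp w = J" "confined (- 1) (4 * J) w" using local_thick_props[OF w J1] by blast+
      show "k \<le> visits y w" if "0 \<le> y" "y < J" for y using local_thick_props(3)[OF w J1 that] .
    qed
    define N where "N = (A - 2) div 2"
    have "exp (2 powr ((1 + 2 * \<epsilon>) * real k)) \<le> exp (ln (real_of_int A))"
      by (subst exp_le_cancel_iff) (use A in blast)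
    then have "4 * (125 * real k ^ 4 + 20) \<le> real_of_int A" using k(2) A by simp
    then have "real_of_int (4 * (125 * int k ^ 4 + 20)) \<le> real_of_int A" by simp
    then have A4: "4 * (125 * int k ^ 4 + 20) \<le> A" by (simp only: of_int_le_iff)
    have NA: "2 * N + 2 \<le> A" "A \<le> 2 * N + 3" by (auto simp: N_def)
    have q0: "0 \<le> int k ^ 4" by simp
    have NS: "A \<le> 4 * (N - S)" "S + 4 * J + 2 \<le> N" 
    proof -
      define q where "q = int k ^ 4"
      show "A \<le> 4 * (N - S)" "S + 4 * J + 2 \<le> N"
        using NA A4 q0 unfolding S_def J_def q_def[symmetric] by auto
    qed
    have "\<exists>W. W \<subseteq> up (2 * A) (4 * A) \<and> (\<forall>z\<in>W. \<exists>p. prefix p z \<and> thick_range k A p) \<and> pr L / 576 \<le> pr W"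
    proof (rule pr_thick_range[OF _ NS(2) NA(1)])
      show "25 * int k ^ 4 \<le> S" by (simp add: S_def)
      have "ln (real_of_int A) - ln 4 \<le> ln (real_of_int N - real_of_int S)"
      proof -
        have "real_of_int A \<le> real_of_int (4 * (N - S))" using NS(1) by (simp only: of_int_le_iff)
        then have "real_of_int A / 4 \<le> real_of_int N - real_of_int S" by simp
        then have "ln (real_of_int A / 4) \<le> ln (real_of_int N - real_of_int S)" using A by (intro ln_mono) auto
        then show ?thesis using A by (simp add: ln_div)
      qed
      moreover have "real_of_int (4 * J + 2) = 4 * (25 * real k ^ 4 + 1) + 2" by (simp add: J_def)
      ultimately have "2 powr ((1 + 2 * \<epsilon>) * real k) - ln 4 - ln (4 * (25 * real k ^ 4 + 1) + 2) \<le>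
          ln (real_of_int N - real_of_int S) - ln (real_of_int (4 * J + 2))" (is "?x \<le> ?y") using A by simp
      have "0 < 64 * (25 * real k ^ 4 + 1)" by (simp add: add_nonneg_pos)
      then have "0 < 2 powr (- (1 + \<epsilon>) * real k) * ?x" using k(1) by (rule less_le_trans)
      then have "0 < ?x" by (simp add: zero_less_mult_iff)
      have "64 * (25 * real k ^ 4 + 1) \<le> pr L * ?y"
        using k(1) m \<open>?x \<le> ?y\<close> \<open>0 < ?x\<close>
          mult_mono[of "2 powr (- (1 + \<epsilon>) * real k)" "pr L" ?x ?y] by (simp add: L_def J_def)
      then show "64 * (real_of_int S + 1) \<le> pr L * ?y" by (simp add: S_def)
    qed
    then show "\<exists>W. W \<subseteq> up (2 * A) (4 * A) \<and> (\<forall>z\<in>W. \<exists>p. prefix p z \<and> thick_range k A p) \<and>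
      2 powr (- (1 + \<epsilon>) * real k) / 576 \<le> pr W"
      using m unfolding L_def J_def by (meson divide_right_mono order_trans zero_le_numeral)
  qed
qed

section \<open>Stages of bounded length\<close>

text \<open>
  A stage ends when the walk leaves an interval, but after \<open>n\<close> steps at the latest.  So the time at which a
  stage ends and the sites visited until then are bounded by constants.
\<close>

definition capped_exit :: "int \<Rightarrow> nat \<Rightarrow> bool list set" where
  "capped_exit r n = {w. confined (- r) r w \<and> length w \<le> n \<and> (\<bar>disp w\<bar> = r \<or> length w = n)}"

lemma prefix_free_capped_exit: "prefix_free (capped_exit r n)"
  unfolding prefix_free_def
proof (intro ballI impI, rule ccontr)
  fix u v assume uv: "u \<in> capped_exit r n" "v \<in> capped_exit r n" "prefix u v" "u \<noteq> v"
  then have "confined (- r) r v" by (simp add: capped_exit_def)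
  then have "- r < disp u" "disp u < r" using confined_prefix_strict uv(3,4) by blast+
  then have "length u = n" using uv(1) by (auto simp: capped_exit_def)
  moreover have "length u < length v" using uv(3,4) by (intro prefix_length_less strict_prefixI)
  ultimately show False using uv(2) by (simp add: capped_exit_def)
qed

lemma stream_exits:
  assumes "a \<le> 0" "0 \<le> b"
  shows "\<exists>i\<le>n. confined a b (stake i s) \<and> (disp (stake i s) = a \<or> disp (stake i s) = b \<or> i = n)"
  using assms
proof (induction n arbitrary: a b s)
  case 0
  then show ?case by simp
next
  case (Suc n)
  show ?case
  proof (cases "a = 0 \<or> b = 0")
    case True
    then show ?thesis by (intro exI[of _ 0]) auto
  next
    case False
    then have "a - step_of (shd s) \<le> 0" "0 \<le> b - step_of (shd s)" using Suc.prems by auto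
    from Suc.IH[OF this, of "stl s"] obtain i where i: "i \<le> n" "confined (a - step_of (shd s)) (b - step_of (shd s)) (stake i (stl s))"
      "disp (stake i (stl s)) = a - step_of (shd s) \<or> disp (stake i (stl s)) = b - step_of (shd s) \<or> i = n" by blast
    have "confined a b (stake (Suc i) s)" using i(2) False Suc.prems by simp
    moreover have "disp (stake (Suc i) s) = a \<or> disp (stake (Suc i) s) = b \<or> Suc i = Suc n" using i(3) by auto
    ultimately show ?thesis using i(1) by (intro exI[of _ "Suc i"]) simp
  qed
qed

lemma capped_exit_complete:
  assumes "0 \<le> r" shows "\<exists>i. stake i s \<in> capped_exit r n"
proof -
  obtain i where "i \<le> n" "confined (- r) r (stake i s)" "disp (stake i s) = - r \<or> disp (stake i s) = r \<or> i = n"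
    using stream_exits[of "- r" r n s] assms by auto
  then have "stake i s \<in> capped_exit r n" using assms by (auto simp: capped_exit_def)
  then show ?thesis by blast
qed

definition staying :: "int \<Rightarrow> int \<Rightarrow> nat \<Rightarrow> bool list set" where
  "staying a b n = {w. length w = n \<and> confined a b w \<and> a < disp w \<and> disp w < b}"

text \<open>
  The sum over all \<open>m\<close> is the expected time to leave the interval.  The bound is the solution of
  \<open>g = 1 + average of g at the two neighbours\<close> that vanishes at \<open>a\<close> and \<open>b\<close>.
\<close>

lemma sum_pr_staying: "a \<le> 0 \<Longrightarrow> 0 \<le> b \<Longrightarrow> (\<Sum>m<n. pr (staying a b m)) \<le> - a * b"
proof (induction n arbitrary: a b)
  case 0
  then show ?case by (simp add: mult_nonpos_nonneg)
next
  case (Suc n)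
  show ?case
  proof (cases "a = 0 \<or> b = 0")
    case True
    have "staying a b m = {}" for m
    proof -
      have "w \<notin> staying a b m" for w using True by (cases w) (auto simp: staying_def)
      then show ?thesis by blast
    qed
    then show ?thesis using True by auto
  next
    case False
    then have ab: "a + 1 \<le> 0" "0 \<le> b - 1" using Suc.prems by auto
    have step: "pr (staying a b (Suc m)) = (pr (staying (a - 1) (b - 1) m) + pr (staying (a + 1) (b + 1) m)) / 2" for m
    proof -
      have "{v. True # v \<in> staying a b (Suc m)} = staying (a - 1) (b - 1) m"
           "{v. False # v \<in> staying a b (Suc m)} = staying (a + 1) (b + 1) m"
        using ab by (auto simp: staying_def)
      then show ?thesis using pr_step[of "staying a b (Suc m)"] by (simp add: staying_def)
    qed
    have "(\<Sum>m<Suc n. pr (staying a b m)) = pr (staying a b 0) + (\<Sum>m<n. pr (staying a b (Suc m)))"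
      by (rule sum.lessThan_Suc_shift)
    also have "(\<Sum>m<n. pr (staying a b (Suc m))) = ((\<Sum>m<n. pr (staying (a - 1) (b - 1) m)) + (\<Sum>m<n. pr (staying (a + 1) (b + 1) m))) / 2"
      by (simp add: step sum.distrib sum_divide_distrib[symmetric])
    also have "pr (staying a b 0) \<le> 1" by simp
    also have "(\<Sum>m<n. pr (staying (a - 1) (b - 1) m)) \<le> - (a - 1) * (b - 1)" using Suc.IH[of "a - 1" "b - 1"] ab by simp
    also have "(\<Sum>m<n. pr (staying (a + 1) (b + 1) m)) \<le> - (a + 1) * (b + 1)" using Suc.IH[of "a + 1" "b + 1"] ab by simp
    also have "1 + (real_of_int (- (a - 1) * (b - 1)) + real_of_int (- (a + 1) * (b + 1))) / 2 = - a * b"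
      by (simp add: field_simps)
    finally show ?thesis by simp
  qed
qed

lemma pr_staying_le:
  assumes "0 \<le> r" "0 < n"
  shows "pr (staying (- r) r n) \<le> (real_of_int r)\<^sup>2 / n"
proof -
  have "pr (staying (- r) r n) \<le> pr (staying (- r) r m)" if "m < n" for m
  proof (rule pr_mono_prefix)
    fix w assume w: "w \<in> staying (- r) r n"
    define u where "u = take m w"
    have u: "prefix u w" "u \<noteq> w" "length u = m" using that w by (auto simp: u_def staying_def take_is_prefix)
    then have "- r < disp u \<and> disp u < r" using w confined_prefix_strict by (auto simp: staying_def)
    moreover have "confined (- r) r u" using u(1) w by (auto simp: staying_def prefix_def confined_append)
    ultimately have "u \<in> staying (- r) r m" using u by (simp add: staying_def)
    then show "\<exists>u\<in>staying (- r) r m. prefix u w" using u by blast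
  qed
  then have "(\<Sum>m<n. pr (staying (- r) r n)) \<le> (\<Sum>m<n. pr (staying (- r) r m))" by (intro sum_mono) auto
  also have "\<dots> \<le> - (- r) * r" using sum_pr_staying[of "- r" r n] assms by simp
  finally have "n * pr (staying (- r) r n) \<le> (real_of_int r)\<^sup>2" by (simp add: power2_eq_square)
  then show ?thesis using assms by (simp add: field_simps)
qed

fun blocks :: "(nat \<Rightarrow> 'a list set) \<Rightarrow> nat \<Rightarrow> 'a list set" where
  "blocks X 0 = {[]}"
| "blocks X (Suc i) = blocks X i \<odot> X i"

lemma prefix_free_blocks: "(\<And>i. prefix_free (X i)) \<Longrightarrow> prefix_free (blocks X n)"
  by (induction n) (auto intro: prefix_free_conc)

text \<open>
  The second Borel-Cantelli lemma for successive independent pieces of the stream of tosses: failure in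
  all pieces from some index on has probability at most \<open>exp\<close> of minus a divergent sum.
\<close>

lemma blocks_infinitely_often:
  assumes pf: "\<And>i. prefix_free (X i)" and complete: "\<And>i s. \<exists>n. stake n s \<in> X i"
    and Y: "\<And>i. Y i \<subseteq> X i" and div: "\<not> summable (\<lambda>i. pr (Y i))"
  shows "AE s in coin_tosses. \<exists>\<^sub>\<infinity>i. \<exists>u v n. u \<in> blocks X i \<and> v \<in> Y i \<and> stake n s = u @ v"
proof -
  define succ where "succ i s \<longleftrightarrow> (\<exists>u v n. u \<in> blocks X i \<and> v \<in> Y i \<and> stake n s = u @ v)" for i s
  have "AE s in coin_tosses. \<exists>i\<ge>i0. succ i s" for i0
  proof -
    \<comment> \<open>the words with failures in the pieces \<open>i0, ..., i0 + m - 1\<close>\<close>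
    define G where "G m = rec_nat (blocks X i0) (\<lambda>m g. g \<odot> (X (i0 + m) - Y (i0 + m))) m" for m
    have G0: "G 0 = blocks X i0" and GS: "G (Suc m) = G m \<odot> (X (i0 + m) - Y (i0 + m))" for m by (simp_all add: G_def)
    have GX: "G m \<subseteq> blocks X (i0 + m)" for m
    proof (induction m)
      case (Suc m)
      show ?case unfolding GS add_Suc_right blocks.simps by (rule conc_mono[OF Suc]) auto
    qed (simp add: G0)
    have pfG: "prefix_free (G m)" for m by (rule prefix_free_subset[OF prefix_free_blocks[OF pf] GX])
    have prXY: "pr (X i - Y i) \<le> 1 - pr (Y i)" for i
    proof -
      have "(\<Sum>b\<in>{True, False}. pr (if b then X i - Y i else Y i)) = pr (\<Union>b\<in>{True, False}. if b then X i - Y i else Y i)"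
        using Y[of i] by (intro pr_disjoint_sum[OF _ _ pf[of i]]) (auto split: if_splits)
      then have "pr (X i - Y i) + pr (Y i) \<le> 1" by simp
      then show ?thesis by simp
    qed
    have prG: "pr (G m) \<le> exp (- (\<Sum>j<m. pr (Y (i0 + j))))" for m
    proof (induction m)
      case (Suc m)
      have "pr (G (Suc m)) = pr (G m) * pr (X (i0 + m) - Y (i0 + m))" by (simp add: GS pr_conc pfG)
      also have "\<dots> \<le> exp (- (\<Sum>j<m. pr (Y (i0 + j)))) * exp (- pr (Y (i0 + m)))"
      proof (intro mult_mono Suc)
        show "pr (X (i0 + m) - Y (i0 + m)) \<le> exp (- pr (Y (i0 + m)))"
          using prXY[of "i0 + m"] exp_ge_add_one_self[of "- pr (Y (i0 + m))"] by linarith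
      qed auto
      finally show ?case by (simp add: exp_add[symmetric])
    qed simp
    have sub: "{s. \<not> (\<exists>i\<ge>i0. succ i s)} \<subseteq> cyl (G m)" for m
    proof (induction m)
      case 0
      have "\<exists>n. stake n s \<in> blocks X i" for i s
      proof (induction i)
        case 0 then show ?case by (intro exI[of _ 0]) simp
      next
        case (Suc i)
        then obtain n where n: "stake n s \<in> blocks X i" by blast
        obtain k where "stake k (sdrop n s) \<in> X i" using complete by blast
        then have "stake (n + k) s \<in> blocks X (Suc i)" using n by (simp add: stake_add[symmetric] concI del: stake_add)
        then show ?case by blast
      qed
      then show ?case by (auto simp: G0 cyl_def)
    next
      case (Suc m)
      show ?case
      proof
        fix s assume s: "s \<in> {s. \<not> (\<exists>i\<ge>i0. succ i s)}"
        then obtain n where n: "stake n s \<in> G m" using Suc by (auto simp: cyl_def)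
        obtain k where k: "stake k (sdrop n s) \<in> X (i0 + m)" using complete by blast
        have "stake k (sdrop n s) \<notin> Y (i0 + m)"
        proof
          assume "stake k (sdrop n s) \<in> Y (i0 + m)"
          moreover have "stake n s \<in> blocks X (i0 + m)" using n GX[of m] by blast
          moreover have "stake (n + k) s = stake n s @ stake k (sdrop n s)" by simp
          ultimately have "succ (i0 + m) s" unfolding succ_def by blast
          then show False using s by auto
        qed
        then have "stake (n + k) s \<in> G (Suc m)" using n k by (simp add: GS stake_add[symmetric] concI del: stake_add)
        then show "s \<in> cyl (G (Suc m))" by (auto simp: cyl_def)
      qed
    qed
    have lim: "(\<lambda>m. exp (- (\<Sum>j<m. pr (Y (i0 + j))))) \<longlonglongrightarrow> 0"
    proof -
      have "\<not> summable (\<lambda>j. pr (Y (i0 + j)))" using div summable_iff_shift[of "\<lambda>i. pr (Y i)" i0] by (simp add: add.commute)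
      then have "\<not> Bseq (\<lambda>m. \<Sum>j<m. pr (Y (i0 + j)))"
        using Bseq_mono_convergent[of "\<lambda>m. \<Sum>j<m. pr (Y (i0 + j))"] sum_mono2[of "{..<_}" "{..<_}" "\<lambda>j. pr (Y (i0 + j))"]
        by (auto simp: summable_iff_convergent)
      then have unb: "\<exists>m. c < (\<Sum>j<m. pr (Y (i0 + j)))" for c
      proof (rule contrapos_np)
        assume "\<nexists>m. c < (\<Sum>j<m. pr (Y (i0 + j)))"
        then have "norm (\<Sum>j<m. pr (Y (i0 + j))) \<le> c" for m by (auto simp: not_less sum_nonneg)
        then show "Bseq (\<lambda>m. \<Sum>j<m. pr (Y (i0 + j)))" by (rule BseqI')
      qed
      have "filterlim (\<lambda>m. \<Sum>j<m. pr (Y (i0 + j))) at_top sequentially"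
        unfolding filterlim_at_top eventually_sequentially
      proof
        fix c
        obtain m where m: "c < (\<Sum>j<m. pr (Y (i0 + j)))" using unb by blast
        have "c \<le> (\<Sum>j<n. pr (Y (i0 + j)))" if "m \<le> n" for n
          using m sum_mono2[of "{..<n}" "{..<m}" "\<lambda>j. pr (Y (i0 + j))"] that by auto
        then show "\<exists>N. \<forall>n\<ge>N. c \<le> (\<Sum>j<n. pr (Y (i0 + j)))" by blast
      qed
      then show ?thesis by (intro filterlim_compose[OF exp_at_bot] filterlim_uminus_at_bot_at_top[THEN filterlim_compose])
    qed
    have "(\<Inter>m. cyl (G m)) \<in> null_sets coin_tosses"
    proof -
      have meas: "(\<Inter>m. cyl (G m)) \<in> sets coin_tosses" by auto
      have "measure coin_tosses (\<Inter>m. cyl (G m)) \<le> exp (- (\<Sum>j<m. pr (Y (i0 + j))))" for m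
      proof -
        have "measure coin_tosses (\<Inter>m. cyl (G m)) \<le> measure coin_tosses (cyl (G m))"
          by (rule coin.finite_measure_mono) auto
        then show ?thesis using prG[of m] by (simp add: pr_def)
      qed
      then have "measure coin_tosses (\<Inter>m. cyl (G m)) \<le> 0" by (intro LIMSEQ_le_const[OF lim]) auto
      then have "measure coin_tosses (\<Inter>m. cyl (G m)) = 0" by (simp add: antisym)
      then show ?thesis using meas by (simp add: null_sets_def coin.emeasure_eq_measure)
    qed
    then show ?thesis
      by (rule AE_I') (use sub in auto)
  qed
  then have "AE s in coin_tosses. \<forall>i0. \<exists>i\<ge>i0. succ i s" by (simp add: AE_all_countable)
  then show ?thesis by (simp add: INFM_nat_le succ_def)
qed

section \<open>Local times of the walk\<close>

definition walk :: "bool stream \<Rightarrow> nat \<Rightarrow> int" where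
  "walk s n = disp (stake n s)"

lemma local_time_walk: "local_time (walk s) x n = visits x (stake (Suc n) s)"
proof (induction n)
  case 0
  have "{j. j \<le> 0 \<and> walk s j = x} = (if x = 0 then {0} else {})" by (auto simp: walk_def)
  then show ?case by (simp add: local_time_def)
next
  case (Suc n)
  have "{j. j \<le> Suc n \<and> walk s j = x} = {j. j \<le> n \<and> walk s j = x} \<union> (if walk s (Suc n) = x then {Suc n} else {})"
    by (auto simp: le_Suc_eq)
  then have "local_time (walk s) x (Suc n) = local_time (walk s) x n + (if walk s (Suc n) = x then 1 else 0)"
    by (simp add: local_time_def)
  also have "\<dots> = visits x (stake (Suc (Suc n)) s)"
    unfolding Suc.IH stake_Suc[of "Suc n"] visits_append walk_def by (auto simp del: stake.simps)
  finally show ?case .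
qed

lemma visited_sites_walk: "x \<in> visited_sites (walk s) n \<longleftrightarrow> 0 < visits x (stake (Suc n) s)"
proof -
  have "0 < local_time (walk s) x n \<longleftrightarrow> {j. j \<le> n \<and> walk s j = x} \<noteq> {}"
    by (simp add: local_time_def card_gt_0_iff)
  then show ?thesis by (auto simp: local_time_walk visited_sites_def)
qed

lemma finite_visited_sites: "finite (visited_sites f n)"
proof -
  have "visited_sites f n = f ` {..n}" by (auto simp: visited_sites_def)
  then show ?thesis by simp
qed

lemma min_local_time_ge_iff:
  "k \<le> min_local_time f n \<longleftrightarrow> (\<forall>x\<in>visited_sites f n. k \<le> local_time f x n)"
proof -
  have "{local_time f x n | x. x \<in> visited_sites f n} = (\<lambda>x. local_time f x n) ` visited_sites f n" by auto
  moreover have "f 0 \<in> visited_sites f n" by (auto simp: visited_sites_def)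
  ultimately show ?thesis using finite_visited_sites[of f n] unfolding min_local_time_def by (subst Min_ge_iff) auto
qed

text \<open>
  The sites visited before the piece \<open>p\<close> are within distance \<open>2 r\<close> of its starting point, hence within the
  thick range.
\<close>

lemma min_local_time_thick:
  assumes u: "confined (- r - 1) (r + 1) u" "\<bar>disp u\<bar> \<le> r" and p: "thick_range k (2 * r) p"
    and s: "stake (Suc n) s = u @ p"
  shows "k \<le> min_local_time (walk s) n"
  unfolding min_local_time_ge_iff
proof
  fix x assume "x \<in> visited_sites (walk s) n"
  then have x: "0 < visits x u + visits (x - disp u) p" by (simp add: visited_sites_walk s visits_append del: stake.simps)
  obtain a b where ab: "2 * r \<le> a" "2 * r < b" "confined (- a - 1) b p" "\<And>y. - a \<le> y \<Longrightarrow> y < b \<Longrightarrow> k \<le> visits y p"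
    using p by (auto simp: thick_range_def)
  have "k \<le> visits (x - disp u) p"
  proof (cases "0 < visits x u")
    case True
    then have "- r - 1 < x \<and> x < r + 1" using confined_visits[OF u(1)] by blast
    then have "- r \<le> x" "x \<le> r" by auto
    then show ?thesis using ab u(2) by (intro ab(4)) auto
  next
    case False
    then have "- a - 1 < x - disp u" "x - disp u < b" using confined_visits[OF ab(3), of "x - disp u"] x by auto
    then show ?thesis by (intro ab(4)) auto
  qed
  then show "k \<le> local_time (walk s) x n" by (simp add: local_time_walk s visits_append del: stake.simps)
qed

text \<open>
  After the first \<open>i\<close> stages the walk is confined to the sum of the radii.
\<close>

lemma blocks_capped_exit:
  fixes r :: "nat \<Rightarrow> int"
  assumes r: "\<And>i. 1 \<le> r i" and w: "w \<in> blocks (\<lambda>i. capped_exit (r i) (n i)) i"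
  shows "confined (- (\<Sum>j<i. r j) - 1) ((\<Sum>j<i. r j) + 1) w \<and> \<bar>disp w\<bar> \<le> (\<Sum>j<i. r j) \<and> length w \<le> (\<Sum>j<i. n j)"
  using w
proof (induction i arbitrary: w)
  case 0
  then show ?case by simp
next
  case (Suc i)
  then obtain u v where w: "w = u @ v" "u \<in> blocks (\<lambda>i. capped_exit (r i) (n i)) i" "v \<in> capped_exit (r i) (n i)"
    by (auto simp: conc_def)
  define h where "h = (\<Sum>j<i. r j)"
  have u: "confined (- h - 1) (h + 1) u" "\<bar>disp u\<bar> \<le> h" "length u \<le> (\<Sum>j<i. n j)" using Suc.IH[OF w(2)] by (simp_all add: h_def)
  have v: "confined (- r i) (r i) v" "length v \<le> n i" using w(3) by (auto simp: capped_exit_def)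
  have dv: "\<bar>disp v\<bar> \<le> r i"
  proof (cases v rule: rev_cases)
    case Nil
    then show ?thesis using r[of i] by simp
  next
    case (snoc y b)
    then have "- r i < disp y \<and> disp y < r i" using confined_prefix_strict[OF v(1), of y] by simp
    then show ?thesis using snoc by auto
  qed
  have c1: "confined (- (h + r i) - 1) (h + r i + 1) u" using confined_mono[OF u(1)] r[of i] by simp
  have c2: "confined (- (h + r i) - 1 - disp u) (h + r i + 1 - disp u) v" using confined_mono[OF v(1)] u(2) by simp
  have "(\<Sum>j<Suc i. r j) = h + r i" "(\<Sum>j<Suc i. n j) = (\<Sum>j<i. n j) + n i" by (simp_all add: h_def)
  then show ?case using c1 c2 u dv v w(1) by (simp add: confined_append)
qed

section \<open>The lower bound\<close>

lemma thick_range_mono: "thick_range k r p \<Longrightarrow> r' \<le> r \<Longrightarrow> thick_range k r' p"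
  unfolding thick_range_def by (meson order_trans le_less_trans)

text \<open>
  A success may be lost because its stage takes too long.  The exit time has expectation of the order
  of the square of the radius, so a cap at the fourth power makes this unlikely.
\<close>

lemma thick_range_capped:
  assumes W: "W \<subseteq> up (2 * A) (4 * A)" and A: "1 \<le> A" and n: "n = nat (4 * A) ^ 4"
  shows "{z \<in> W. length z \<le> n} \<subseteq> capped_exit (4 * A) n"
    and "pr W \<le> pr {z \<in> W. length z \<le> n} + 1 / (4 * real_of_int A)\<^sup>2"
proof -
  have Wc: "disp z = 4 * A" "confined (- (4 * A)) (4 * A) z" if "z \<in> W" for z
  proof -
    have z: "disp z = 4 * A" "confined (- (2 * A)) (4 * A) z" using that W by (auto simp: up_def)
    show "disp z = 4 * A" by (rule z)
    show "confined (- (4 * A)) (4 * A) z" using confined_mono[OF z(2), of "- (4 * A)" "4 * A"] A by simp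
  qed
  show "{z \<in> W. length z \<le> n} \<subseteq> capped_exit (4 * A) n"
  proof
    fix z assume "z \<in> {z \<in> W. length z \<le> n}"
    then have "z \<in> W" "length z \<le> n" by auto
    then show "z \<in> capped_exit (4 * A) n" unfolding capped_exit_def using Wc[of z] A by simp
  qed
  have n0: "0 < n" using A by (simp add: n)
  have "pr W \<le> pr ({z \<in> W. length z \<le> n} \<union> {z \<in> W. n < length z})" by (rule pr_mono) auto
  also have "\<dots> \<le> pr {z \<in> W. length z \<le> n} + pr {z \<in> W. n < length z}" by (rule pr_Un)
  also have "pr {z \<in> W. n < length z} \<le> pr (staying (- (4 * A)) (4 * A) n)"
  proof (rule pr_mono_prefix)
    fix z assume "z \<in> {z \<in> W. n < length z}"
    then have z: "z \<in> W" "n < length z" by auto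
    have u: "prefix (take n z) z" "take n z \<noteq> z" using z(2) by (auto simp: take_is_prefix)
    then have "- (4 * A) < disp (take n z) \<and> disp (take n z) < 4 * A"
      using confined_prefix_strict[OF Wc(2)[OF z(1)]] by blast
    moreover have "confined (- (4 * A)) (4 * A) (take n z)"
      using Wc(2)[OF z(1)] confined_append[of _ _ "take n z" "drop n z"] by simp
    ultimately have "take n z \<in> staying (- (4 * A)) (4 * A) n" using z(2) by (simp add: staying_def)
    then show "\<exists>u\<in>staying (- (4 * A)) (4 * A) n. prefix u z" using u by blast
  qed
  also have "\<dots> \<le> (real_of_int (4 * A))\<^sup>2 / n" using A n0 by (intro pr_staying_le) auto
  also have "\<dots> = 1 / (4 * real_of_int A)\<^sup>2"
  proof -
    define x where "x = 4 * real_of_int A"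
    have "real n = x ^ 4" using A by (simp add: n x_def)
    moreover have "0 < x" using A by (simp add: x_def)
    moreover have "real_of_int (4 * A) = x" by (simp add: x_def)
    ultimately show ?thesis by (simp add: x_def[symmetric] field_simps power2_eq_square power4_eq_xxxx)
  qed
  finally show "pr W \<le> pr {z \<in> W. length z \<le> n} + 1 / (4 * real_of_int A)\<^sup>2" by simp
qed

lemma sum_powers_9: "2 * (\<Sum>j<i. 4 * 9 ^ j) = (9 ^ i - 1 :: int)"
  by (induction i) auto

lemma sum_powers_6561: "(\<Sum>j\<le>i. 256 * 6561 ^ j) \<le> (512 * 6561 ^ i :: nat)"
  by (induction i) auto

lemma harmonic_vs_exponential: "1 \<le> i \<Longrightarrow> 72 * real i \<le> 81 ^ i"
proof (induction i rule: nat_induct_at_least)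
  case base then show ?case by simp
next
  case (Suc i)
  then show ?case by simp
qed

text \<open>
  Stage \<open>i\<close> uses the interval of radius \<open>4 * 9^i\<close>.  The logarithm of \<open>9^i\<close> is a multiple of \<open>i\<close> and
  \<open>2 powr ((1+\<delta>) k) \<le> i\<close>, so that \<open>thick_range_eventually\<close> applies and gives a success probability of at least a
  multiple of \<open>1/i\<close>.  The stage is over at time \<open>512 * 6561^i\<close>, whose iterated logarithm is \<open>ln i\<close> up to a constant.
\<close>

lemma min_local_time_infinitely_often:
  fixes \<delta> :: real
  assumes \<delta>: "0 < \<delta>" "\<delta> < 1"
  shows "AE s in coin_tosses. \<exists>\<^sub>\<infinity>i. \<exists>n. nat \<lfloor>(1 - \<delta>) * log 2 (real i)\<rfloor> \<le> min_local_time (walk s) n \<and> n \<le> 512 * 6561 ^ i"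
proof -
  define k where "k i = nat \<lfloor>(1 - \<delta>) * log 2 (real i)\<rfloor>" for i :: nat
  define A where "A i = (9::int) ^ i" for i :: nat
  define n where "n i = nat (4 * A i) ^ 4" for i
  have A1: "1 \<le> A i" for i by (simp add: A_def)
  define P where "P i \<longleftrightarrow> 1 \<le> i \<and> (\<forall>A. 2 powr ((1 + 2 * (\<delta>/2)) * real (k i)) \<le> ln (real_of_int A) \<and> 0 < A \<longrightarrow>
    (\<exists>W. W \<subseteq> up (2 * A) (4 * A) \<and> (\<forall>z\<in>W. \<exists>p. prefix p z \<and> thick_range (k i) A p) \<and>
      2 powr (- (1 + \<delta>/2) * real (k i)) / 576 \<le> pr W))" for i
  have k_top: "filterlim k at_top sequentially"
  proof -
    have "filterlim (\<lambda>i. (1 - \<delta>) * log 2 (real i)) at_top sequentially" using \<delta> by real_asymp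
    then show ?thesis unfolding k_def
      by (intro filterlim_compose[OF filterlim_nat_sequentially] filterlim_compose[OF filterlim_floor_sequentially])
  qed
  have P: "eventually P sequentially"
    unfolding P_def
    by (rule eventually_conj[OF eventually_ge_at_top])
      (rule eventually_compose_filterlim[OF thick_range_eventually k_top], use \<delta> in simp)
  have "\<exists>Y. Y \<subseteq> capped_exit (4 * A i) (n i) \<and> (\<forall>z\<in>Y. \<exists>p. prefix p z \<and> thick_range (k i) (A i) p) \<and>
      (P i \<longrightarrow> 1 / (1152 * real i) \<le> pr Y)" for i
  proof (cases "P i")
    case False
    then show ?thesis by (intro exI[of _ "{}"]) simp
  next
    case True
    then have i: "1 \<le> i" by (simp add: P_def)
    define l where "l = log 2 (real i)"
    have l0: "0 \<le> l" using i by (simp add: l_def)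
    have kl: "real (k i) \<le> (1 - \<delta>) * l"
    proof -
      have "0 \<le> (1 - \<delta>) * l" using \<delta> l0 by simp
      then show ?thesis unfolding k_def l_def[symmetric] by linarith
    qed
    have pl: "2 powr l = real i" using i by (simp add: l_def)
    have "(1 + \<delta>) * real (k i) \<le> (1 + \<delta>) * ((1 - \<delta>) * l)" using kl \<delta> by (intro mult_left_mono) auto
    also have "\<dots> = l - \<delta> * \<delta> * l" by (simp add: algebra_simps)
    also have "\<dots> \<le> l" using \<delta> l0 by simp
    finally have k1: "(1 + \<delta>) * real (k i) \<le> l" .
    moreover have "(1 + \<delta>/2) * real (k i) \<le> (1 + \<delta>) * real (k i)" using \<delta> by (intro mult_right_mono) auto
    ultimately have k2: "(1 + \<delta>/2) * real (k i) \<le> l" by linarith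
    have "2 powr ((1 + 2 * (\<delta>/2)) * real (k i)) \<le> 2 powr l" using k1 by (intro powr_mono) auto
    also have "\<dots> \<le> ln (real_of_int (A i))"
    proof -
      have "1 \<le> ln (9::real)"
      proof -
        have "exp 1 \<le> (9::real)" using exp_le by simp
        then show ?thesis by (subst ln_ge_iff) auto
      qed
      then have "real i * 1 \<le> real i * ln 9" by (intro mult_left_mono) auto
      then show ?thesis unfolding pl by (simp add: A_def ln_realpow)
    qed
    finally have "2 powr ((1 + 2 * (\<delta>/2)) * real (k i)) \<le> ln (real_of_int (A i)) \<and> 0 < A i" using A1[of i] by simp
    then obtain W where W: "W \<subseteq> up (2 * A i) (4 * A i)" "\<forall>z\<in>W. \<exists>p. prefix p z \<and> thick_range (k i) (A i) p"
      "2 powr (- (1 + \<delta>/2) * real (k i)) / 576 \<le> pr W" using True unfolding P_def by blast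
    note cap = thick_range_capped[OF W(1) A1[of i] n_def]
    have "1 / (1152 * real i) \<le> pr {z \<in> W. length z \<le> n i}"
    proof -
      have "1 / real i = 2 powr (- l)" by (simp add: powr_minus pl inverse_eq_divide)
      also have "\<dots> \<le> 2 powr (- (1 + \<delta>/2) * real (k i))" 
      proof (rule powr_mono)
        show "- l \<le> - (1 + \<delta>/2) * real (k i)" using k2 by (simp only: mult_minus_left neg_le_iff_le)
      qed simp
      finally have "1 / real i / 576 \<le> 2 powr (- (1 + \<delta>/2) * real (k i)) / 576" by (rule divide_right_mono) simp
      then have "1 / real i / 576 \<le> pr W" using W(3) by (rule order_trans)
      moreover have "1 / (4 * real_of_int (A i))\<^sup>2 \<le> 1 / (1152 * real i)"
      proof -
        have "(4 * real_of_int (A i))\<^sup>2 = 16 * 81 ^ i" by (simp add: A_def power_mult_distrib power2_eq_square flip: power_mult_distrib)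
        then show ?thesis using harmonic_vs_exponential[OF i] i by (simp add: field_simps)
      qed
      moreover define x where "x = 1 / (1152 * real i)"
      moreover have "1 / real i / 576 = 2 * x" by (simp add: x_def)
      ultimately have "2 * x \<le> pr W" "pr W \<le> pr {z \<in> W. length z \<le> n i} + x"
        using order_trans[OF cap(2) add_left_mono] by simp_all
      then have "x \<le> pr {z \<in> W. length z \<le> n i}" by linarith
      then show ?thesis by (simp only: x_def)
    qed
    then show ?thesis using cap(1) W(2) by (intro exI[of _ "{z \<in> W. length z \<le> n i}"]) auto
  qed
  then obtain Y where Y: "\<And>i. Y i \<subseteq> capped_exit (4 * A i) (n i)"
    "\<And>i z. z \<in> Y i \<Longrightarrow> \<exists>p. prefix p z \<and> thick_range (k i) (A i) p" "\<And>i. P i \<Longrightarrow> 1 / (1152 * real i) \<le> pr (Y i)"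
    by metis
  define X where "X i = capped_exit (4 * A i) (n i)" for i
  have div: "\<not> summable (\<lambda>i. pr (Y i))"
  proof
    assume "summable (\<lambda>i. pr (Y i))"
    moreover have "eventually (\<lambda>i. norm (1 / (1152 * real i)) \<le> pr (Y i)) sequentially"
      using P by eventually_elim (use Y(3) in auto)
    ultimately have "summable (\<lambda>i. 1 / (1152 * real i))" by (rule summable_comparison_test_ev[rotated])
    then have "summable (\<lambda>i. 1152 * (1 / (1152 * real i)))" by (rule summable_mult)
    then have "summable (\<lambda>i. inverse (real i))" by (simp add: inverse_eq_divide)
    then show False using not_summable_harmonic[where 'a=real] by blast
  qed
  have "AE s in coin_tosses. \<exists>\<^sub>\<infinity>i. \<exists>u v m. u \<in> blocks X i \<and> v \<in> Y i \<and> stake m s = u @ v"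
  proof (rule blocks_infinitely_often[OF _ _ _ div])
    show "prefix_free (X i)" for i unfolding X_def by (rule prefix_free_capped_exit)
    show "\<exists>n. stake n s \<in> X i" for i s unfolding X_def using A1[of i] by (intro capped_exit_complete) auto
    show "Y i \<subseteq> X i" for i unfolding X_def by (rule Y(1))
  qed
  then show ?thesis
  proof (rule AE_mp, intro AE_I2 impI)
    fix s assume inf: "\<exists>\<^sub>\<infinity>i. \<exists>u v m. u \<in> blocks X i \<and> v \<in> Y i \<and> stake m s = u @ v"
    have "\<exists>m. k i \<le> min_local_time (walk s) m \<and> m \<le> 512 * 6561 ^ i"
      if ex: "\<exists>u v m. u \<in> blocks X i \<and> v \<in> Y i \<and> stake m s = u @ v" for i
    proof -
      obtain u v m where uv: "u \<in> blocks X i" "v \<in> Y i" "stake m s = u @ v" using ex by blast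
      obtain p where p: "prefix p v" "thick_range (k i) (A i) p" using Y(2)[OF uv(2)] by blast
      define h where "h = (\<Sum>j<i. 4 * A j)"
      have u: "confined (- h - 1) (h + 1) u" "\<bar>disp u\<bar> \<le> h" "length u \<le> (\<Sum>j<i. n j)"
      proof -
        have "1 \<le> 4 * A j" for j using A1[of j] by simp
        from blocks_capped_exit[where r="\<lambda>i. 4 * A i", OF this, where w=u and i=i and n=n] uv(1)
        show "confined (- h - 1) (h + 1) u" "\<bar>disp u\<bar> \<le> h" "length u \<le> (\<Sum>j<i. n j)" by (simp_all add: X_def[abs_def] h_def)
      qed
      \<comment> \<open>The scales grow so fast that all earlier stages together have at most half the margin.\<close>
      have "2 * h \<le> A i" using sum_powers_9[of i] by (simp add: h_def A_def)
      then have th: "thick_range (k i) (2 * h) p" using thick_range_mono[OF p(2)] by blast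
      have "length v \<le> n i" using Y(1) uv(2) by (auto simp: capped_exit_def)
      then have "length p \<le> n i" using p(1) prefix_length_le order_trans by blast
      moreover have "n j = 256 * 6561 ^ j" for j
      proof -
        have "nat (4 * A j) = 4 * 9 ^ j" by (simp add: A_def nat_mult_distrib nat_power_eq)
        then have "n j = 4 ^ 4 * (9 ^ j) ^ 4" unfolding n_def by (simp only: power_mult_distrib)
        also have "(9 ^ j) ^ 4 = ((9 ^ 4) ^ j :: nat)" by (simp only: power_mult[symmetric] mult.commute)
        finally show ?thesis by simp
      qed
      ultimately have len: "length (u @ p) \<le> 512 * 6561 ^ i"
        using u(3) sum_powers_6561[of i] by (simp add: lessThan_Suc_atMost[symmetric])
      show ?thesis
      proof (cases "u @ p = []")
        case True
        obtain a b where "A i \<le> a" "A i < b" "\<And>y. - a \<le> y \<Longrightarrow> y < b \<Longrightarrow> k i \<le> visits y p"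
          using p(2) unfolding thick_range_def by blast
        from this(3)[of 0] have "k i = 0" using True \<open>A i \<le> a\<close> \<open>A i < b\<close> A1[of i] by simp
        then show ?thesis by (intro exI[of _ 0]) simp
      next
        case False
        then obtain t where t: "length (u @ p) = Suc t" by (cases "length (u @ p)") auto
        have "prefix (u @ p) (stake m s)" using uv(3) p(1) by simp
        then have "stake (Suc t) s = u @ p" using prefix_stakeD[of "u @ p" m s] t by simp
        then have "k i \<le> min_local_time (walk s) t" by (rule min_local_time_thick[OF u(1,2) th])
        then show ?thesis using len t by (intro exI[of _ t]) simp
      qed
    qed
    then show "\<exists>\<^sub>\<infinity>i. \<exists>n. nat \<lfloor>(1 - \<delta>) * log 2 (real i)\<rfloor> \<le> min_local_time (walk s) n \<and> n \<le> 512 * 6561 ^ i"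
      unfolding k_def[symmetric] by (rule INFM_mono[OF inf])
  qed
qed

section \<open>The upper bound\<close>

text \<open>
  The walk makes \<open>k\<close> visits to its starting point without stepping below it; in \<open>crossing_returns\<close> it also crosses the
  whole range up to its far end.
\<close>

definition returns :: "nat \<Rightarrow> bool list set" where
  "returns k = {z. (\<exists>b. confined (- 1) b z) \<and> k \<le> visits 0 z}"

definition crossing_returns :: "int \<Rightarrow> nat \<Rightarrow> bool list set" where
  "crossing_returns w k = {z \<in> returns k. 0 < visits w z}"

definition pos_loops :: "bool list set" where
  "pos_loops = {c \<in> loops. \<exists>b. confined (- 1) b c}"

lemma prefix_free_pos_loops: "prefix_free pos_loops"
  by (rule prefix_free_subset[OF prefix_free_loops]) (auto simp: pos_loops_def)

lemma pos_loops_Cons: "c \<in> pos_loops \<Longrightarrow> \<exists>x. c = True # x \<and> disp x = - 1 \<and> visits (- 1) x = 0 \<and> (\<exists>b. confined (- 2) b x)"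
proof -
  assume "c \<in> pos_loops"
  then obtain b where c: "disp c = 0" "visits 0 c = 1" "confined (- 1) b c" by (auto simp: pos_loops_def loops_def)
  then obtain t x where x: "c = t # x" by (cases c) auto
  have t
  proof (rule ccontr)
    assume "\<not> t"
    then have "confined 0 (b + 1) x" "disp x = 1" using c x by auto
    then show False by (cases x) auto
  qed
  then show ?thesis using c x by auto
qed

lemma pr_pos_loops: "pr pos_loops \<le> 1/2"
proof -
  have "pr pos_loops \<le> pr ((#) True ` UNIV)" using pos_loops_Cons by (intro pr_mono) blast
  also have "\<dots> \<le> 1/2" by (simp add: pr_Cons)
  finally show ?thesis .
qed

lemma returns_Suc_Suc: "z \<in> returns (Suc (Suc k)) \<Longrightarrow> \<exists>c x. z = c @ x \<and> c \<in> pos_loops \<and> x \<in> returns (Suc k)"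
proof -
  assume "z \<in> returns (Suc (Suc k))"
  then obtain b where z: "confined (- 1) b z" "Suc (Suc k) \<le> visits 0 z" by (auto simp: returns_def)
  then obtain c x where c: "z = c @ x" "c \<in> loops" "visits 0 z = Suc (visits 0 x)" using split_loop[of z] by auto
  then have "confined (- 1) b c" "confined (- 1) b x" using z(1) by (auto simp: confined_append loops_def)
  then show ?thesis using c z(2) by (intro exI[of _ c] exI[of _ x]) (auto simp: pos_loops_def returns_def)
qed

lemma pr_returns: "pr (returns (Suc k)) \<le> (1/2) ^ k"
proof (induction k)
  case (Suc k)
  have "pr (returns (Suc (Suc k))) \<le> pr pos_loops * pr (returns (Suc k))"
    using returns_Suc_Suc by (intro pr_conc_le[OF _ prefix_free_pos_loops]) (auto simp: conc_def)
  also have "\<dots> \<le> 1/2 * (1/2) ^ k" using pr_pos_loops Suc by (intro mult_mono) auto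
  finally show ?case by simp
qed simp

lemma pos_loops_crossing:
  assumes c: "c \<in> pos_loops" "0 < visits w c" and w: "1 \<le> w"
  shows "\<exists>u\<in>(#) True ` up 1 (w - 1). prefix u c"
proof -
  obtain x b where x: "c = True # x" "visits (- 1) x = 0" "confined (- 2) b x" using pos_loops_Cons[OF c(1)] by blast
  then have "0 < visits (w - 1) x" using c(2) w by simp
  then obtain u v where u: "x = u @ v" "disp u = w - 1" "visits (w - 1) u = 0" using split_first_visit by blast
  have "confined (- 2) b u" "visits (- 1) u = 0" using x u(1) by (auto simp: confined_append visits_append)
  then have "confined (- 1) b u" using confined_unbounded_below[of "- 2" b u "- 1"] by simp
  then have "confined (- 1) (w - 1) u"
  proof (cases "w = 1")
    case True
    then have "u = []" using u(3) visits_start[of u] by auto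
    then show ?thesis by simp
  next
    case False
    then show ?thesis using confined_unvisited_above[OF \<open>confined (- 1) b u\<close>] u w by simp
  qed
  then have "u \<in> up 1 (w - 1)" using u by (simp add: up_def)
  then show ?thesis using x(1) u(1) by (intro bexI[of _ "True # u"]) auto
qed

text \<open>
  Each of the \<open>k\<close> excursions between successive visits costs a factor 1/2.  The crossing takes place in one
  of them, which then costs \<open>1/(2 w)\<close> instead, or after the last visit, which costs \<open>1/(w+1)\<close>.
\<close>

lemma pr_crossing_returns:
  assumes w: "1 \<le> w"
  shows "pr (crossing_returns w (Suc k)) \<le> real (Suc k) * (1/2) ^ k / w"
proof (induction k)
  case 0
  have "pr (crossing_returns w (Suc 0)) \<le> pr (up 1 w)"
  proof (rule pr_mono_prefix)
    fix z assume "z \<in> crossing_returns w (Suc 0)"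
    then obtain b where z: "confined (- 1) b z" "0 < visits w z" by (auto simp: crossing_returns_def returns_def)
    then obtain u v where u: "z = u @ v" "disp u = w" "visits w u = 0" using split_first_visit by blast
    then have "confined (- 1) b u" using z(1) by (simp add: confined_append)
    then have "confined (- 1) w u" using confined_unvisited_above[of "- 1" b u w] u w by simp
    then show "\<exists>u\<in>up 1 w. prefix u z" using u by (intro bexI[of _ u]) (auto simp: up_def)
  qed
  also have "\<dots> = 1 / (1 + w)" using w by (simp add: pr_up)
  also have "\<dots> \<le> 1 / w" using w by (simp add: field_simps)
  finally show ?case by simp
next
  case (Suc k)
  define B where "B = {c \<in> pos_loops. 0 < visits w c}"
  have pfB: "prefix_free B" by (rule prefix_free_subset[OF prefix_free_pos_loops]) (auto simp: B_def)
  have "crossing_returns w (Suc (Suc k)) \<subseteq> B \<odot> returns (Suc k) \<union> pos_loops \<odot> crossing_returns w (Suc k)"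
  proof
    fix z assume "z \<in> crossing_returns w (Suc (Suc k))"
    then have z: "z \<in> returns (Suc (Suc k))" "0 < visits w z" by (auto simp: crossing_returns_def)
    then obtain c x where c: "z = c @ x" "c \<in> pos_loops" "x \<in> returns (Suc k)" using returns_Suc_Suc by blast
    have "disp c = 0" using c(2) by (auto simp: pos_loops_def loops_def)
    show "z \<in> B \<odot> returns (Suc k) \<union> pos_loops \<odot> crossing_returns w (Suc k)"
    proof (cases "0 < visits w c")
      case True
      then have "c \<in> B" using c(2) by (simp add: B_def)
      then show ?thesis unfolding c(1) using c(3) by (intro UnI1 concI)
    next
      case False
      then have "x \<in> crossing_returns w (Suc k)" using z(2) c \<open>disp c = 0\<close> by (simp add: crossing_returns_def visits_append)
      then show ?thesis unfolding c(1) using c(2) by (intro UnI2 concI)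
    qed
  qed
  then have "pr (crossing_returns w (Suc (Suc k))) \<le> pr (B \<odot> returns (Suc k)) + pr (pos_loops \<odot> crossing_returns w (Suc k))"
    using pr_mono pr_Un order_trans by meson
  also have "pr (B \<odot> returns (Suc k)) = pr B * pr (returns (Suc k))" by (rule pr_conc[OF pfB])
  also have "\<dots> \<le> 1 / (2 * w) * (1/2) ^ k"
  proof (intro mult_mono pr_returns)
    have "pr B \<le> pr ((#) True ` up 1 (w - 1))" using pos_loops_crossing[OF _ _ w] by (intro pr_mono_prefix) (auto simp: B_def)
    also have "\<dots> = 1 / (2 * w)" using w by (simp add: pr_Cons pr_up)
    finally show "pr B \<le> 1 / (2 * w)" .
  qed (use w in auto)
  also have "pr (pos_loops \<odot> crossing_returns w (Suc k)) = pr pos_loops * pr (crossing_returns w (Suc k))"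
    by (rule pr_conc[OF prefix_free_pos_loops])
  also have "\<dots> \<le> 1/2 * (real (Suc k) * (1/2) ^ k / w)" using pr_pos_loops Suc by (intro mult_mono) auto
  also have "1 / (2 * w) * (1/2) ^ k + 1/2 * (real (Suc k) * (1/2) ^ k / w) = real (Suc (Suc k)) * (1/2) ^ Suc k / w"
    using w by (simp add: field_simps)
  finally show ?case by simp
qed

text \<open>
  The words that end at a new minimum at the moment at which the range gets its \<open>w\<close>-th site.
\<close>

definition record_low :: "int \<Rightarrow> bool list set" where
  "record_low w = {u. confined (disp u) (disp u + w) u \<and> (u = [] \<and> w = 1 \<or> 0 < visits (disp u + w - 1) u)}"

lemma prefix_free_record_low: "prefix_free (record_low w)"
  unfolding prefix_free_def
proof (intro ballI impI, rule ccontr)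
  fix u v assume uv: "u \<in> record_low w" "v \<in> record_low w" "prefix u v" "u \<noteq> v"
  have v: "confined (disp v) (disp v + w) v" using uv(2) by (simp add: record_low_def)
  then have d: "disp v < disp u" "disp u < disp v + w" using confined_prefix_strict uv(3,4) by blast+
  from uv(1) consider "u = []" "w = 1" | "0 < visits (disp u + w - 1) u" by (auto simp: record_low_def)
  then show False
  proof cases
    case 1 then show False using d by simp
  next
    case 2
    then have "0 < visits (disp u + w - 1) v" using uv(3) by (auto simp: prefix_def visits_append)
    then have "disp u + w - 1 < disp v + w" using confined_visits[OF v] by blast
    then show False using d by simp
  qed
qed

definition old_end_heavy :: "int \<Rightarrow> nat \<Rightarrow> bool list set" where
  "old_end_heavy w k = record_low w \<odot> crossing_returns w k"

lemma pr_old_end_heavy: "1 \<le> w \<Longrightarrow> pr (old_end_heavy w (Suc k)) \<le> real (Suc k) * (1/2) ^ k / w"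
proof -
  assume w: "1 \<le> w"
  have "pr (old_end_heavy w (Suc k)) \<le> 1 * pr (crossing_returns w (Suc k))"
    unfolding old_end_heavy_def pr_conc[OF prefix_free_record_low] by (intro mult_right_mono) auto
  then show ?thesis using pr_crossing_returns[OF w, of k] by simp
qed

lemma old_end_heavy_antimono: "k \<le> k' \<Longrightarrow> old_end_heavy w k' \<subseteq> old_end_heavy w k"
  unfolding old_end_heavy_def by (intro conc_mono) (auto simp: crossing_returns_def returns_def)

definition visited :: "bool list \<Rightarrow> int set" where
  "visited w = {y. 0 < visits y w}"

lemma finite_visited: "finite (visited w)"
proof -
  have "\<exists>a b. confined a b w"
  proof (induction w)
    case (Cons c w)
    then obtain a b where ab: "confined a b w" by blast
    define a' b' where "a' = min (a + step_of c) (- 1)" and "b' = max (b + step_of c) 1"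
    have "confined (a' - step_of c) (b' - step_of c) w" by (rule confined_mono[OF ab]) (auto simp: a'_def b'_def)
    moreover have "a' < 0" "0 < b'" by (simp_all add: a'_def b'_def)
    ultimately have "confined a' b' (c # w)" by simp
    then show ?case by blast
  qed simp
  then obtain a b where ab: "confined a b w" by blast
  have "visited w \<subseteq> {a..b}"
  proof
    fix y assume "y \<in> visited w"
    then have "a < y \<and> y < b" unfolding visited_def by (intro confined_visits[OF ab]) simp
    then show "y \<in> {a..b}" by simp
  qed
  then show ?thesis by (rule finite_subset) simp
qed

text \<open>
  The converse of \<open>confined_visits\<close>.
\<close>

lemma confined_visited:
  assumes "\<And>y. 0 < visits y w \<Longrightarrow> a < y \<and> y < b" shows "confined a b w"
  using assms
proof (induction w arbitrary: a b)
  case (Cons c w)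
  have "confined (a - step_of c) (b - step_of c) w"
  proof (rule Cons.IH)
    fix y assume "0 < visits y w"
    then have "0 < visits (y + step_of c) (c # w)" by simp
    from Cons.prems[OF this] show "a - step_of c < y \<and> y < b - step_of c" by auto
  qed
  moreover have "a < 0 \<and> 0 < b" using Cons.prems[of 0] by simp
  ultimately show ?case by simp
qed simp

lemma visits_intermediate:
  assumes "0 < visits y z" "0 \<le> w" "w \<le> y" shows "0 < visits w z"
proof -
  obtain z1 z2 where z: "z = z1 @ z2" "disp z1 = y" "z2 \<noteq> []" using split_first_visit[OF assms(1)] by blast
  show ?thesis
  proof (cases "w = y")
    case False
    then have "0 < visits w z1" using visits_pos_if_crossed[of w z1] assms z by simp
    then show ?thesis by (simp add: z visits_append)
  qed (use assms in simp)
qed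

lemma abs_visited_less: "0 < visits y w \<Longrightarrow> \<bar>y\<bar> < int (length w)"
proof (induction w arbitrary: y)
  case (Cons c w)
  show ?case
  proof (cases "y = 0")
    case False
    then have "0 < visits (y - step_of c) w" using Cons.prems by (simp split: if_splits)
    then have "\<bar>y - step_of c\<bar> < int (length w)" by (rule Cons.IH)
    then show ?thesis by (auto split: if_splits)
  qed simp
qed simp

text \<open>
  If the minimum is visited before the maximum, then it has been an end of the range since its
  first visit, and the range has been crossed since then.
\<close>

lemma old_low_end:
  assumes z: "z = u @ x" "disp u = Min (visited z)" "visits (disp u) u = 0"
    and b: "0 < visits b z" "visits b u = 0" "\<And>y. 0 < visits y z \<Longrightarrow> y \<le> b" "disp u < b"
    and k: "k \<le> visits (disp u) z"
  shows "\<exists>w. 1 \<le> w \<and> w \<le> 2 * int (length z) \<and> z \<in> old_end_heavy w k"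
proof -
  have low: "disp u \<le> y" if "0 < visits y z" for y
    using that finite_visited[of z] unfolding z(2) by (intro Min_le) (auto simp: visited_def)
  have u_vis: "disp u < y \<and> y < b" if "0 < visits y u" for y
  proof -
    have "0 < visits y z" using that z(1) by (simp add: visits_append)
    moreover have "y \<noteq> disp u" "y \<noteq> b" using that z(3) b(2) by auto
    ultimately show ?thesis using low[of y] b(3)[of y] by simp
  qed
  \<comment> \<open>the maximum before the first visit to the minimum; if \<open>u\<close> is empty, it is the starting point\<close>
  define c where "c = Max (insert (disp u) (visited u))"
  have c: "c \<in> insert (disp u) (visited u)" "\<And>y. y \<in> visited u \<Longrightarrow> y \<le> c" "disp u \<le> c"
    using finite_visited[of u] Max_in[of "insert (disp u) (visited u)"] unfolding c_def by (auto intro: Max_ge)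
  define w where "w = c - disp u + 1"
  have cb: "c < b" using c(1) u_vis b(4) by (auto simp: visited_def)
  have rec: "u \<in> record_low w"
  proof -
    have "confined (disp u) (disp u + w) u"
      by (rule confined_visited) (use u_vis c(2) in \<open>auto simp: w_def visited_def\<close>)
    moreover have "u = [] \<and> w = 1 \<or> 0 < visits (disp u + w - 1) u"
    proof (cases "c \<in> visited u")
      case True then show ?thesis by (simp add: w_def visited_def)
    next
      case False
      then have "c = disp u" using c(1) by simp
      have "u = []"
      proof (rule ccontr)
        assume "u \<noteq> []"
        then have v0: "0 \<in> visited u" using visits_start by (simp add: visited_def)
        then have "disp u < 0" "0 \<le> c" using u_vis[of 0] c(2)[of 0] by (auto simp: visited_def)
        then show False using \<open>c = disp u\<close> by simp
      qed
      then show ?thesis using \<open>c = disp u\<close> by (simp add: w_def)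
    qed
    ultimately show ?thesis by (simp add: record_low_def)
  qed
  have x_vis: "visits y x = visits (y + disp u) z" if "visits (y + disp u) u = 0" for y
    using that z(1) by (simp add: visits_append)
  have x: "x \<in> crossing_returns w k"
  proof -
    have "confined (- 1) (b - disp u + 1) x"
    proof (rule confined_visited)
      fix y assume "0 < visits y x"
      then have "0 < visits (y + disp u) z" by (simp add: z(1) visits_append)
      from low[OF this] b(3)[OF this] show "- 1 < y \<and> y < b - disp u + 1" by simp
    qed
    moreover have "k \<le> visits 0 x" using x_vis[of 0] z(3) k by simp
    moreover have "0 < visits w x"
    proof (rule visits_intermediate)
      show "0 < visits (b - disp u) x" using x_vis[of "b - disp u"] b by simp
      show "0 \<le> w" "w \<le> b - disp u" using cb c(3) by (simp_all add: w_def)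
    qed
    ultimately show ?thesis by (auto simp: crossing_returns_def returns_def)
  qed
  have "w \<le> 2 * int (length z)"
  proof -
    have "0 < visits (disp u) z"
      using Min_in[OF finite_visited[of z]] b(1) unfolding z(2) by (auto simp: visited_def)
    then have "\<bar>disp u\<bar> < int (length z)" by (rule abs_visited_less)
    moreover have "\<bar>b\<bar> < int (length z)" using b(1) by (rule abs_visited_less)
    ultimately show ?thesis using cb by (simp add: w_def)
  qed
  moreover have "1 \<le> w" using c(3) by (simp add: w_def)
  moreover have "z \<in> old_end_heavy w k" unfolding old_end_heavy_def z(1) using rec x by (intro concI)
  ultimately show ?thesis by blast
qed

text \<open>
  One of the two ends of the range is older; if it is the upper one, the path is reflected.
\<close>

lemma old_end:
  assumes k: "\<And>y. 0 < visits y z \<Longrightarrow> k \<le> visits y z" and len: "2 \<le> length z"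
  shows "\<exists>w. 1 \<le> w \<and> w \<le> 2 * int (length z) \<and> (z \<in> old_end_heavy w k \<or> map Not z \<in> old_end_heavy w k)"
proof -
  define a b where "a = Min (visited z)" and "b = Max (visited z)"
  have z0: "z \<noteq> []" using len by auto
  have "visited z \<noteq> {}" using visits_start[OF z0] by (auto simp: visited_def)
  then have ab: "0 < visits a z" "0 < visits b z"
    using Min_in[OF finite_visited] Max_in[OF finite_visited] unfolding a_def b_def visited_def by auto
  have bounds: "a \<le> y" "y \<le> b" if "0 < visits y z" for y
    using that finite_visited[of z] unfolding a_def b_def by (auto simp: visited_def)
  have "a < b"
  proof -
    obtain c d t where z: "z = c # d # t" using len by (cases z; cases "tl z") auto
    have "0 < visits 0 z" "0 < visits (step_of c) z" by (auto simp: z)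
    from bounds[OF this(1)] bounds[OF this(2)] show ?thesis by (cases c) auto
  qed
  obtain u x where u: "z = u @ x" "disp u = a" "visits a u = 0" using split_first_visit[OF ab(1)] by blast
  obtain v y where v: "z = v @ y" "disp v = b" "visits b v = 0" using split_first_visit[OF ab(2)] by blast
  show ?thesis
  proof (cases "visits b u = 0")
    case True
    have "\<exists>w. 1 \<le> w \<and> w \<le> 2 * int (length z) \<and> z \<in> old_end_heavy w k"
    proof (rule old_low_end[where u=u and x=x and b=b])
      show "disp u = Min (visited z)" using u(2) by (simp add: a_def)
      show "k \<le> visits (disp u) z" using k[OF ab(1)] u(2) by simp
    qed (use u True ab bounds \<open>a < b\<close> in auto)
    then show ?thesis by blast
  next
    case False
    have "visits a v = 0"
    proof (rule ccontr)
      assume av: "visits a v \<noteq> 0"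
      have "prefix u z" by (simp add: u(1))
      moreover have "prefix v z" by (simp add: v(1))
      ultimately have "prefix u v \<or> prefix v u" by (rule prefix_same_cases)
      then show False
      proof
        assume "prefix u v"
        then have "visits b v \<noteq> 0" using False by (auto simp: prefix_def visits_append)
        then show False using v(3) by simp
      next
        assume "prefix v u"
        then have "visits a u \<noteq> 0" using av by (auto simp: prefix_def visits_append)
        then show False using u(3) by simp
      qed
    qed
    let ?z = "map Not z"
    have vis: "visited ?z = uminus ` visited z" by (auto simp: visited_def image_iff) (metis minus_minus)
    have "\<exists>w. 1 \<le> w \<and> w \<le> 2 * int (length ?z) \<and> ?z \<in> old_end_heavy w k"
    proof (rule old_low_end[where u="map Not v" and x="map Not y" and b="- a"])
      show "?z = map Not v @ map Not y" using v(1) by simp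
      have "Min (uminus ` visited z) = - b"
        using \<open>visited z \<noteq> {}\<close> finite_visited[of z] unfolding b_def by (simp add: minus_Max_eq_Min)
      then show "disp (map Not v) = Min (visited ?z)" using v(2) by (simp add: vis)
      show "k \<le> visits (disp (map Not v)) ?z" using k[OF ab(2)] v(2) by simp
      show "y \<le> - a" if "0 < visits y ?z" for y using bounds(1)[of "- y"] that by simp
      show "0 < visits (- a) ?z" using ab(1) by simp
      show "visits (disp (map Not v)) (map Not v) = 0" using v by simp
      show "visits (- a) (map Not v) = 0" using \<open>visits a v = 0\<close> by simp
      show "disp (map Not v) < - a" using v(2) \<open>a < b\<close> by simp
    qed
    then show ?thesis by auto
  qed
qed

definition heavy_event :: "int \<Rightarrow> nat \<Rightarrow> bool list set" where
  "heavy_event w k = old_end_heavy w k \<union> map Not ` old_end_heavy w k"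

lemma pr_heavy_event: "1 \<le> w \<Longrightarrow> pr (heavy_event w (Suc k)) \<le> 2 * (real (Suc k) * (1/2) ^ k) / w"
  using pr_Un[of "old_end_heavy w (Suc k)" "map Not ` old_end_heavy w (Suc k)"] pr_old_end_heavy[of w k]
  by (simp add: heavy_event_def pr_flip)

lemma heavy_event_antimono: "k \<le> k' \<Longrightarrow> cyl (heavy_event w k') \<subseteq> cyl (heavy_event w k)"
  using old_end_heavy_antimono[of k k' w] by (auto simp: heavy_event_def cyl_def)

lemma min_local_time_heavy:
  assumes "1 \<le> n" "k \<le> min_local_time (walk s) n"
  shows "\<exists>w. 1 \<le> w \<and> w \<le> 2 * (int n + 1) \<and> s \<in> cyl (heavy_event w k)"
proof -
  let ?z = "stake (Suc n) s"
  have "k \<le> visits y ?z" if "0 < visits y ?z" for y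
    using assms(2) that visited_sites_walk[of y s n] local_time_walk[of s y n] unfolding min_local_time_ge_iff by auto
  then obtain w where w: "1 \<le> w" "w \<le> 2 * int (length ?z)" "?z \<in> old_end_heavy w k \<or> map Not ?z \<in> old_end_heavy w k"
    using old_end[of ?z k] assms(1) by auto
  have "?z \<in> heavy_event w k"
    using w(3)
  proof
    assume "map Not ?z \<in> old_end_heavy w k"
    then have "map Not (map Not ?z) \<in> map Not ` old_end_heavy w k" by (rule imageI)
    then show ?thesis by (simp add: heavy_event_def del: stake.simps)
  qed (simp add: heavy_event_def del: stake.simps)
  then have "s \<in> cyl (heavy_event w k)" unfolding cyl_def by blast
  then show ?thesis using w(1,2) by (intro exI[of _ w]) simp
qed

text \<open>
  This takes care of the finitely many \<open>w\<close> to which the Borel-Cantelli lemma gives no information.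
\<close>

lemma AE_escapes_heavy:
  assumes w: "1 \<le> w"
  shows "AE s in coin_tosses. \<exists>k. s \<notin> cyl (heavy_event w k)"
proof -
  let ?N = "\<Inter>k. cyl (heavy_event w k)"
  have "measure coin_tosses ?N \<le> 2 * (real (Suc k) * (1/2) ^ k) / w" for k
  proof -
    have "measure coin_tosses ?N \<le> pr (heavy_event w (Suc k))" unfolding pr_def by (rule coin.finite_measure_mono) auto
    then show ?thesis using pr_heavy_event[OF w, of k] by linarith
  qed
  moreover have "(\<lambda>k. 2 * (real (Suc k) * (1/2) ^ k) / w) \<longlonglongrightarrow> 0" using w by real_asymp
  ultimately have "measure coin_tosses ?N \<le> 0" by (intro LIMSEQ_le_const[where X="\<lambda>k. 2 * (real (Suc k) * (1/2) ^ k) / w"]) auto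
  then have "measure coin_tosses ?N = 0" by (simp add: antisym)
  then have "?N \<in> null_sets coin_tosses" by (simp add: null_sets_def coin.emeasure_eq_measure)
  then show ?thesis by (rule AE_I') auto
qed

text \<open>
  For \<open>w\<close> between \<open>2^j\<close> and \<open>2^(j+1)\<close> the threshold \<open>(1+\<epsilon>) log 2 j\<close> is used.  The sum of \<open>1/w\<close> over this range is at
  most 1, so that the probability for the scale \<open>j\<close> is essentially \<open>2\<close> to the power of minus the threshold, that is
  \<open>j powr -(1+\<epsilon>)\<close> up to logarithms.
\<close>

lemma min_local_time_upper:
  assumes \<epsilon>: "0 < \<epsilon>"
  shows "AE s in coin_tosses. \<exists>K. \<forall>n\<ge>1. real (min_local_time (walk s) n) \<le> real K + 1 + (1 + \<epsilon>) * log 2 (log 2 (2 * real n + 2))"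
proof -
  define c where "c j = nat \<lceil>(1 + \<epsilon>) * log 2 (real j)\<rceil>" for j :: nat
  define C where "C j = cyl (\<Union>w\<in>{2 ^ j..<2 ^ Suc j}. heavy_event w (Suc (c j)))" for j :: nat
  have c: "(1 + \<epsilon>) * log 2 (real j) \<le> c j" "c j \<le> (1 + \<epsilon>) * log 2 (real j) + 1" if "1 \<le> j" for j
  proof -
    have "0 \<le> (1 + \<epsilon>) * log 2 (real j)" using that \<epsilon> by simp
    then show "(1 + \<epsilon>) * log 2 (real j) \<le> c j" "c j \<le> (1 + \<epsilon>) * log 2 (real j) + 1" unfolding c_def by linarith+
  qed
  have mC: "measure coin_tosses (C j) \<le> 2 * ((1 + \<epsilon>) * log 2 (real j) + 2) * real j powr (- (1 + \<epsilon>))" if j: "1 \<le> j" for j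
  proof -
    have half: "(1/2) ^ c j \<le> real j powr (- (1 + \<epsilon>))"
    proof -
      have "(1/2::real) ^ c j = 2 powr (- real (c j))" by (simp add: powr_minus powr_realpow power_one_over inverse_eq_divide)
      also have "\<dots> \<le> 2 powr (- (1 + \<epsilon>) * log 2 (real j))" using c(1)[OF j]
      proof (intro powr_mono)
        show "- real (c j) \<le> - (1 + \<epsilon>) * log 2 (real j)" using c(1)[OF j] by (simp only: mult_minus_left neg_le_iff_le)
      qed simp
      also have "\<dots> = (2 powr (log 2 (real j))) powr (- (1 + \<epsilon>))" by (simp only: powr_powr mult.commute)
      also have "2 powr (log 2 (real j)) = real j" using j by simp
      finally show ?thesis .
    qed
    define q where "q = 2 * ((1 + \<epsilon>) * log 2 (real j) + 2) * real j powr (- (1 + \<epsilon>))"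
    have l0: "0 \<le> (1 + \<epsilon>) * log 2 (real j)" using j \<epsilon> by simp
    have q0: "0 \<le> q" using l0 by (simp add: q_def)
    have "pr (heavy_event w (Suc (c j))) \<le> q / 2 ^ j" if w: "w \<in> {2 ^ j..<2 ^ Suc j}" for w :: int
    proof -
      have "1 \<le> (2::int) ^ j" by simp
      then have w1: "1 \<le> w" using w by auto
      have "real_of_int (2 ^ j) \<le> real_of_int w" using w by (subst of_int_le_iff) simp
      then have w2: "2 ^ j \<le> real_of_int w" by simp
      have "pr (heavy_event w (Suc (c j))) \<le> 2 * (real (Suc (c j)) * (1/2) ^ c j) / w" by (rule pr_heavy_event[OF w1])
      also have "\<dots> \<le> q / w"
      proof (rule divide_right_mono)
        have "real (Suc (c j)) * (1/2) ^ c j \<le> ((1 + \<epsilon>) * log 2 (real j) + 2) * real j powr (- (1 + \<epsilon>))"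
          using c(2)[OF j] half l0 by (intro mult_mono) auto
        then show "2 * (real (Suc (c j)) * (1/2) ^ c j) \<le> q" unfolding q_def by linarith
      qed (use w1 in simp)
      also have "\<dots> \<le> q / 2 ^ j" using q0 w2 w1 by (intro divide_left_mono) auto
      finally show ?thesis .
    qed
    then have "(\<Sum>w\<in>{2 ^ j..<2 ^ Suc j}. pr (heavy_event w (Suc (c j)))) \<le> (\<Sum>w\<in>{2 ^ j..<2 ^ Suc j::int}. q / 2 ^ j)" by (rule sum_mono)
    also have "\<dots> = q"
    proof -
      have "card {2 ^ j..<2 ^ Suc j::int} = 2 ^ j" by (simp add: nat_power_eq)
      then show ?thesis by simp
    qed
    finally have "(\<Sum>w\<in>{2 ^ j..<2 ^ Suc j}. pr (heavy_event w (Suc (c j)))) \<le> q" .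
    moreover have "measure coin_tosses (C j) \<le> (\<Sum>w\<in>{2 ^ j..<2 ^ Suc j}. pr (heavy_event w (Suc (c j))))"
      unfolding C_def pr_def[symmetric] by (rule pr_UN) simp
    ultimately show ?thesis unfolding q_def by linarith
  qed
  have "AE s in coin_tosses. eventually (\<lambda>j. s \<in> space coin_tosses - C j) sequentially"
  proof (rule borel_cantelli_AE1)
    show "C j \<in> sets coin_tosses" for j by (simp add: C_def)
    show "emeasure coin_tosses (C j) < \<infinity>" for j by (simp add: coin.emeasure_eq_measure)
    have "eventually (\<lambda>j::nat. 2 * ((1 + \<epsilon>) * log 2 (real j) + 2) * real j powr (- (1 + \<epsilon>)) \<le> real j powr (- (1 + \<epsilon>/2))) sequentially"
      using \<epsilon> by real_asymp
    then have "eventually (\<lambda>j. norm (measure coin_tosses (C j)) \<le> real j powr (- (1 + \<epsilon>/2))) sequentially"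
      using eventually_ge_at_top[of 1] by eventually_elim (use mC in force)
    moreover have "summable (\<lambda>j. real j powr (- (1 + \<epsilon>/2)))" using \<epsilon> by (subst summable_real_powr_iff) auto
    ultimately show "summable (\<lambda>j. measure coin_tosses (C j))" by (rule summable_comparison_test_ev)
  qed
  moreover have "AE s in coin_tosses. \<forall>w\<in>{1..}. \<exists>k. s \<notin> cyl (heavy_event w k)"
    using AE_escapes_heavy by (subst AE_ball_countable) auto
  ultimately show ?thesis
  proof eventually_elim
    fix s
    assume "eventually (\<lambda>j. s \<in> space coin_tosses - C j) sequentially" and esc: "\<forall>w\<in>{1..}. \<exists>k. s \<notin> cyl (heavy_event w k)"
    then obtain j1 where j1: "\<And>j. j1 \<le> j \<Longrightarrow> s \<notin> C j" by (auto simp: eventually_sequentially)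
    define j0 where "j0 = max 1 j1"
    obtain kk where kk: "\<And>w. 1 \<le> w \<Longrightarrow> s \<notin> cyl (heavy_event w (kk w))" using esc by (metis atLeast_iff)
    \<comment> \<open>The sum dominates each of the finitely many bounds for small \<open>w\<close>.\<close>
    define K where "K = (\<Sum>w\<in>{1..<2 ^ j0::int}. kk w)"
    have "real (min_local_time (walk s) n) \<le> real K + 1 + (1 + \<epsilon>) * log 2 (log 2 (2 * real n + 2))" if n: "1 \<le> n" for n
    proof -
      define f where "f = min_local_time (walk s) n"
      obtain w where w: "1 \<le> w" "w \<le> 2 * (int n + 1)" "s \<in> cyl (heavy_event w f)"
        using min_local_time_heavy[OF n, of f s] by (auto simp: f_def)
      have small: "f < k" if "s \<notin> cyl (heavy_event w k)" for k
        using heavy_event_antimono[of k f w] w(3) that by (meson linorder_not_le subsetD)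
      have l2: "2 \<le> log 2 (2 * real n + 2)"
      proof -
        have "log 2 4 \<le> log 2 (2 * real n + 2)" using n by (subst log_le_cancel_iff) auto
        moreover have "log 2 4 = (2::real)" using log_pow_cancel[of 2 2] by simp
        ultimately show ?thesis by simp
      qed
      then have ll0: "0 \<le> (1 + \<epsilon>) * log 2 (log 2 (2 * real n + 2))" using \<epsilon> by simp
      show ?thesis
      proof (cases "w < 2 ^ j0")
        case True
        have "f < kk w" using small kk[OF w(1)] by blast
        also have "kk w \<le> K" unfolding K_def using True w(1) by (intro member_le_sum) auto
        finally have "real f \<le> real K" by simp
        then show ?thesis using ll0 unfolding f_def by linarith
      next
        case False
        define j where "j = nat \<lfloor>log 2 (real_of_int w)\<rfloor>"
        have "real j0 \<le> log 2 (real_of_int w)"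
        proof -
          have "real_of_int (2 ^ j0) \<le> real_of_int w" using False by (subst of_int_le_iff) simp
          then have "log 2 (2 ^ j0) \<le> log 2 (real_of_int w)" using w(1) by (subst log_le_cancel_iff) auto
          then show ?thesis by simp
        qed
        then have j: "j0 \<le> j" "real j \<le> log 2 (real_of_int w)" "log 2 (real_of_int w) < real j + 1"
          unfolding j_def by linarith+
        have "w \<in> {2 ^ j..<2 ^ Suc j}"
        proof -
          have "2 powr real j \<le> real_of_int w" "real_of_int w < 2 powr (real j + 1)"
            using j(2,3) w(1) by (simp_all add: le_log_iff[symmetric] log_less_iff[symmetric])
          then have "real_of_int (2 ^ j) \<le> real_of_int w" "real_of_int w < real_of_int (2 ^ Suc j)"
            by (simp_all add: powr_realpow powr_add)
          then show ?thesis unfolding of_int_le_iff of_int_less_iff by simp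
        qed
        then have "s \<notin> cyl (heavy_event w (Suc (c j)))" using j1[of j] j(1) by (auto simp: C_def cyl_def j0_def)
        then have "real f \<le> c j" using small by force
        also have "\<dots> \<le> (1 + \<epsilon>) * log 2 (real j) + 1" using c(2)[of j] j(1) by (simp add: j0_def)
        also have "\<dots> \<le> (1 + \<epsilon>) * log 2 (log 2 (2 * real n + 2)) + 1"
        proof -
          have "real_of_int w \<le> real_of_int (2 * (int n + 1))" using w(2) by (subst of_int_le_iff)
          then have "log 2 (real_of_int w) \<le> log 2 (2 * real n + 2)" using w(1) by (subst log_le_cancel_iff) auto
          then have "real j \<le> log 2 (2 * real n + 2)" using j(2) by linarith
          then have "log 2 (real j) \<le> log 2 (log 2 (2 * real n + 2))" using j(1) l2 by (subst log_le_cancel_iff) (auto simp: j0_def)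
          then show ?thesis using \<epsilon> by (simp add: mult_left_mono)
        qed
        finally show ?thesis unfolding f_def by linarith
      qed
    qed
    then show "\<exists>K. \<forall>n\<ge>1. real (min_local_time (walk s) n) \<le> real K + 1 + (1 + \<epsilon>) * log 2 (log 2 (2 * real n + 2))" by blast
  qed
qed

section \<open>The limit superior\<close>

lemma limsup_upper:
  assumes "\<And>n. 1 \<le> n \<Longrightarrow> real (f n) \<le> real K + 1 + (1 + \<epsilon>) * log 2 (log 2 (2 * real n + 2))" "0 < \<epsilon>"
  shows "limsup (\<lambda>n. ereal (real (f n) / ln (ln (real n)))) \<le> ereal ((1 + \<epsilon>) / ln 2)"
proof -
  define g where "g n = (real K + 1 + (1 + \<epsilon>) * log 2 (log 2 (2 * real n + 2))) / ln (ln (real n))" for n :: nat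
  have "g \<longlonglongrightarrow> (1 + \<epsilon>) * inverse (ln 2)" unfolding g_def using assms(2) by real_asymp
  then have "g \<longlonglongrightarrow> (1 + \<epsilon>) / ln 2" by (simp only: divide_inverse)
  then have "(\<lambda>n. ereal (g n)) \<longlonglongrightarrow> ereal ((1 + \<epsilon>) / ln 2)" by simp
  then have "limsup (\<lambda>n. ereal (g n)) = ereal ((1 + \<epsilon>) / ln 2)" by (intro lim_imp_Limsup) auto
  moreover have "limsup (\<lambda>n. ereal (real (f n) / ln (ln (real n)))) \<le> limsup (\<lambda>n. ereal (g n))"
  proof (rule Limsup_mono)
    have "eventually (\<lambda>n::nat. 0 < ln (ln (real n))) sequentially" by real_asymp
    then show "eventually (\<lambda>n. ereal (real (f n) / ln (ln (real n))) \<le> ereal (g n)) sequentially"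
      using eventually_ge_at_top[of 1]
      by eventually_elim (auto simp: g_def intro!: divide_right_mono assms(1))
  qed
  ultimately show ?thesis by simp
qed

text \<open>
  The bound \<open>f n \<le> n + 1\<close> forces the times \<open>n\<close> to be unbounded, as the values of \<open>f\<close> are.
\<close>

lemma limsup_lower:
  assumes inf: "\<exists>\<^sub>\<infinity>i. \<exists>n. nat \<lfloor>(1 - \<delta>) * log 2 (real i)\<rfloor> \<le> f n \<and> n \<le> 512 * 6561 ^ i"
    and f: "\<And>n. f n \<le> n + 1" and \<delta>: "0 < \<delta>" "\<delta> < 1"
  shows "ereal ((1 - \<delta>) / ln 2) \<le> limsup (\<lambda>n. ereal (real (f n) / ln (ln (real n))))"
proof (rule ccontr)
  assume "\<not> ?thesis"
  then have "limsup (\<lambda>n. ereal (real (f n) / ln (ln (real n)))) < ereal ((1 - \<delta>) / ln 2)" by (simp only: not_le)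
  then obtain c where c: "limsup (\<lambda>n. ereal (real (f n) / ln (ln (real n)))) < ereal c" "ereal c < ereal ((1 - \<delta>) / ln 2)"
    using ereal_dense2 by blast
  from Limsup_lessD[OF c(1)] obtain N where N: "\<And>n. N \<le> n \<Longrightarrow> real (f n) / ln (ln (real n)) < c"
    by (auto simp: eventually_sequentially)
  have "(\<lambda>i::nat. ((1 - \<delta>) * log 2 (real i) - 1) / ln (ln (512 * 6561 ^ i))) \<longlonglongrightarrow> (1 - \<delta>) * inverse (ln 2)" using \<delta> by real_asymp
  then have "(\<lambda>i::nat. ((1 - \<delta>) * log 2 (real i) - 1) / ln (ln (512 * 6561 ^ i))) \<longlonglongrightarrow> (1 - \<delta>) / ln 2" by (simp only: divide_inverse)
  then have e1: "eventually (\<lambda>i::nat. c < ((1 - \<delta>) * log 2 (real i) - 1) / ln (ln (512 * 6561 ^ i))) sequentially"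
    using c(2) by (intro order_tendstoD(1)) auto
  have e2: "eventually (\<lambda>i::nat. real N + 6 < (1 - \<delta>) * log 2 (real i)) sequentially" using \<delta> by real_asymp
  have "eventually (\<lambda>i. \<not> (\<exists>n. nat \<lfloor>(1 - \<delta>) * log 2 (real i)\<rfloor> \<le> f n \<and> n \<le> 512 * 6561 ^ i)) sequentially"
    using e1 e2
  proof (eventually_elim, intro notI, elim exE conjE)
    fix i n
    assume i: "c < ((1 - \<delta>) * log 2 (real i) - 1) / ln (ln (512 * 6561 ^ i))" "real N + 6 < (1 - \<delta>) * log 2 (real i)"
      and n: "nat \<lfloor>(1 - \<delta>) * log 2 (real i)\<rfloor> \<le> f n" "n \<le> 512 * 6561 ^ i"
    define x where "x = (1 - \<delta>) * log 2 (real i)"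
    have fx: "x - 1 \<le> real (f n)" using n(1) unfolding x_def[symmetric] by linarith
    then have "real N + 4 \<le> real n" using f[of n] i(2) unfolding x_def[symmetric] by linarith
    \<comment> \<open>\<open>4 \<le> n\<close> makes \<open>ln (ln n)\<close> positive.\<close>
    then have nN: "N \<le> n" "4 \<le> n" by linarith+
    have "1 < ln (real n)"
    proof -
      have "exp 1 < real n" using exp_le nN(2) by linarith
      then have "ln (exp 1) < ln (real n)" using nN(2) by (subst ln_less_cancel_iff) auto
      then show ?thesis by simp
    qed
    then have l0: "0 < ln (ln (real n))" by simp
    have "real n \<le> real (512 * 6561 ^ i)" using n(2) by (subst of_nat_le_iff)
    then have "ln (real n) \<le> ln (512 * 6561 ^ i)" using nN(2) by (subst ln_le_cancel_iff) auto
    then have l1: "ln (ln (real n)) \<le> ln (ln (512 * 6561 ^ i))"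
      by (rule ln_mono) (use \<open>1 < ln (real n)\<close> in linarith)
    have "(x - 1) / ln (ln (512 * 6561 ^ i)) \<le> (x - 1) / ln (ln (real n))"
      using l0 l1 i(2) unfolding x_def[symmetric] by (intro divide_left_mono mult_pos_pos) auto
    also have "\<dots> \<le> real (f n) / ln (ln (real n))" using fx l0 by (intro divide_right_mono) auto
    finally have "c < real (f n) / ln (ln (real n))" using i(1) unfolding x_def[symmetric] by linarith
    then show False using N[OF nN(1)] by simp
  qed
  then show False using inf unfolding cofinite_eq_sequentially[symmetric] frequently_def by simp
qed

lemma min_local_time_le: "min_local_time f n \<le> n + 1"
proof -
  have "f 0 \<in> visited_sites f n" by (auto simp: visited_sites_def)
  then have "min_local_time f n \<le> local_time f (f 0) n" using min_local_time_ge_iff[of "min_local_time f n" f n] by blast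
  also have "\<dots> \<le> card {..n}" unfolding local_time_def by (intro card_mono) auto
  finally show ?thesis by simp
qed

theorem limsup_min_local_time_coin_tosses:
  "AE s in coin_tosses. limsup (\<lambda>n. ereal (real (min_local_time (walk s) n) / ln (ln (real n)))) = ereal (1 / ln 2)"
proof -
  have u: "AE s in coin_tosses. \<forall>m::nat. \<exists>K. \<forall>n\<ge>1. real (min_local_time (walk s) n) \<le>
      real K + 1 + (1 + 1 / real (m + 2)) * log 2 (log 2 (2 * real n + 2))"
    unfolding AE_all_countable by (intro allI min_local_time_upper) simp
  have l: "AE s in coin_tosses. \<forall>m::nat. \<exists>\<^sub>\<infinity>i. \<exists>n. nat \<lfloor>(1 - 1 / real (m + 2)) * log 2 (real i)\<rfloor> \<le> min_local_time (walk s) n \<and> n \<le> 512 * 6561 ^ i"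
    unfolding AE_all_countable by (intro allI min_local_time_infinitely_often) simp_all
  show ?thesis using u l
  proof eventually_elim
    fix s
    assume u: "\<forall>m::nat. \<exists>K. \<forall>n\<ge>1. real (min_local_time (walk s) n) \<le>
        real K + 1 + (1 + 1 / real (m + 2)) * log 2 (log 2 (2 * real n + 2))"
      and l: "\<forall>m::nat. \<exists>\<^sub>\<infinity>i. \<exists>n. nat \<lfloor>(1 - 1 / real (m + 2)) * log 2 (real i)\<rfloor> \<le> min_local_time (walk s) n \<and> n \<le> 512 * 6561 ^ i"
    let ?L = "limsup (\<lambda>n. ereal (real (min_local_time (walk s) n) / ln (ln (real n))))"
    have le: "?L \<le> ereal ((1 + 1 / real (m + 2)) / ln 2)" for m
      using u[rule_format, of m] by (elim exE) (rule limsup_upper[where \<epsilon>="1 / real (m + 2)"], auto)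
    have ge: "ereal ((1 - 1 / real (m + 2)) / ln 2) \<le> ?L" for m
      by (rule limsup_lower[OF l[rule_format, of m] min_local_time_le]) simp_all
    have "(\<lambda>m::nat. (1 + 1 / real (m + 2)) / ln 2) \<longlonglongrightarrow> inverse (ln 2)" by real_asymp
    then have "(\<lambda>m::nat. ereal ((1 + 1 / real (m + 2)) / ln 2)) \<longlonglongrightarrow> ereal (1 / ln 2)"
      by (simp only: inverse_eq_divide lim_ereal)
    then have "?L \<le> ereal (1 / ln 2)" by (rule LIMSEQ_le_const) (use le in auto)
    moreover have "(\<lambda>m::nat. (1 - 1 / real (m + 2)) / ln 2) \<longlonglongrightarrow> inverse (ln 2)" by real_asymp
    then have "(\<lambda>m::nat. ereal ((1 - 1 / real (m + 2)) / ln 2)) \<longlonglongrightarrow> ereal (1 / ln 2)"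
      by (simp only: inverse_eq_divide lim_ereal)
    then have "ereal (1 / ln 2) \<le> ?L" by (rule LIMSEQ_le_const2) (use ge in auto)
    ultimately show "?L = ereal (1 / ln 2)" by (rule antisym)
  qed
qed

definition up_steps :: "(nat \<Rightarrow> 'a \<Rightarrow> int) \<Rightarrow> 'a \<Rightarrow> bool stream" where
  "up_steps S \<omega> = to_stream (\<lambda>n. S (Suc n) \<omega> - S n \<omega> = 1)"

context simple_symmetric_random_walk
begin

lemma measurable_step[measurable]: "(\<lambda>\<omega>. S (Suc n) \<omega> - S n \<omega>) \<in> M \<rightarrow>\<^sub>M count_space UNIV"
  using steps_indep unfolding indep_vars_def by simp

text \<open>
  The indicators of upward steps are independent and fair.
\<close>

lemma distr_up_steps: "distr M coin_tosses (up_steps S) = coin_tosses"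
proof -
  let ?B = "measure_pmf (bernoulli_pmf (1/2))"
  define X where "X n \<omega> \<longleftrightarrow> S (Suc n) \<omega> - S n \<omega> = 1" for n \<omega>
  have X[measurable]: "X n \<in> M \<rightarrow>\<^sub>M count_space UNIV" for n
    unfolding X_def by (rule measurable_compose[OF measurable_step, where g="\<lambda>d. d = 1"]) simp
  have "indep_vars (\<lambda>_. count_space UNIV) (\<lambda>n \<omega>. (\<lambda>d. d = 1) (S (Suc n) \<omega> - S n \<omega>)) UNIV"
    by (rule indep_vars_compose2[OF steps_indep]) simp
  then have ind: "indep_vars (\<lambda>_. count_space UNIV) X UNIV" by (simp add: X_def[abs_def])
  have B: "distr M (count_space UNIV) (X n) = ?B" for n
  proof (rule measure_eqI_countable[where A=UNIV])
    fix b :: bool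
    have T: "prob {\<omega> \<in> space M. X n \<omega>} = 1/2" using step_up[of n] by (simp add: X_def)
    moreover have "prob {\<omega> \<in> space M. \<not> X n \<omega>} = 1 - prob {\<omega> \<in> space M. X n \<omega>}"
      by (rule prob_neg) measurable
    ultimately have p: "prob (X n -` {b} \<inter> space M) = 1/2"
      by (cases b) (auto simp: vimage_def Int_def conj_commute)
    have "emeasure (distr M (count_space UNIV) (X n)) {b} = emeasure M (X n -` {b} \<inter> space M)"
      by (rule emeasure_distr[OF X]) simp
    also have "\<dots> = ennreal (1/2)" by (simp only: emeasure_eq_measure p)
    also have "\<dots> = emeasure ?B {b}" by (cases b) (auto simp: emeasure_pmf_single)
    finally show "emeasure (distr M (count_space UNIV) (X n)) {b} = emeasure ?B {b}" .
  qed auto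
  have P: "distr M (\<Pi>\<^sub>M n\<in>UNIV. count_space UNIV) (\<lambda>\<omega>. \<lambda>n\<in>UNIV. X n \<omega>) = (\<Pi>\<^sub>M n\<in>(UNIV::nat set). ?B)"
    using ind by (subst (asm) indep_vars_iff_distr_eq_PiM) (auto simp: B)
  have ts: "to_stream \<in> (\<Pi>\<^sub>M n\<in>(UNIV::nat set). count_space (UNIV::bool set)) \<rightarrow>\<^sub>M coin_tosses"
    unfolding measurable_cong_sets[OF refl sets_coin_tosses] by (rule measurable_to_stream)
  have XM: "(\<lambda>\<omega>. \<lambda>n\<in>UNIV. X n \<omega>) \<in> M \<rightarrow>\<^sub>M (\<Pi>\<^sub>M n\<in>(UNIV::nat set). count_space (UNIV::bool set))"
    by (rule measurable_restrict) (rule X)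
  have "up_steps S = to_stream \<circ> (\<lambda>\<omega>. \<lambda>n\<in>UNIV. X n \<omega>)"
    by (auto simp: up_steps_def X_def fun_eq_iff restrict_def)
  then have "distr M coin_tosses (up_steps S) = distr (\<Pi>\<^sub>M n\<in>(UNIV::nat set). ?B) coin_tosses to_stream"
    unfolding P[symmetric] by (simp add: distr_distr[OF ts XM])
  also have "\<dots> = coin_tosses"
    using stream_space_eq_distr[of ?B] by (simp add: coin_tosses_def)
  finally show ?thesis .
qed

lemma measurable_up_steps: "up_steps S \<in> M \<rightarrow>\<^sub>M coin_tosses"
proof -
  have "(\<lambda>\<omega>. up_steps S \<omega> !! n) \<in> M \<rightarrow>\<^sub>M count_space UNIV" for n
    unfolding up_steps_def to_stream_def
    by simp
  then show ?thesis
    unfolding measurable_cong_sets[OF refl sets_coin_tosses] by (rule measurable_stream_space2)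
qed

lemma AE_walk_up_steps: "AE \<omega> in M. \<forall>n. walk (up_steps S \<omega>) n = S n \<omega>"
proof -
  have "AE \<omega> in M. S (Suc n) \<omega> - S n \<omega> = 1 \<or> S (Suc n) \<omega> - S n \<omega> = - 1" for n
  proof -
    have "prob ({\<omega> \<in> space M. S (Suc n) \<omega> - S n \<omega> = 1} \<union> {\<omega> \<in> space M. S (Suc n) \<omega> - S n \<omega> = - 1}) =
        prob {\<omega> \<in> space M. S (Suc n) \<omega> - S n \<omega> = 1} + prob {\<omega> \<in> space M. S (Suc n) \<omega> - S n \<omega> = - 1}"
      by (rule finite_measure_Union) (measurable, auto)
    then have "prob ({\<omega> \<in> space M. S (Suc n) \<omega> - S n \<omega> = 1} \<union> {\<omega> \<in> space M. S (Suc n) \<omega> - S n \<omega> = - 1}) = 1"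
      using step_up[of n] step_down[of n] by simp
    then have "AE \<omega> in M. \<omega> \<in> {\<omega> \<in> space M. S (Suc n) \<omega> - S n \<omega> = 1} \<union> {\<omega> \<in> space M. S (Suc n) \<omega> - S n \<omega> = - 1}"
      by (rule AE_prob_1)
    then show ?thesis by eventually_elim auto
  qed
  then have "AE \<omega> in M. \<forall>n. S (Suc n) \<omega> - S n \<omega> = 1 \<or> S (Suc n) \<omega> - S n \<omega> = - 1"
    unfolding AE_all_countable by blast
  moreover have "AE \<omega> in M. S 0 \<omega> = 0" using start by (intro AE_I2)
  ultimately show ?thesis
  proof eventually_elim
    fix \<omega>
    assume st: "\<forall>n. S (Suc n) \<omega> - S n \<omega> = 1 \<or> S (Suc n) \<omega> - S n \<omega> = - 1" and "S 0 \<omega> = 0"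
    have "walk (up_steps S \<omega>) n = S n \<omega>" for n
    proof (induction n)
      case 0
      then show ?case using \<open>S 0 \<omega> = 0\<close> by (simp add: walk_def)
    next
      case (Suc n)
      have "walk (up_steps S \<omega>) (Suc n) = walk (up_steps S \<omega>) n + step_of (up_steps S \<omega> !! n)"
        unfolding walk_def stake_Suc disp_append by simp
      also have "up_steps S \<omega> !! n \<longleftrightarrow> S (Suc n) \<omega> - S n \<omega> = 1" by (simp add: up_steps_def to_stream_def)
      finally show ?case using Suc.IH spec[OF st, of n] by (auto split: if_splits)
    qed
    then show "\<forall>n. walk (up_steps S \<omega>) n = S n \<omega>" by blast
  qed
qed

end

theorem theorem1p1:
  fixes M :: "'a measure" and S :: "nat \<Rightarrow> 'a \<Rightarrow> int"
  assumes "simple_symmetric_random_walk M S"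
  shows "AE \<omega> in M.
    limsup (\<lambda>n. ereal (real (min_local_time (\<lambda>k. S k \<omega>) n) / ln (ln (real n)))) = ereal (1 / ln 2)"
proof -
  interpret simple_symmetric_random_walk M S by fact
  have "AE s in distr M coin_tosses (up_steps S).
      limsup (\<lambda>n. ereal (real (min_local_time (walk s) n) / ln (ln (real n)))) = ereal (1 / ln 2)"
    unfolding distr_up_steps by (rule limsup_min_local_time_coin_tosses)
  then have "AE \<omega> in M.
      limsup (\<lambda>n. ereal (real (min_local_time (walk (up_steps S \<omega>)) n) / ln (ln (real n)))) = ereal (1 / ln 2)"
    by (rule AE_distrD[OF measurable_up_steps])
  with AE_walk_up_steps show ?thesis
  proof eventually_elim
    fix \<omega>
    assume "\<forall>n. walk (up_steps S \<omega>) n = S n \<omega>"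
      and lim: "limsup (\<lambda>n. ereal (real (min_local_time (walk (up_steps S \<omega>)) n) / ln (ln (real n)))) = ereal (1 / ln 2)"
    then have "walk (up_steps S \<omega>) = (\<lambda>k. S k \<omega>)" by (simp add: fun_eq_iff)
    then show "limsup (\<lambda>n. ereal (real (min_local_time (\<lambda>k. S k \<omega>) n) / ln (ln (real n)))) = ereal (1 / ln 2)"
      using lim by (simp only:)
  qed
qed

end
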